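(* Let $\mathcal{L}$ be a unimodular network concentrated on trees. Then $\Sigma_{p.p.}(\mathcal{L})\subseteq\mathbb{A}$, where $\mathbb{A}$ is the ring of totally real algebraic integers.
   Context: Unimodular networks. Let $\mathcal{G}_\star$ be the set of isomorphism classes of connected, locally finite, countable rooted graphs $(G,o)$ (isomorphisms preserve the root). It is a Polish space under the distance $1/(1+R)$, where $R$ is the supremum of the $r\ge 0$ such that the balls of radius $r$ around the two roots are isomorphic as rooted graphs. Let $\mathcal{G}_{\star\star}$ be the analogous space of doubly rooted graphs $(G,x,y)$. A probability measure $\mathcal{L}$ on $\mathcal{G}_\star$ (or a random rooted graph $(G,o)\sim\mathcal{L}$) is called unimodular, or a unimodular network, if for every Borel $f\colon\mathcal{G}_{\star\star}\to[0,\infty]$, $\mathbb{E}[\sum_{x\in V(G)}f(G,o,x)]=\mathbb{E}[\sum_{x\in V(G)}f(G,x,o)]$. It is concentrated on trees if $G$ is almost surely a tree. Spectral measures. For a countable locally finite graph $G=(V,E)$, the adjacency operator $A$ acts on finitely supported functions in $\ell^2_{\mathbb{C}}(V)$, with $\langle \mathfrak{e}_x|A\mathfrak{e}_y\rangle=1$ if $\{x,y\}\in E$ and $0$ otherwise, where $(\mathfrak{e}_x)_{x\in V}$ is the canonical basis. $G$ is called self-adjoint if $A$ is essentially self-adjoint. In that case, for $o\in V$, $\mu_{(G,o)}$ is the unique Borel probability measure on $\mathbb{R}$ such that $\langle \mathfrak{e}_o|(A-z)^{-1}\mathfrak{e}_o\rangle=\int_{\mathbb{R}}\frac{1}{\xi-z}\,\mu_{(G,o)}(d\xi)$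 for all $z\in\mathbb{C}\setminus\mathbb{R}$. It is known that under any unimodular network, $G$ is almost surely self-adjoint; one sets $\mu_{\mathcal{L}}(\cdot):=\mathbb{E}[\mu_{(G,o)}(\cdot)]$ with $(G,o)\sim\mathcal{L}$. The pure-point support is $\Sigma_{p.p.}(\mathcal{L}):=\{\lambda\in\mathbb{R}\colon\mu_{\mathcal{L}}(\{\lambda\})>0\}$. $\mathbb{A}$ is the set of totally real algebraic integers, i.e. roots of monic polynomials with integer coefficients all of whose complex roots are real. *)

theory Defs
  imports "HOL-Probability.Probability" "HOL-Library.Diagonal_Subsequence"
    "HOL-Computational_Algebra.Polynomial"
begin

section \<open>Graphs, balls and isomorphisms\<close>

text \<open>
  A connected, locally finite graph is countable, so that up to isomorphism its vertex set is a
  set of natural numbers.  Edges are stored as a symmetric, irreflexive relation.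
\<close>

datatype graph = Graph (verts: "nat set") (edges: "(nat \<times> nat) set")

definition connected_lf_graph :: "graph \<Rightarrow> bool" where
  "connected_lf_graph G \<longleftrightarrow>
     edges G \<subseteq> verts G \<times> verts G \<and> sym (edges G) \<and> irrefl (edges G) \<and>
     (\<forall>x\<in>verts G. finite (edges G `` {x})) \<and>
     (\<forall>x\<in>verts G. \<forall>y\<in>verts G. (x, y) \<in> (edges G)\<^sup>*)"

definition cycle_in :: "graph \<Rightarrow> nat list \<Rightarrow> bool" where
  "cycle_in G p \<longleftrightarrow> 3 \<le> length p \<and> distinct p \<and>
     (\<forall>i<length p. (p ! i, p ! (Suc i mod length p)) \<in> edges G)"

definition tree :: "graph \<Rightarrow> bool" where
  "tree G \<longleftrightarrow> connected_lf_graph G \<and> (\<nexists>p. cycle_in G p)"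

text \<open>
  Rooted and doubly rooted graphs are treated uniformly as graphs with a list of roots.  The ball
  of radius \<open>r\<close> is the subgraph induced by the vertices at graph distance at most \<open>r\<close> from some
  root; for two roots this is the union of the two balls.
\<close>

definition ball_verts :: "graph \<Rightarrow> nat list \<Rightarrow> real \<Rightarrow> nat set" where
  "ball_verts G xs r = {v. \<exists>s\<in>set xs. \<exists>n. real n \<le> r \<and> (s, v) \<in> edges G ^^ n}"

definition graph_ball :: "graph \<Rightarrow> nat list \<Rightarrow> real \<Rightarrow> graph" where
  "graph_ball G xs r =
     Graph (ball_verts G xs r) (edges G \<inter> ball_verts G xs r \<times> ball_verts G xs r)"

definition iso_map :: "(nat \<Rightarrow> nat) \<Rightarrow> graph \<Rightarrow> nat list \<Rightarrow> graph \<Rightarrow> nat list \<Rightarrow> bool" where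
  "iso_map \<phi> G xs H ys \<longleftrightarrow> bij_betw \<phi> (verts G) (verts H) \<and>
     (\<forall>x\<in>verts G. \<forall>y\<in>verts G. (x, y) \<in> edges G \<longleftrightarrow> (\<phi> x, \<phi> y) \<in> edges H) \<and> map \<phi> xs = ys"

definition isomorphic :: "graph \<Rightarrow> nat list \<Rightarrow> graph \<Rightarrow> nat list \<Rightarrow> bool" where
  "isomorphic G xs H ys \<longleftrightarrow> (\<exists>\<phi>. iso_map \<phi> G xs H ys)"

definition agreement_radius :: "graph \<Rightarrow> nat list \<Rightarrow> graph \<Rightarrow> nat list \<Rightarrow> ennreal" where
  "agreement_radius G xs H ys =
     (SUP r\<in>{r. 0 \<le> r \<and> isomorphic (graph_ball G xs r) xs (graph_ball H ys r) ys}. ennreal r)"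

definition local_dist :: "graph \<Rightarrow> nat list \<Rightarrow> graph \<Rightarrow> nat list \<Rightarrow> real" where
  "local_dist G xs H ys = enn2real (1 / (1 + agreement_radius G xs H ys))"

definition wf_marked :: "graph \<Rightarrow> nat list \<Rightarrow> bool" where
  "wf_marked G xs \<longleftrightarrow> edges G \<subseteq> verts G \<times> verts G \<and> set xs \<subseteq> verts G"

lemma wf_markedI: "connected_lf_graph G \<Longrightarrow> set xs \<subseteq> verts G \<Longrightarrow> wf_marked G xs"
  by (simp add: wf_marked_def connected_lf_graph_def)

lemma iso_map_id: "iso_map (\<lambda>x. x) G xs G xs"
  by (auto simp: iso_map_def bij_betw_def)

lemma isomorphic_refl: "isomorphic G xs G xs"
  using iso_map_id isomorphic_def by blast

lemma iso_map_inv: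
  assumes "iso_map \<phi> G xs H ys" "set xs \<subseteq> verts G"
  shows "iso_map (inv_into (verts G) \<phi>) H ys G xs"
proof -
  let ?i = "inv_into (verts G) \<phi>"
  have b: "bij_betw \<phi> (verts G) (verts H)" using assms by (simp add: iso_map_def)
  have b': "bij_betw ?i (verts H) (verts G)" using b by (rule bij_betw_inv_into)
  have r: "\<phi> (?i y) = y" if "y \<in> verts H" for y using b that by (meson bij_betw_inv_into_right)
  have l: "?i (\<phi> x) = x" if "x \<in> verts G" for x using b that by (meson bij_betw_inv_into_left)
  have m: "map ?i ys = xs"
    using assms l by (auto simp: iso_map_def subset_iff intro!: map_idI)
  have "(x, y) \<in> edges H \<longleftrightarrow> (?i x, ?i y) \<in> edges G" if "x \<in> verts H" "y \<in> verts H" for x y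
  proof -
    have "?i x \<in> verts G" "?i y \<in> verts G" using b' that by (auto dest: bij_betwE)
    then show ?thesis using assms r that by (auto simp: iso_map_def)
  qed
  with b' m show ?thesis by (auto simp: iso_map_def)
qed

lemma isomorphic_sym: "isomorphic G xs H ys \<Longrightarrow> set xs \<subseteq> verts G \<Longrightarrow> isomorphic H ys G xs"
  unfolding isomorphic_def using iso_map_inv by blast

lemma iso_map_comp:
  assumes "iso_map \<phi> G xs H ys" "iso_map \<psi> H ys K zs"
  shows "iso_map (\<psi> \<circ> \<phi>) G xs K zs"
proof -
  have "\<phi> x \<in> verts H" if "x \<in> verts G" for x
    using assms that by (auto simp: iso_map_def dest: bij_betwE)
  then show ?thesis
    using assms by (auto simp: iso_map_def intro: bij_betw_trans)
qed

lemma isomorphic_trans: "isomorphic G xs H ys \<Longrightarrow> isomorphic H ys K zs \<Longrightarrow> isomorphic G xs K zs"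
  unfolding isomorphic_def using iso_map_comp by blast

lemma iso_map_roots: "iso_map \<phi> G xs H ys \<Longrightarrow> set xs \<subseteq> verts G \<Longrightarrow> set ys \<subseteq> verts H"
  unfolding iso_map_def using bij_betwE by fastforce

lemma relpow_verts:
  assumes "edges G \<subseteq> verts G \<times> verts G" "s \<in> verts G" "(s, v) \<in> edges G ^^ n"
  shows "v \<in> verts G"
  using assms(3) by (induction n arbitrary: v) (use assms in auto)

lemma ball_verts_subset: "wf_marked G xs \<Longrightarrow> ball_verts G xs r \<subseteq> verts G"
  unfolding ball_verts_def wf_marked_def using relpow_verts by blast

lemma ball_verts_mono: "r \<le> r' \<Longrightarrow> ball_verts G xs r \<subseteq> ball_verts G xs r'"
  unfolding ball_verts_def by force

lemma roots_in_ball: "0 \<le> r \<Longrightarrow> set xs \<subseteq> ball_verts G xs r"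
  unfolding ball_verts_def by (auto intro!: exI[of _ 0] bexI)

lemma wf_marked_ball: "0 \<le> r \<Longrightarrow> wf_marked (graph_ball G xs r) xs"
  using roots_in_ball by (auto simp: wf_marked_def graph_ball_def)

lemma relpow_in_ball:
  assumes "(s, v) \<in> edges G ^^ n" "s \<in> set xs" "real n \<le> r"
  shows "(s, v) \<in> edges (graph_ball G xs r) ^^ n"
  using assms(1,3)
proof (induction n arbitrary: v)
  case (Suc n)
  then obtain w where w: "(s, w) \<in> edges G ^^ n" "(w, v) \<in> edges G" by auto
  have "real n \<le> r" using Suc.prems by simp
  then have "w \<in> ball_verts G xs r" "v \<in> ball_verts G xs r"
    unfolding ball_verts_def using assms(2) Suc.prems w by blast+
  with w Suc show ?case by (auto simp: graph_ball_def)
qed auto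

lemma ball_verts_ball:
  assumes "r \<le> r'"
  shows "ball_verts (graph_ball G xs r') xs r = ball_verts G xs r"
proof -
  have "edges (graph_ball G xs r') \<subseteq> edges G" by (auto simp: graph_ball_def)
  then have "edges (graph_ball G xs r') ^^ n \<subseteq> edges G ^^ n" for n
    by (induction n) auto
  then have "(s, v) \<in> edges (graph_ball G xs r') ^^ n \<longleftrightarrow> (s, v) \<in> edges G ^^ n"
    if "s \<in> set xs" "real n \<le> r" for s v n
    using relpow_in_ball[of s v n G xs r'] that assms by auto
  then show ?thesis unfolding ball_verts_def by blast
qed

lemma graph_ball_ball: "r \<le> r' \<Longrightarrow> graph_ball (graph_ball G xs r') xs r = graph_ball G xs r"
  unfolding graph_ball_def[of _ _ r] ball_verts_ball
  using ball_verts_mono[of r r' G xs] by (auto simp: graph_ball_def)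

lemma iso_map_relpow:
  assumes "iso_map \<phi> G xs H ys" "edges G \<subseteq> verts G \<times> verts G" "(s, v) \<in> edges G ^^ n"
  shows "(\<phi> s, \<phi> v) \<in> edges H ^^ n"
  using assms(3)
proof (induction n arbitrary: v)
  case (Suc n)
  then obtain w where "(s, w) \<in> edges G ^^ n" "(w, v) \<in> edges G" by auto
  with Suc assms(1,2) have "(\<phi> s, \<phi> w) \<in> edges H ^^ n" "(\<phi> w, \<phi> v) \<in> edges H"
    by (auto simp: iso_map_def)
  then show ?case by auto
qed auto

lemma iso_map_ball_verts:
  assumes "iso_map \<phi> G xs H ys" "wf_marked G xs"
  shows "\<phi> ` ball_verts G xs r \<subseteq> ball_verts H ys r"
proof
  fix w assume "w \<in> \<phi> ` ball_verts G xs r"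
  then obtain s n v where w: "w = \<phi> v" "s \<in> set xs" "real n \<le> r" "(s, v) \<in> edges G ^^ n"
    unfolding ball_verts_def by blast
  then have "(\<phi> s, w) \<in> edges H ^^ n"
    using iso_map_relpow[OF assms(1)] assms(2) by (auto simp: wf_marked_def)
  moreover have "\<phi> s \<in> set ys" using w assms(1) by (auto simp: iso_map_def)
  ultimately show "w \<in> ball_verts H ys r" unfolding ball_verts_def using w(3) by blast
qed

lemma iso_map_wf:
  assumes "iso_map \<phi> G xs H ys" "wf_marked G xs" "edges H \<subseteq> verts H \<times> verts H"
  shows "wf_marked H ys"
  using assms iso_map_roots by (auto simp: wf_marked_def)

lemma iso_map_ball:
  assumes iso: "iso_map \<phi> G xs H ys" and wf: "wf_marked G xs" "wf_marked H ys"
  shows "iso_map \<phi> (graph_ball G xs r) xs (graph_ball H ys r) ys"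
proof -
  let ?i = "inv_into (verts G) \<phi>"
  have b: "bij_betw \<phi> (verts G) (verts H)" using iso by (simp add: iso_map_def)
  have iso': "iso_map ?i H ys G xs" using iso_map_inv iso wf by (simp add: wf_marked_def)
  have im: "\<phi> ` ball_verts G xs r = ball_verts H ys r"
  proof
    show "\<phi> ` ball_verts G xs r \<subseteq> ball_verts H ys r" using iso_map_ball_verts iso wf by blast
    show "ball_verts H ys r \<subseteq> \<phi> ` ball_verts G xs r"
    proof
      fix w assume w: "w \<in> ball_verts H ys r"
      then have "?i w \<in> ball_verts G xs r" using iso_map_ball_verts[OF iso' wf(2)] by blast
      moreover have "\<phi> (?i w) = w"
        using w ball_verts_subset[OF wf(2)] b by (meson bij_betw_inv_into_right subsetD)
      ultimately show "w \<in> \<phi> ` ball_verts G xs r" by (metis image_eqI)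
    qed
  qed
  moreover have "inj_on \<phi> (ball_verts G xs r)"
    using b ball_verts_subset[OF wf(1)] by (meson bij_betw_def inj_on_subset)
  ultimately have "bij_betw \<phi> (ball_verts G xs r) (ball_verts H ys r)"
    by (simp add: bij_betw_def)
  moreover have "ball_verts G xs r \<subseteq> verts G" using ball_verts_subset wf by blast
  ultimately show ?thesis
    using iso im by (auto simp: iso_map_def graph_ball_def)
qed

lemma isomorphic_ball:
  assumes "isomorphic G xs H ys" "wf_marked G xs" "wf_marked H ys"
  shows "isomorphic (graph_ball G xs r) xs (graph_ball H ys r) ys"
  using assms iso_map_ball unfolding isomorphic_def by blast

lemma iso_map_ball_mono:
  assumes "iso_map \<phi> (graph_ball G xs r') xs (graph_ball H ys r') ys" "0 \<le> r" "r \<le> r'"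
  shows "iso_map \<phi> (graph_ball G xs r) xs (graph_ball H ys r) ys"
  using iso_map_ball[OF assms(1), of r] assms wf_marked_ball[of r'] by (simp add: graph_ball_ball)

lemma finite_ball_verts:
  assumes "connected_lf_graph G" "set xs \<subseteq> verts G"
  shows "finite (ball_verts G xs r)"
proof -
  have lf: "finite (edges G `` {x})" for x
    using assms(1) unfolding connected_lf_graph_def
    by (cases "x \<in> verts G") (auto intro: finite_subset[of _ "{}"])
  have fin: "finite ((edges G ^^ n) `` {s})" for n s
  proof (induction n)
    case (Suc n)
    have "(edges G ^^ Suc n) `` {s} = (\<Union>x\<in>(edges G ^^ n) `` {s}. edges G `` {x})" by auto
    then show ?case using Suc lf by simp
  qed auto
  have "ball_verts G xs r \<subseteq> (\<Union>s\<in>set xs. \<Union>n\<in>{..nat \<lfloor>r\<rfloor>}. (edges G ^^ n) `` {s})"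
    unfolding ball_verts_def using le_nat_floor by blast
  then show ?thesis by (rule finite_subset) (use fin in auto)
qed

lemma ball_verts_exhaust:
  assumes "connected_lf_graph G" "set xs \<subseteq> verts G" "xs \<noteq> []" "v \<in> verts G"
  shows "\<exists>n. v \<in> ball_verts G xs (real n)"
proof -
  obtain s where "s \<in> set xs" using assms(3) by (meson ex_in_conv set_empty)
  moreover from this have "(s, v) \<in> (edges G)\<^sup>*" using assms by (auto simp: connected_lf_graph_def)
  then obtain n where "(s, v) \<in> edges G ^^ n" using rtrancl_power by blast
  ultimately show ?thesis unfolding ball_verts_def by auto
qed

lemma isomorphic_of_balls:
  assumes G: "connected_lf_graph G" "set xs \<subseteq> verts G" "xs \<noteq> []"
    and H: "connected_lf_graph H" "set ys \<subseteq> verts H" "ys \<noteq> []"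
    and balls: "\<And>n. isomorphic (graph_ball G xs (real n)) xs (graph_ball H ys (real n)) ys"
  shows "isomorphic G xs H ys"
proof -
  let ?B = "\<lambda>n. ball_verts G xs (real n)" and ?C = "\<lambda>n. ball_verts H ys (real n)"
  obtain F where F: "\<And>n. iso_map (F n) (graph_ball G xs (real n)) xs (graph_ball H ys (real n)) ys"
    using balls unfolding isomorphic_def by metis
  have Fm: "iso_map (F m) (graph_ball G xs (real n)) xs (graph_ball H ys (real n)) ys" if "n \<le> m" for m n
    using iso_map_ball_mono[OF F[of m]] that by simp
  have Fbij: "bij_betw (F m) (?B n) (?C n)" if "n \<le> m" for m n
    using Fm[OF that] by (simp add: iso_map_def graph_ball_def)
  define P where "P = (\<lambda>v (s::nat \<Rightarrow> nat). v \<in> verts G \<longrightarrow> (\<exists>c. \<forall>m. F (s m) v = c))"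
  interpret subseqs P
  proof
    fix v and s :: "nat \<Rightarrow> nat" assume s: "strict_mono s"
    show "\<exists>r. strict_mono r \<and> P v (s \<circ> r)"
    proof (cases "v \<in> verts G")
      case False
      then show ?thesis by (auto simp: P_def intro!: exI[of _ id] strict_mono_id)
    next
      case True
      then obtain k where k: "v \<in> ?B k" using ball_verts_exhaust G by blast
      have "F (s m) v \<in> (\<lambda>m. F (s m) v) ` {..<k} \<union> ?C k" for m
      proof (cases "m < k")
        case False
        then have "k \<le> s m" using s by (meson le_trans linorder_not_less strict_mono_imp_increasing)
        then show ?thesis using Fbij[of k "s m"] k bij_betwE by blast
      qed auto
      then have "range (\<lambda>m. F (s m) v) \<subseteq> (\<lambda>m. F (s m) v) ` {..<k} \<union> ?C k" by blast
      moreover have "finite ((\<lambda>m. F (s m) v) ` {..<k} \<union> ?C k)"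
        using finite_ball_verts[OF H(1,2)] by simp
      ultimately have "finite (range (\<lambda>m. F (s m) v))" by (rule finite_subset)
      then obtain c where c: "infinite {m. F (s m) v = c}"
        using pigeonhole_infinite[of UNIV "\<lambda>m. F (s m) v"] by auto
      obtain r :: "nat \<Rightarrow> nat" where "strict_mono r" "\<forall>m. r m \<in> {m. F (s m) v = c}"
        using infinite_enumerate[OF c] by blast
      then show ?thesis by (auto simp: P_def)
    qed
  qed
  have "P v (diagseq \<circ> ((+) (Suc v)))" for v
    by (rule diagseq_holds) (auto simp: P_def)
  then have "\<exists>c. \<forall>m. F (diagseq (Suc v + m)) v = c" if "v \<in> verts G" for v
    using that by (auto simp: P_def)
  then obtain f where f: "\<And>v m. v \<in> verts G \<Longrightarrow> F (diagseq (Suc v + m)) v = f v" by metis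
  have ev: "\<forall>\<^sub>F m in sequentially. F (diagseq m) v = f v" if "v \<in> verts G" for v
    unfolding eventually_sequentially
    using f[OF that] by (metis le_add_diff_inverse)
  have large: "\<forall>\<^sub>F m in sequentially. k \<le> diagseq m" for k
    using subseq_diagseq strict_mono_imp_increasing unfolding eventually_sequentially
    by (meson le_trans)
  have fin: "\<exists>m\<ge>k. \<forall>v\<in>A. F m v = f v" if "finite A" "A \<subseteq> verts G" for A k
  proof -
    have "\<forall>\<^sub>F m in sequentially. k \<le> diagseq m \<and> (\<forall>v\<in>A. F (diagseq m) v = f v)"
      using that ev large by (intro eventually_conj eventually_ball_finite) auto
    then show ?thesis unfolding eventually_sequentially by blast
  qed
  have wfG: "wf_marked G xs" and wfH: "wf_marked H ys" using G H wf_markedI by auto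
  have BV: "?B n \<subseteq> verts G" for n using ball_verts_subset[OF wfG] .
  have CV: "?C n \<subseteq> verts H" for n using ball_verts_subset[OF wfH] .
  have two: "\<exists>m k. k \<le> m \<and> x \<in> ?B k \<and> y \<in> ?B k \<and> F m x = f x \<and> F m y = f y"
    if xy: "x \<in> verts G" "y \<in> verts G" for x y
  proof -
    obtain a b where "x \<in> ?B a" "y \<in> ?B b" using ball_verts_exhaust G xy by meson
    then have "x \<in> ?B (max a b)" "y \<in> ?B (max a b)"
      using ball_verts_mono[of "real a" "real (max a b)" G xs]
        ball_verts_mono[of "real b" "real (max a b)" G xs] by auto
    moreover obtain m where "m \<ge> max a b" "\<forall>v\<in>{x, y}. F m v = f v"
      using fin[of "{x, y}" "max a b"] xy by auto
    ultimately show ?thesis by blast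
  qed
  have "inj_on f (verts G)"
  proof (rule inj_onI)
    fix x y assume xy: "x \<in> verts G" "y \<in> verts G" "f x = f y"
    then obtain m k where mk: "k \<le> m" "x \<in> ?B k" "y \<in> ?B k" "F m x = f x" "F m y = f y"
      using two by blast
    have "inj_on (F m) (?B k)" using Fbij[OF mk(1)] by (rule bij_betw_imp_inj_on)
    then show "x = y" using mk xy(3) by (metis inj_onD)
  qed
  moreover have "f ` verts G \<subseteq> verts H"
  proof
    fix w assume "w \<in> f ` verts G"
    then obtain v where v: "w = f v" "v \<in> verts G" by blast
    then obtain m k where mk: "k \<le> m" "v \<in> ?B k" "F m v = f v" using two[of v v] by blast
    then have "w \<in> ?C k" using bij_betwE[OF Fbij[OF mk(1)]] v by metis
    then show "w \<in> verts H" using CV by blast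
  qed
  moreover have "verts H \<subseteq> f ` verts G"
  proof
    fix w assume "w \<in> verts H"
    then obtain k where k: "w \<in> ?C k" using ball_verts_exhaust H by blast
    obtain m where m: "m \<ge> k" "\<forall>v\<in>?B k. F m v = f v"
      using fin[OF finite_ball_verts[OF G(1,2)] BV] by blast
    have "w \<in> F m ` ?B k" using bij_betw_imp_surj_on[OF Fbij[OF m(1)]] k by simp
    then obtain v where "v \<in> ?B k" "F m v = w" by blast
    then show "w \<in> f ` verts G" using m BV by blast
  qed
  ultimately have "bij_betw f (verts G) (verts H)" by (auto simp: bij_betw_def)
  moreover have "(x, y) \<in> edges G \<longleftrightarrow> (f x, f y) \<in> edges H"
    if xy: "x \<in> verts G" "y \<in> verts G" for x y
  proof -
    obtain m k where mk: "k \<le> m" "x \<in> ?B k" "y \<in> ?B k" "F m x = f x" "F m y = f y"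
      using two xy by blast
    moreover from this have "f x \<in> ?C k" "f y \<in> ?C k" using bij_betwE[OF Fbij[OF mk(1)]] by metis+
    ultimately show ?thesis using Fm[OF mk(1)] by (auto simp: iso_map_def graph_ball_def)
  qed
  moreover have "map f xs = ys"
  proof -
    obtain m where "\<forall>v\<in>set xs. F m v = f v" using fin[of "set xs" 0] G by auto
    then have "map f xs = map (F m) xs" by simp
    also have "\<dots> = ys" using F[of m] unfolding iso_map_def by blast
    finally show ?thesis .
  qed
  ultimately show ?thesis unfolding isomorphic_def iso_map_def by blast
qed

lemma isomorphic_ball_mono:
  assumes "isomorphic (graph_ball G xs r') xs (graph_ball H ys r') ys" "0 \<le> r" "r \<le> r'"
  shows "isomorphic (graph_ball G xs r) xs (graph_ball H ys r) ys"
  using assms iso_map_ball_mono unfolding isomorphic_def by blast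

lemma agreement_radius_ge:
  assumes "isomorphic (graph_ball G xs r) xs (graph_ball H ys r) ys" "0 \<le> r"
  shows "ennreal r \<le> agreement_radius G xs H ys"
  unfolding agreement_radius_def using assms by (intro SUP_upper) auto

lemma agreement_radius_less:
  assumes "ennreal r < agreement_radius G xs H ys" "0 \<le> r"
  shows "isomorphic (graph_ball G xs r) xs (graph_ball H ys r) ys"
proof -
  obtain r' where "ennreal r < ennreal r'" "0 \<le> r'"
    "isomorphic (graph_ball G xs r') xs (graph_ball H ys r') ys"
    using assms(1) unfolding agreement_radius_def less_SUP_iff by auto
  then show ?thesis using isomorphic_ball_mono assms(2) by (simp add: ennreal_less_iff)
qed

lemma agreement_radius_le_sym: "agreement_radius G xs H ys \<le> agreement_radius H ys G xs"
proof -
  have "isomorphic (graph_ball H ys r) ys (graph_ball G xs r) xs"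
    if "0 \<le> r" "isomorphic (graph_ball G xs r) xs (graph_ball H ys r) ys" for r
    using isomorphic_sym that wf_marked_ball by (auto simp: wf_marked_def)
  then show ?thesis
    unfolding agreement_radius_def by (intro SUP_subset_mono) auto
qed

lemma agreement_radius_sym: "agreement_radius G xs H ys = agreement_radius H ys G xs"
  by (intro antisym agreement_radius_le_sym)

lemma agreement_radius_trans:
  "min (agreement_radius G xs H ys) (agreement_radius H ys K zs) \<le> agreement_radius G xs K zs"
proof (rule dense_le)
  fix x assume x: "x < min (agreement_radius G xs H ys) (agreement_radius H ys K zs)"
  then have "x < top" by (metis min_less_iff_conj order_less_le_trans top_greatest)
  then obtain r where r: "0 \<le> r" "x = ennreal r" by (cases x) auto
  with x show "x \<le> agreement_radius G xs K zs"
    by (auto intro!: agreement_radius_ge intro: isomorphic_trans agreement_radius_less)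
qed

lemma inverse_radius:
  "1 / (1 + (R::ennreal)) = (if R = top then 0 else ennreal (1 / (1 + enn2real R)))"
proof (cases R)
  case (real r)
  then have "1 + R = ennreal (1 + r)" by (simp add: ennreal_plus flip: ennreal_1)
  moreover have "1 / ennreal (1 + r) = ennreal (1 / (1 + r))"
    using divide_ennreal[of 1 "1 + r"] real by simp
  ultimately have "1 / (1 + R) = ennreal (1 / (1 + r))" by simp
  with real show ?thesis by simp
qed simp

lemma inverse_radius_mono:
  assumes "R \<le> (R'::ennreal)"
  shows "enn2real (1 / (1 + R')) \<le> enn2real (1 / (1 + R))"
proof (cases "R' = top")
  case False
  then have "R < top" "R' < top" using assms by (auto simp: top.not_eq_extremum)
  then have "enn2real R \<le> enn2real R'" using assms enn2real_mono by blast
  then have "1 / (1 + enn2real R') \<le> 1 / (1 + enn2real R)"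
    by (intro frac_le) (auto simp: add_pos_nonneg)
  with \<open>R < top\<close> \<open>R' < top\<close> show ?thesis
    by (simp add: inverse_radius)
qed (simp add: inverse_radius)

lemma local_dist_sym: "local_dist G xs H ys = local_dist H ys G xs"
  unfolding local_dist_def by (subst agreement_radius_sym) simp

lemma local_dist_nonneg: "0 \<le> local_dist G xs H ys"
  by (simp add: local_dist_def)

lemma local_dist_triangle: "local_dist G xs K zs \<le> local_dist G xs H ys + local_dist H ys K zs"
proof -
  let ?a = "agreement_radius G xs H ys" and ?b = "agreement_radius H ys K zs"
  have "local_dist G xs K zs \<le> enn2real (1 / (1 + min ?a ?b))"
    unfolding local_dist_def by (intro inverse_radius_mono agreement_radius_trans)
  also have "\<dots> \<le> max (local_dist G xs H ys) (local_dist H ys K zs)"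
    by (auto simp: local_dist_def min_def)
  also have "\<dots> \<le> local_dist G xs H ys + local_dist H ys K zs"
    using local_dist_nonneg by (simp add: max_def)
  finally show ?thesis .
qed

lemma local_dist_eq_0_iff:
  assumes G: "connected_lf_graph G" "set xs \<subseteq> verts G" "xs \<noteq> []"
    and H: "connected_lf_graph H" "set ys \<subseteq> verts H" "ys \<noteq> []"
  shows "local_dist G xs H ys = 0 \<longleftrightarrow> isomorphic G xs H ys"
proof -
  let ?R = "agreement_radius G xs H ys"
  have "0 < 1 + enn2real ?R" by (simp add: add_pos_nonneg)
  then have "local_dist G xs H ys = 0 \<longleftrightarrow> ?R = top"
    unfolding local_dist_def inverse_radius by simp
  also have "\<dots> \<longleftrightarrow> isomorphic G xs H ys"
  proof
    assume "?R = top"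
    then have "isomorphic (graph_ball G xs (real n)) xs (graph_ball H ys (real n)) ys" for n
      by (intro agreement_radius_less) auto
    then show "isomorphic G xs H ys" using isomorphic_of_balls G H by blast
  next
    assume "isomorphic G xs H ys"
    then have "ennreal r \<le> ?R" if "0 \<le> r" for r
      using that isomorphic_ball wf_markedI G H by (intro agreement_radius_ge) auto
    then have "x \<le> ?R" if "x < top" for x
      using that by (cases x) auto
    then show "?R = top" by (metis dense_le top.extremum_uniqueI)
  qed
  finally show ?thesis .
qed

lemma local_dist_cong:
  assumes "isomorphic G xs G' xs'" "wf_marked G xs" "wf_marked G' xs'"
    and "isomorphic H ys H' ys'" "wf_marked H ys" "wf_marked H' ys'"
  shows "local_dist G xs H ys = local_dist G' xs' H' ys'"
proof -
  have "isomorphic (graph_ball G xs r) xs (graph_ball H ys r) ys \<longleftrightarrow>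
        isomorphic (graph_ball G' xs' r) xs' (graph_ball H' ys' r) ys'" if "0 \<le> r" for r
  proof -
    have "isomorphic (graph_ball G xs r) xs (graph_ball G' xs' r) xs'"
      "isomorphic (graph_ball H ys r) ys (graph_ball H' ys' r) ys'"
      using assms isomorphic_ball by blast+
    moreover have "isomorphic (graph_ball G' xs' r) xs' (graph_ball G xs r) xs"
      "isomorphic (graph_ball H' ys' r) ys' (graph_ball H ys r) ys"
      using calculation isomorphic_sym wf_marked_ball[OF that] unfolding wf_marked_def by blast+
    ultimately show ?thesis using isomorphic_trans by blast
  qed
  then show ?thesis
    unfolding local_dist_def agreement_radius_def by (metis (mono_tags, lifting) Collect_cong)
qed


section \<open>The spaces of rooted and doubly rooted graphs\<close>

quotient_type rooted_graph = "graph \<times> nat" / partial: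
  "\<lambda>(G, x) (H, y). connected_lf_graph G \<and> connected_lf_graph H \<and> x \<in> verts G \<and> y \<in> verts H \<and>
     isomorphic G [x] H [y]"
proof (rule part_equivpI)
  have "connected_lf_graph (Graph {0} {})"
    by (auto simp: connected_lf_graph_def irrefl_def sym_def)
  then show "\<exists>p. (\<lambda>(G, x) (H, y). connected_lf_graph G \<and> connected_lf_graph H \<and>
      x \<in> verts G \<and> y \<in> verts H \<and> isomorphic G [x] H [y]) p p"
    by (intro exI[of _ "(Graph {0} {}, 0)"]) (auto simp: isomorphic_refl)
qed (auto intro!: sympI transpI intro: isomorphic_sym isomorphic_trans)

quotient_type birooted_graph = "graph \<times> nat \<times> nat" / partial:
  "\<lambda>(G, x, x') (H, y, y'). connected_lf_graph G \<and> connected_lf_graph H \<and>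
     {x, x'} \<subseteq> verts G \<and> {y, y'} \<subseteq> verts H \<and> isomorphic G [x, x'] H [y, y']"
proof (rule part_equivpI)
  have "connected_lf_graph (Graph {0} {})"
    by (auto simp: connected_lf_graph_def irrefl_def sym_def)
  then show "\<exists>p. (\<lambda>(G, x, x') (H, y, y'). connected_lf_graph G \<and> connected_lf_graph H \<and>
      {x, x'} \<subseteq> verts G \<and> {y, y'} \<subseteq> verts H \<and> isomorphic G [x, x'] H [y, y']) p p"
    by (intro exI[of _ "(Graph {0} {}, 0, 0)"]) (auto simp: isomorphic_refl)
qed (auto intro!: sympI transpI intro: isomorphic_sym isomorphic_trans)

instantiation rooted_graph :: metric_space
begin

lift_definition dist_rooted_graph :: "rooted_graph \<Rightarrow> rooted_graph \<Rightarrow> real" is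
  "\<lambda>(G, x) (H, y). local_dist G [x] H [y]"
  by (auto intro!: local_dist_cong wf_markedI)

definition uniformity_rooted_graph :: "(rooted_graph \<times> rooted_graph) filter" where
  "uniformity_rooted_graph = (INF e\<in>{0<..}. principal {(g, h). dist g h < e})"

definition open_rooted_graph :: "rooted_graph set \<Rightarrow> bool" where
  "open_rooted_graph U \<longleftrightarrow> (\<forall>g\<in>U. \<forall>\<^sub>F (g', h) in uniformity. g' = g \<longrightarrow> h \<in> U)"

instance
proof
  fix g h k :: rooted_graph
  show "dist g h = 0 \<longleftrightarrow> g = h"
    by transfer (auto simp: local_dist_eq_0_iff)
  have "dist h k = dist k h"
    by transfer (auto simp: local_dist_sym)
  moreover have "dist g h \<le> dist g k + dist k h"
    by transfer (auto simp: local_dist_triangle)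
  ultimately show "dist g h \<le> dist g k + dist h k" by simp
qed (rule uniformity_rooted_graph_def open_rooted_graph_def)+

end

instantiation birooted_graph :: metric_space
begin

lift_definition dist_birooted_graph :: "birooted_graph \<Rightarrow> birooted_graph \<Rightarrow> real" is
  "\<lambda>(G, x, x') (H, y, y'). local_dist G [x, x'] H [y, y']"
  by (auto intro!: local_dist_cong wf_markedI)

definition uniformity_birooted_graph :: "(birooted_graph \<times> birooted_graph) filter" where
  "uniformity_birooted_graph = (INF e\<in>{0<..}. principal {(g, h). dist g h < e})"

definition open_birooted_graph :: "birooted_graph set \<Rightarrow> bool" where
  "open_birooted_graph U \<longleftrightarrow> (\<forall>g\<in>U. \<forall>\<^sub>F (g', h) in uniformity. g' = g \<longrightarrow> h \<in> U)"

instance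
proof
  fix g h k :: birooted_graph
  show "dist g h = 0 \<longleftrightarrow> g = h"
    by transfer (auto simp: local_dist_eq_0_iff)
  have "dist h k = dist k h"
    by transfer (auto simp: local_dist_sym)
  moreover have "dist g h \<le> dist g k + dist k h"
    by transfer (auto simp: local_dist_triangle)
  ultimately show "dist g h \<le> dist g k + dist h k" by simp
qed (rule uniformity_birooted_graph_def open_birooted_graph_def)+

end


section \<open>Unimodular networks\<close>

lemma cycle_in_iso:
  assumes "iso_map \<phi> G xs H ys" "cycle_in G p" "edges G \<subseteq> verts G \<times> verts G"
  shows "cycle_in H (map \<phi> p)"
proof -
  have p: "3 \<le> length p" "distinct p"
    and e: "\<And>i. i < length p \<Longrightarrow> (p ! i, p ! (Suc i mod length p)) \<in> edges G"
    using assms(2) by (auto simp: cycle_in_def)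
  have "set p \<subseteq> verts G" using e assms(3) by (fastforce simp: in_set_conv_nth)
  then have "inj_on \<phi> (set p)"
    using assms(1) by (meson bij_betw_def inj_on_subset iso_map_def)
  moreover have "(\<phi> (p ! i), \<phi> (p ! (Suc i mod length p))) \<in> edges H" if "i < length p" for i
    using e[OF that] assms(1,3) by (auto simp: iso_map_def)
  moreover have "Suc i mod length p < length p" for i
    using p by (intro mod_less_divisor) auto
  ultimately show ?thesis using p by (simp add: cycle_in_def distinct_map)
qed

lift_definition is_tree :: "rooted_graph \<Rightarrow> bool" is "\<lambda>(G, x). tree G"
proof clarsimp
  fix G H :: graph and x y :: nat
  assume *: "connected_lf_graph G" "connected_lf_graph H" "x \<in> verts G" "y \<in> verts H"
    "isomorphic G [x] H [y]"
  then obtain \<phi> \<psi> where "iso_map \<phi> G [x] H [y]" "iso_map \<psi> H [y] G [x]"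
    using isomorphic_sym[of G "[x]" H "[y]"] by (auto simp: isomorphic_def)
  moreover have "edges G \<subseteq> verts G \<times> verts G" "edges H \<subseteq> verts H \<times> verts H"
    using * by (auto simp: connected_lf_graph_def)
  ultimately show "tree G = tree H"
    using * cycle_in_iso unfolding tree_def by meson
qed

lemma abs_birooted_graph_cong:
  assumes "connected_lf_graph G" "connected_lf_graph H" "{x, x'} \<subseteq> verts G"
    and "iso_map \<phi> G xs H ys"
  shows "abs_birooted_graph (G, x, x') = abs_birooted_graph (H, \<phi> x, \<phi> x')"
proof -
  have "iso_map \<phi> G [x, x'] H [\<phi> x, \<phi> x']" using assms by (simp add: iso_map_def)
  moreover from this have "{\<phi> x, \<phi> x'} \<subseteq> verts H" using iso_map_roots assms(3) by fastforce
  ultimately show ?thesis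
    using assms by (intro Quotient_rel_abs[OF Quotient_birooted_graph]) (auto simp: isomorphic_def)
qed

text \<open>The total mass sent and received by the root under the transport \<open>f\<close>.\<close>

lift_definition mass_sent :: "(birooted_graph \<Rightarrow> ennreal) \<Rightarrow> rooted_graph \<Rightarrow> ennreal" is
  "\<lambda>f (G, x). \<integral>\<^sup>+ y. f (abs_birooted_graph (G, x, y)) \<partial>count_space (verts G)"
proof clarsimp
  fix f :: "birooted_graph \<Rightarrow> ennreal" and G H x y
  assume *: "connected_lf_graph G" "connected_lf_graph H" "x \<in> verts G" "isomorphic G [x] H [y]"
  then obtain \<phi> where \<phi>: "iso_map \<phi> G [x] H [y]" by (auto simp: isomorphic_def)
  then have "(\<integral>\<^sup>+ v. f (abs_birooted_graph (H, y, v)) \<partial>count_space (verts H)) =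
    (\<integral>\<^sup>+ v. f (abs_birooted_graph (H, \<phi> x, \<phi> v)) \<partial>count_space (verts G))"
    by (subst nn_integral_bij_count_space[symmetric, of \<phi> "verts G"]) (auto simp: iso_map_def)
  also have "\<dots> = (\<integral>\<^sup>+ v. f (abs_birooted_graph (G, x, v)) \<partial>count_space (verts G))"
    using abs_birooted_graph_cong[OF *(1,2) _ \<phi>] *(3) by (intro nn_integral_cong) simp
  finally show "(\<integral>\<^sup>+ v. f (abs_birooted_graph (G, x, v)) \<partial>count_space (verts G)) =
    (\<integral>\<^sup>+ v. f (abs_birooted_graph (H, y, v)) \<partial>count_space (verts H))" by simp
qed

lift_definition mass_received :: "(birooted_graph \<Rightarrow> ennreal) \<Rightarrow> rooted_graph \<Rightarrow> ennreal" is
  "\<lambda>f (G, x). \<integral>\<^sup>+ y. f (abs_birooted_graph (G, y, x)) \<partial>count_space (verts G)"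
proof clarsimp
  fix f :: "birooted_graph \<Rightarrow> ennreal" and G H x y
  assume *: "connected_lf_graph G" "connected_lf_graph H" "x \<in> verts G" "isomorphic G [x] H [y]"
  then obtain \<phi> where \<phi>: "iso_map \<phi> G [x] H [y]" by (auto simp: isomorphic_def)
  then have "(\<integral>\<^sup>+ v. f (abs_birooted_graph (H, v, y)) \<partial>count_space (verts H)) =
    (\<integral>\<^sup>+ v. f (abs_birooted_graph (H, \<phi> v, \<phi> x)) \<partial>count_space (verts G))"
    by (subst nn_integral_bij_count_space[symmetric, of \<phi> "verts G"]) (auto simp: iso_map_def)
  also have "\<dots> = (\<integral>\<^sup>+ v. f (abs_birooted_graph (G, v, x)) \<partial>count_space (verts G))"
    using abs_birooted_graph_cong[OF *(1,2) _ \<phi>] *(3) by (intro nn_integral_cong) simp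
  finally show "(\<integral>\<^sup>+ v. f (abs_birooted_graph (G, v, x)) \<partial>count_space (verts G)) =
    (\<integral>\<^sup>+ v. f (abs_birooted_graph (H, v, y)) \<partial>count_space (verts H))" by simp
qed

definition unimodular :: "rooted_graph measure \<Rightarrow> bool" where
  "unimodular L \<longleftrightarrow> prob_space L \<and> sets L = sets borel \<and>
     (\<forall>f\<in>borel_measurable borel. (\<integral>\<^sup>+ g. mass_sent f g \<partial>L) = (\<integral>\<^sup>+ g. mass_received f g \<partial>L))"

definition concentrated_on_trees :: "rooted_graph measure \<Rightarrow> bool" where
  "concentrated_on_trees L \<longleftrightarrow> (AE g in L. is_tree g)"


section \<open>Operators on square-summable functions\<close>

text \<open>
  Functions on a vertex set \<open>V\<close> are extended by zero to all natural numbers.  An (unbounded)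
  operator is represented by its graph, a set of pairs of vectors.
\<close>

definition ell2 :: "nat set \<Rightarrow> (nat \<Rightarrow> complex) set" where
  "ell2 V = {f. (\<forall>x. x \<notin> V \<longrightarrow> f x = 0) \<and> (\<lambda>x. (cmod (f x))\<^sup>2) summable_on V}"

definition ell2_inner :: "nat set \<Rightarrow> (nat \<Rightarrow> complex) \<Rightarrow> (nat \<Rightarrow> complex) \<Rightarrow> complex" where
  "ell2_inner V f g = (\<Sum>\<^sub>\<infinity>x\<in>V. cnj (f x) * g x)"

definition ell2_norm :: "nat set \<Rightarrow> (nat \<Rightarrow> complex) \<Rightarrow> real" where
  "ell2_norm V f = sqrt (\<Sum>\<^sub>\<infinity>x\<in>V. (cmod (f x))\<^sup>2)"

definition basis_vec :: "nat \<Rightarrow> nat \<Rightarrow> complex" where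
  "basis_vec x = (\<lambda>y. if y = x then 1 else 0)"

type_synonym operator = "((nat \<Rightarrow> complex) \<times> (nat \<Rightarrow> complex)) set"

definition op_closure :: "nat set \<Rightarrow> operator \<Rightarrow> operator" where
  "op_closure V T = {(f, g). f \<in> ell2 V \<and> g \<in> ell2 V \<and>
     (\<exists>F H. (\<forall>n::nat. (F n, H n) \<in> T) \<and>
        (\<lambda>n. ell2_norm V (\<lambda>x. F n x - f x)) \<longlonglongrightarrow> 0 \<and>
        (\<lambda>n. ell2_norm V (\<lambda>x. H n x - g x)) \<longlonglongrightarrow> 0)}"

definition op_adjoint :: "nat set \<Rightarrow> operator \<Rightarrow> operator" where
  "op_adjoint V T = {(f, g). f \<in> ell2 V \<and> g \<in> ell2 V \<and>
     (\<forall>(h, k)\<in>T. ell2_inner V f k = ell2_inner V g h)}"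

definition self_adjoint_op :: "nat set \<Rightarrow> operator \<Rightarrow> bool" where
  "self_adjoint_op V T \<longleftrightarrow> op_adjoint V T = T"

definition essentially_self_adjoint_op :: "nat set \<Rightarrow> operator \<Rightarrow> bool" where
  "essentially_self_adjoint_op V T \<longleftrightarrow> self_adjoint_op V (op_closure V T)"

text \<open>\<open>resolvent_op T z\<close> is the graph of the inverse of \<open>T - z\<close>.\<close>

definition resolvent_op :: "operator \<Rightarrow> complex \<Rightarrow> operator" where
  "resolvent_op T z = {(\<lambda>x. g x - z * f x, f) | f g. (f, g) \<in> T}"

definition adjacency_op :: "graph \<Rightarrow> operator" where
  "adjacency_op G = {(f, \<lambda>x. \<Sum>y\<in>edges G `` {x}. f y) | f.
     finite {x. f x \<noteq> 0} \<and> {x. f x \<noteq> 0} \<subseteq> verts G}"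

definition self_adjoint_graph :: "graph \<Rightarrow> bool" where
  "self_adjoint_graph G \<longleftrightarrow> essentially_self_adjoint_op (verts G) (adjacency_op G)"

definition resolvent_entry :: "graph \<Rightarrow> complex \<Rightarrow> nat \<Rightarrow> complex" where
  "resolvent_entry G z x = (THE c. \<exists>f.
     (basis_vec x, f) \<in> resolvent_op (op_closure (verts G) (adjacency_op G)) z \<and>
     c = ell2_inner (verts G) (basis_vec x) f)"

text \<open>
  The value for graphs that are not self-adjoint is a convention without influence on averages
  over unimodular networks, under which almost every graph is self-adjoint.
\<close>

definition spectral_measure_at :: "graph \<Rightarrow> nat \<Rightarrow> real measure" where
  "spectral_measure_at G x =
     (if self_adjoint_graph G
      then THE \<mu>. prob_space \<mu> \<and> sets \<mu> = sets borel \<and>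
             (\<forall>z. z \<notin> \<real> \<longrightarrow> resolvent_entry G z x = (\<integral>\<xi>. 1 / (complex_of_real \<xi> - z) \<partial>\<mu>))
      else null_measure borel)"

definition pull :: "nat set \<Rightarrow> (nat \<Rightarrow> nat) \<Rightarrow> (nat \<Rightarrow> complex) \<Rightarrow> nat \<Rightarrow> complex" where
  "pull V \<phi> h = (\<lambda>x. if x \<in> V then h (\<phi> x) else 0)"

definition pulls_into :: "nat set \<Rightarrow> (nat \<Rightarrow> nat) \<Rightarrow> operator \<Rightarrow> operator \<Rightarrow> bool" where
  "pulls_into V \<phi> T' T \<longleftrightarrow> (\<forall>(f, g)\<in>T'. (pull V \<phi> f, pull V \<phi> g) \<in> T)"

lemma pull_ell2:
  assumes "bij_betw \<phi> V W" "h \<in> ell2 W"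
  shows "pull V \<phi> h \<in> ell2 V"
proof -
  have "(\<lambda>x. (cmod (h (\<phi> x)))\<^sup>2) summable_on V"
    using assms(2) summable_on_reindex_bij_betw[OF assms(1), of "\<lambda>x. (cmod (h x))\<^sup>2"]
    by (simp add: ell2_def)
  then have "(\<lambda>x. (cmod (pull V \<phi> h x))\<^sup>2) summable_on V"
    by (rule summable_on_cong[THEN iffD1, rotated]) (simp add: pull_def)
  then show ?thesis by (simp add: ell2_def pull_def)
qed

lemma pull_inner:
  assumes "bij_betw \<phi> V W"
  shows "ell2_inner V (pull V \<phi> f) (pull V \<phi> g) = ell2_inner W f g"
proof -
  have "ell2_inner V (pull V \<phi> f) (pull V \<phi> g) = (\<Sum>\<^sub>\<infinity>x\<in>V. cnj (f (\<phi> x)) * g (\<phi> x))"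
    unfolding ell2_inner_def by (rule infsum_cong) (simp add: pull_def)
  also have "\<dots> = ell2_inner W f g"
    unfolding ell2_inner_def
    by (rule infsum_reindex_bij_betw[OF assms, of "\<lambda>x. cnj (f x) * g x"])
  finally show ?thesis .
qed

lemma pull_norm_diff:
  assumes "bij_betw \<phi> V W"
  shows "ell2_norm V (\<lambda>x. pull V \<phi> f x - pull V \<phi> g x) = ell2_norm W (\<lambda>x. f x - g x)"
proof -
  have "(\<Sum>\<^sub>\<infinity>x\<in>V. (cmod (pull V \<phi> f x - pull V \<phi> g x))\<^sup>2) =
      (\<Sum>\<^sub>\<infinity>x\<in>V. (cmod (f (\<phi> x) - g (\<phi> x)))\<^sup>2)"
    by (rule infsum_cong) (simp add: pull_def)
  also have "\<dots> = (\<Sum>\<^sub>\<infinity>x\<in>W. (cmod (f x - g x))\<^sup>2)"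
    by (rule infsum_reindex_bij_betw[OF assms, of "\<lambda>x. (cmod (f x - g x))\<^sup>2"])
  finally show ?thesis by (simp add: ell2_norm_def)
qed

lemma pull_inv:
  assumes "bij_betw \<phi> V W" "f \<in> ell2 V"
  shows "pull V \<phi> (pull W (inv_into V \<phi>) f) = f"
proof
  fix x
  have "\<phi> x \<in> W" "inv_into V \<phi> (\<phi> x) = x" if "x \<in> V"
    using that assms(1) by (auto dest: bij_betwE intro: bij_betw_inv_into_left)
  then show "pull V \<phi> (pull W (inv_into V \<phi>) f) x = f x"
    using assms(2) by (auto simp: pull_def ell2_def)
qed

lemma inv_pull:
  assumes "bij_betw \<phi> V W" "f \<in> ell2 W"
  shows "pull W (inv_into V \<phi>) (pull V \<phi> f) = f"
proof
  fix x
  have "inv_into V \<phi> x \<in> V" "\<phi> (inv_into V \<phi> x) = x" if "x \<in> W"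
    using that assms(1) bij_betwE[OF bij_betw_inv_into[OF assms(1)]]
    by (auto intro: bij_betw_inv_into_right)
  then show "pull W (inv_into V \<phi>) (pull V \<phi> f) x = f x"
    using assms(2) by (auto simp: pull_def ell2_def)
qed

lemma pulls_into_adjacency:
  assumes iso: "iso_map \<phi> G xs H ys"
    and sub: "edges G \<subseteq> verts G \<times> verts G" "edges H \<subseteq> verts H \<times> verts H"
  shows "pulls_into (verts G) \<phi> (adjacency_op H) (adjacency_op G)"
proof -
  let ?V = "verts G"
  have bij: "bij_betw \<phi> ?V (verts H)" using iso by (simp add: iso_map_def)
  have "(pull ?V \<phi> f, pull ?V \<phi> (\<lambda>x. \<Sum>y\<in>edges H `` {x}. f y)) \<in> adjacency_op G"
    if f: "finite {x. f x \<noteq> 0}" for f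
  proof -
    have sup: "{x. pull ?V \<phi> f x \<noteq> 0} \<subseteq> ?V" by (auto simp: pull_def)
    have inj: "inj_on \<phi> {x. pull ?V \<phi> f x \<noteq> 0}"
      using inj_on_subset[OF bij_betw_imp_inj_on[OF bij] sup] .
    have "\<phi> ` {x. pull ?V \<phi> f x \<noteq> 0} \<subseteq> {x. f x \<noteq> 0}"
      by (auto simp: pull_def split: if_splits)
    then have "finite (\<phi> ` {x. pull ?V \<phi> f x \<noteq> 0})" using f by (rule finite_subset)
    then have fin: "finite {x. pull ?V \<phi> f x \<noteq> 0}" using inj by (rule finite_imageD)
    have "pull ?V \<phi> (\<lambda>x. \<Sum>y\<in>edges H `` {x}. f y) = (\<lambda>x. \<Sum>y\<in>edges G `` {x}. pull ?V \<phi> f y)"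
    proof
      fix x
      show "pull ?V \<phi> (\<lambda>x. \<Sum>y\<in>edges H `` {x}. f y) x = (\<Sum>y\<in>edges G `` {x}. pull ?V \<phi> f y)"
      proof (cases "x \<in> ?V")
        case False
        then have "edges G `` {x} = {}" using sub by auto
        with False show ?thesis by (simp add: pull_def)
      next
        case True
        have nb: "edges G `` {x} \<subseteq> ?V" using sub by auto
        have "edges H `` {\<phi> x} \<subseteq> \<phi> ` ?V" using sub bij by (auto simp: bij_betw_def)
        moreover have "(\<phi> x, \<phi> y) \<in> edges H \<longleftrightarrow> (x, y) \<in> edges G" if "y \<in> ?V" for y
          using iso True that by (simp add: iso_map_def)
        ultimately have "edges H `` {\<phi> x} = \<phi> ` (edges G `` {x})"
          using nb by blast
        moreover have "inj_on \<phi> (edges G `` {x})"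
          using bij nb by (meson bij_betw_def inj_on_subset)
        ultimately have "(\<Sum>y\<in>edges H `` {\<phi> x}. f y) = (\<Sum>y\<in>edges G `` {x}. f (\<phi> y))"
          by (simp add: sum.reindex)
        also have "\<dots> = (\<Sum>y\<in>edges G `` {x}. pull ?V \<phi> f y)"
          using nb by (intro sum.cong) (auto simp: pull_def)
        finally show ?thesis using True by (simp add: pull_def)
      qed
    qed
    with fin sup show ?thesis by (auto simp: adjacency_op_def)
  qed
  then show ?thesis by (auto simp: pulls_into_def adjacency_op_def)
qed

lemma pulls_into_closure:
  assumes bij: "bij_betw \<phi> V W" and into: "pulls_into V \<phi> T' T"
  shows "pulls_into V \<phi> (op_closure W T') (op_closure V T)"
proof -
  have "(pull V \<phi> f, pull V \<phi> g) \<in> op_closure V T" if fg: "(f, g) \<in> op_closure W T'" for f g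
  proof -
    obtain F H where F: "\<And>n::nat. (F n, H n) \<in> T'"
      "(\<lambda>n. ell2_norm W (\<lambda>x. F n x - f x)) \<longlonglongrightarrow> 0" "(\<lambda>n. ell2_norm W (\<lambda>x. H n x - g x)) \<longlonglongrightarrow> 0"
      using fg unfolding op_closure_def by blast
    have "f \<in> ell2 W" "g \<in> ell2 W" using fg by (auto simp: op_closure_def)
    then have "pull V \<phi> f \<in> ell2 V" "pull V \<phi> g \<in> ell2 V" using pull_ell2 bij by auto
    moreover have "\<forall>n. (pull V \<phi> (F n), pull V \<phi> (H n)) \<in> T"
      using F(1) into by (auto simp: pulls_into_def)
    moreover have "(\<lambda>n. ell2_norm V (\<lambda>x. pull V \<phi> (F n) x - pull V \<phi> f x)) \<longlonglongrightarrow> 0"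
      "(\<lambda>n. ell2_norm V (\<lambda>x. pull V \<phi> (H n) x - pull V \<phi> g x)) \<longlonglongrightarrow> 0"
      using F(2,3) by (simp_all add: pull_norm_diff[OF bij])
    ultimately show ?thesis
      unfolding op_closure_def mem_Collect_eq prod.case
      by (intro conjI exI[of _ "\<lambda>n. pull V \<phi> (F n)"] exI[of _ "\<lambda>n. pull V \<phi> (H n)"])
  qed
  then show ?thesis by (auto simp: pulls_into_def)
qed

lemma pulls_into_adjoint:
  assumes bij: "bij_betw \<phi> V W" and into: "pulls_into W (inv_into V \<phi>) T T'"
    and sub: "T \<subseteq> ell2 V \<times> ell2 V"
  shows "pulls_into V \<phi> (op_adjoint W T') (op_adjoint V T)"
proof -
  let ?\<psi> = "inv_into V \<phi>"
  have "(pull V \<phi> f, pull V \<phi> g) \<in> op_adjoint V T" if fg: "(f, g) \<in> op_adjoint W T'" for f g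
  proof -
    have "ell2_inner V (pull V \<phi> f) k = ell2_inner V (pull V \<phi> g) h" if hk: "(h, k) \<in> T" for h k
    proof -
      have "(pull W ?\<psi> h, pull W ?\<psi> k) \<in> T'" using hk into by (auto simp: pulls_into_def)
      then have "ell2_inner W f (pull W ?\<psi> k) = ell2_inner W g (pull W ?\<psi> h)"
        using fg by (auto simp: op_adjoint_def)
      moreover have "h = pull V \<phi> (pull W ?\<psi> h)" "k = pull V \<phi> (pull W ?\<psi> k)"
        using pull_inv[OF bij] hk sub by auto
      ultimately show ?thesis using pull_inner[OF bij] by metis
    qed
    moreover have "f \<in> ell2 W" "g \<in> ell2 W" using fg by (auto simp: op_adjoint_def)
    then have "pull V \<phi> f \<in> ell2 V" "pull V \<phi> g \<in> ell2 V" using pull_ell2 bij by auto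
    ultimately show ?thesis by (auto simp: op_adjoint_def)
  qed
  then show ?thesis by (auto simp: pulls_into_def)
qed

lemma op_closure_subset: "op_closure V T \<subseteq> ell2 V \<times> ell2 V"
  by (auto simp: op_closure_def)

lemma op_adjoint_subset: "op_adjoint V T \<subseteq> ell2 V \<times> ell2 V"
  by (auto simp: op_adjoint_def)

lemma pulls_into_eq:
  assumes bij: "bij_betw \<phi> V W" and into: "pulls_into V \<phi> T' T" "pulls_into W (inv_into V \<phi>) T T'"
    and sub: "T \<subseteq> ell2 V \<times> ell2 V" "T' \<subseteq> ell2 W \<times> ell2 W"
  shows "(f, g) \<in> T' \<longleftrightarrow> f \<in> ell2 W \<and> g \<in> ell2 W \<and> (pull V \<phi> f, pull V \<phi> g) \<in> T"
proof
  assume "f \<in> ell2 W \<and> g \<in> ell2 W \<and> (pull V \<phi> f, pull V \<phi> g) \<in> T"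
  then have "f \<in> ell2 W" "g \<in> ell2 W"
    "(pull W (inv_into V \<phi>) (pull V \<phi> f), pull W (inv_into V \<phi>) (pull V \<phi> g)) \<in> T'"
    using into(2) by (auto simp: pulls_into_def)
  then show "(f, g) \<in> T'" by (simp add: inv_pull[OF bij])
qed (use into(1) sub in \<open>auto simp: pulls_into_def\<close>)

lemma iso_map_closure:
  assumes "iso_map \<phi> G xs H ys" "wf_marked G xs" "wf_marked H ys"
  shows "pulls_into (verts G) \<phi> (op_closure (verts H) (adjacency_op H)) (op_closure (verts G) (adjacency_op G))"
    and "pulls_into (verts H) (inv_into (verts G) \<phi>)
      (op_closure (verts G) (adjacency_op G)) (op_closure (verts H) (adjacency_op H))"
proof -
  have "bij_betw \<phi> (verts G) (verts H)" using assms by (simp add: iso_map_def)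
  note * = this bij_betw_inv_into[OF this]
  have "iso_map (inv_into (verts G) \<phi>) H ys G xs" using assms iso_map_inv by (simp add: wf_marked_def)
  with assms * show "pulls_into (verts G) \<phi> (op_closure (verts H) (adjacency_op H)) (op_closure (verts G) (adjacency_op G))"
    "pulls_into (verts H) (inv_into (verts G) \<phi>)
      (op_closure (verts G) (adjacency_op G)) (op_closure (verts H) (adjacency_op H))"
    by (auto intro!: pulls_into_closure pulls_into_adjacency simp: wf_marked_def)
qed

lemma self_adjoint_graph_iso:
  assumes iso: "iso_map \<phi> G xs H ys" and wf: "wf_marked G xs" "wf_marked H ys"
    and sa: "self_adjoint_graph G"
  shows "self_adjoint_graph H"
proof -
  let ?T = "op_closure (verts G) (adjacency_op G)" and ?T' = "op_closure (verts H) (adjacency_op H)"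
  have bij: "bij_betw \<phi> (verts G) (verts H)" using iso by (simp add: iso_map_def)
  have bij': "bij_betw (inv_into (verts G) \<phi>) (verts H) (verts G)" using bij by (rule bij_betw_inv_into)
  have adj: "op_adjoint (verts G) ?T = ?T"
    using sa by (simp add: self_adjoint_graph_def essentially_self_adjoint_op_def self_adjoint_op_def)
  note into = iso_map_closure[OF iso wf]
  have "pulls_into (verts G) \<phi> (op_adjoint (verts H) ?T') (op_adjoint (verts G) ?T)"
    using pulls_into_adjoint[OF bij into(2) op_closure_subset] .
  moreover have "pulls_into (verts H) (inv_into (verts G) \<phi>) (op_adjoint (verts G) ?T) (op_adjoint (verts H) ?T')"
  proof -
    have "(pull (verts H) (inv_into (verts G) \<phi>) f, pull (verts H) (inv_into (verts G) \<phi>) g)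
        \<in> op_adjoint (verts H) ?T'" if fg: "(f, g) \<in> op_adjoint (verts G) ?T" for f g
    proof -
      have f: "f \<in> ell2 (verts G)" "g \<in> ell2 (verts G)" using fg by (auto simp: op_adjoint_def)
      let ?p = "pull (verts H) (inv_into (verts G) \<phi>)"
      have "ell2_inner (verts H) (?p f) k = ell2_inner (verts H) (?p g) h" if hk: "(h, k) \<in> ?T'" for h k
      proof -
        have "(pull (verts G) \<phi> h, pull (verts G) \<phi> k) \<in> ?T"
          using hk into(1) by (auto simp: pulls_into_def)
        then have "ell2_inner (verts G) f (pull (verts G) \<phi> k) = ell2_inner (verts G) g (pull (verts G) \<phi> h)"
          using fg by (auto simp: op_adjoint_def)
        then show ?thesis
          by (metis pull_inner[OF bij] pull_inv[OF bij f(1)] pull_inv[OF bij f(2)])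
      qed
      then show ?thesis using pull_ell2[OF bij'] f by (auto simp: op_adjoint_def)
    qed
    then show ?thesis by (auto simp: pulls_into_def)
  qed
  ultimately have "(f, g) \<in> op_adjoint (verts H) ?T' \<longleftrightarrow> (f, g) \<in> ?T'" for f g
    using pulls_into_eq[OF bij _ _ op_adjoint_subset op_adjoint_subset, of ?T' ?T f g]
      pulls_into_eq[OF bij into op_closure_subset op_closure_subset, of f g] adj by simp
  then have "op_adjoint (verts H) ?T' = ?T'" by auto
  then show ?thesis
    by (simp add: self_adjoint_graph_def essentially_self_adjoint_op_def self_adjoint_op_def)
qed

lemma resolvent_entry_iso:
  assumes iso: "iso_map \<phi> G [x] H [y]" and wf: "wf_marked G [x]" "wf_marked H [y]"
    and f: "(basis_vec y, f) \<in> resolvent_op (op_closure (verts H) (adjacency_op H)) z"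
  shows "\<exists>f'. (basis_vec x, f') \<in> resolvent_op (op_closure (verts G) (adjacency_op G)) z \<and>
     ell2_inner (verts H) (basis_vec y) f = ell2_inner (verts G) (basis_vec x) f'"
proof -
  let ?p = "pull (verts G) \<phi>"
  have bij: "bij_betw \<phi> (verts G) (verts H)" and y: "y = \<phi> x" and x: "x \<in> verts G"
    using iso wf by (auto simp: iso_map_def wf_marked_def)
  obtain g where g: "(f, g) \<in> op_closure (verts H) (adjacency_op H)"
    and e: "basis_vec y = (\<lambda>x. g x - z * f x)"
    using f by (auto simp: resolvent_op_def)
  have b: "?p (basis_vec y) = basis_vec x"
    using bij x unfolding y by (auto simp: pull_def basis_vec_def fun_eq_iff bij_betw_def inj_on_def)
  have "(?p f, ?p g) \<in> op_closure (verts G) (adjacency_op G)"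
    using g iso_map_closure(1)[OF iso wf] by (auto simp: pulls_into_def)
  moreover have "basis_vec x = (\<lambda>v. ?p g v - z * ?p f v)"
    unfolding b[symmetric] e by (auto simp: pull_def)
  ultimately have "(basis_vec x, ?p f) \<in> resolvent_op (op_closure (verts G) (adjacency_op G)) z"
    by (auto simp: resolvent_op_def)
  moreover have "ell2_inner (verts H) (basis_vec y) f = ell2_inner (verts G) (basis_vec x) (?p f)"
    using pull_inner[OF bij] b by metis
  ultimately show ?thesis by blast
qed

lift_definition spectral_measure :: "rooted_graph \<Rightarrow> real measure" is
  "\<lambda>(G, x). spectral_measure_at G x"
proof clarsimp
  fix G H x y
  assume *: "connected_lf_graph G" "connected_lf_graph H" "x \<in> verts G" "y \<in> verts H"
    "isomorphic G [x] H [y]"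
  then have wf: "wf_marked G [x]" "wf_marked H [y]" by (auto intro: wf_markedI)
  obtain \<phi> where \<phi>: "iso_map \<phi> G [x] H [y]" using * by (auto simp: isomorphic_def)
  obtain \<psi> where \<psi>: "iso_map \<psi> H [y] G [x]"
    using isomorphic_sym[OF *(5)] *(3) by (auto simp: isomorphic_def)
  have "self_adjoint_graph G = self_adjoint_graph H"
    using self_adjoint_graph_iso \<phi> \<psi> wf by blast
  moreover have "resolvent_entry G z x = resolvent_entry H z y" for z
  proof -
    have "(\<exists>f. (basis_vec x, f) \<in> resolvent_op (op_closure (verts G) (adjacency_op G)) z \<and>
            c = ell2_inner (verts G) (basis_vec x) f) =
          (\<exists>f. (basis_vec y, f) \<in> resolvent_op (op_closure (verts H) (adjacency_op H)) z \<and>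
            c = ell2_inner (verts H) (basis_vec y) f)" for c
      using resolvent_entry_iso[OF \<phi> wf] resolvent_entry_iso[OF \<psi> wf(2,1)] by metis
    then show ?thesis unfolding resolvent_entry_def by simp
  qed
  ultimately show "spectral_measure_at G x = spectral_measure_at H y"
    unfolding spectral_measure_at_def by simp
qed

definition mean_spectral_measure :: "rooted_graph measure \<Rightarrow> real set \<Rightarrow> ennreal" where
  "mean_spectral_measure L B = (\<integral>\<^sup>+ g. emeasure (spectral_measure g) B \<partial>L)"

definition pure_point_support :: "rooted_graph measure \<Rightarrow> real set" where
  "pure_point_support L = {x. mean_spectral_measure L {x} > 0}"

definition totally_real_algebraic_integers :: "real set" where
  "totally_real_algebraic_integers =
     {x. \<exists>p::int poly. lead_coeff p = 1 \<and> poly (map_poly of_int p) x = 0 \<and>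
        (\<forall>z::complex. poly (map_poly of_int p) z = 0 \<longrightarrow> z \<in> \<real>)}"

end

(* Cut a square-summable eigenfunction phi with phi x = 0 along an edge {x, y} of a self-adjoint
   tree: the restriction of phi to the branch at y solves (A - l) phi' = phi(y) e_x, so by symmetry
   phi(y) psi(x) = 0 for every eigenfunction psi.  Hence along a connected component C of the set of
   vertices charged by the eigenspace, all evaluations are proportional, and the projection P onto
   the eigenspace satisfies |P(y,x)|^2 = P(x,x) P(y,y) for x, y in C.  The transport
   |P(y,x)|^2 / P(y,y) sends mass at most 1, while x receives at least |C| P(x,x); by unimodularity
   C is almost surely finite whenever P(x,x) > 0, and then l is an eigenvalue of the finite tree C.
   The transport is Borel because it is an iterated limit of quantities computed from the resolvents
   of finite balls; the same limits produce the spectral measure. *)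

theory Submission
  imports Defs "HOL-Computational_Algebra.Fundamental_Theorem_Algebra"
    "HOL-Real_Asymp.Real_Asymp" "Jordan_Normal_Form.Char_Poly"
begin

text \<open>The exact transport \<open>|P(y,x)|^2 / P(y,y)\<close> is not visibly a Borel function
  of the doubly rooted graph. It is replaced by \<open>\<eta> |g(x)|^2 / Im g(y)\<close>, where
  \<open>g\<close> is the column at \<open>y\<close> of the resolvent of a finite ball at
  \<open>z = l + i \<eta>\<close>. This depends on a finite part of the graph only, so it is locally
  constant. The quotient has this form because \<open>-i \<eta> (A - z)^-1\<close> tends to
  \<open>P\<close> as \<eta> tends to 0, and because \<open>\<eta> ||g||^2 = Im g(y)\<close> holds
  exactly on each ball. The approximations therefore already send mass at most 1, and Fatou's lemma
  carries the bound to the iterated liminf on every graph, self-adjoint or not. Self-adjointness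
  enters on the receiving side, where an atom of the spectral measure provides it: it identifies the
  limits and gives symmetry for eigenfunctions cut along an edge, whose support may be infinite. All
  limits over balls follow one pattern: a uniform l2 bound gives pointwise limit points, each limit
  point solves an equation, and this equation has a single solution.\<close>

subsection \<open>Eigenfunction expansions on finite graphs\<close>

definition fin_graph :: "graph \<Rightarrow> bool" where
  "fin_graph H \<longleftrightarrow> finite (verts H) \<and> edges H \<subseteq> verts H \<times> verts H \<and> sym (edges H)"

text \<open>The adjacency operator on arbitrary functions: local finiteness makes it meaningful
  pointwise, without any domain.\<close>

definition nbsum :: "graph \<Rightarrow> (nat \<Rightarrow> complex) \<Rightarrow> nat \<Rightarrow> complex" where
  "nbsum G f v = (\<Sum>w\<in>edges G `` {v}. f w)"

text \<open>Gaussian elimination, one point of \<open>V\<close> at a time. It later yields a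
  polynomial in the adjacency operator that annihilates a given function.\<close>

lemma linearly_dependent_functions:
  fixes u :: "'i \<Rightarrow> 'a \<Rightarrow> 'f::field"
  assumes "finite V" "finite I" "card V < card I"
  shows "\<exists>c. (\<exists>i\<in>I. c i \<noteq> 0) \<and> (\<forall>v\<in>V. (\<Sum>i\<in>I. c i * u i v) = 0)"
  using assms
proof (induction V arbitrary: I u)
  case empty
  then have "I \<noteq> {}" by auto
  then show ?case by (intro exI[of _ "\<lambda>_. 1"]) auto
next
  case (insert a V)
  show ?case
  proof (cases "\<forall>i\<in>I. u i a = 0")
    case True
    have "card V < card I" using insert by simp
    from insert.IH[OF insert.prems(1) this, of u] obtain c
      where "\<exists>i\<in>I. c i \<noteq> 0" "\<forall>v\<in>V. (\<Sum>i\<in>I. c i * u i v) = 0" by blast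
    with True show ?thesis by (intro exI[of _ c]) simp
  next
    case False
    then obtain j where j: "j \<in> I" "u j a \<noteq> 0" by blast
    \<comment> \<open>Subtracting a multiple of the pivot \<open>u j\<close> kills the value at
      \<open>a\<close>. The coefficient that \<open>d\<close> gives to \<open>j\<close> below turns
      a relation among the \<open>u'\<close> into one among the \<open>u\<close>.\<close>
    define u' where "u' = (\<lambda>i v. u i v - u i a / u j a * u j v)"
    have "finite (I - {j})" "card V < card (I - {j})" using insert j by auto
    from insert.IH[OF this, of u'] obtain c where c: "\<exists>i\<in>I - {j}. c i \<noteq> 0"
      "\<forall>v\<in>V. (\<Sum>i\<in>I - {j}. c i * u' i v) = 0" by blast
    define d where "d = (\<lambda>i. if i = j then - (\<Sum>i\<in>I - {j}. c i * (u i a / u j a)) else c i)"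
    have "(\<Sum>i\<in>I. d i * u i v) = (\<Sum>i\<in>I - {j}. c i * u' i v)" for v
    proof -
      have "(\<Sum>i\<in>I. d i * u i v) = d j * u j v + (\<Sum>i\<in>I - {j}. d i * u i v)"
        using insert.prems(1) j(1) by (rule sum.remove)
      also have "(\<Sum>i\<in>I - {j}. d i * u i v) = (\<Sum>i\<in>I - {j}. c i * u i v)"
        by (intro sum.cong) (auto simp: d_def)
      finally show ?thesis
        by (simp add: d_def u'_def right_diff_distrib sum_subtractf sum_distrib_right mult.assoc)
    qed
    moreover have "(\<Sum>i\<in>I - {j}. c i * u' i a) = 0" using j by (simp add: u'_def)
    moreover have "\<exists>i\<in>I. d i \<noteq> 0" using c(1) by (auto simp: d_def)
    ultimately show ?thesis using c(2) by (intro exI[of _ d]) auto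
  qed
qed

lemma nbsum_cong: "(\<And>w. w \<in> edges G `` {v} \<Longrightarrow> f w = g w) \<Longrightarrow> nbsum G f v = nbsum G g v"
  unfolding nbsum_def by (rule sum.cong) auto

lemma nbsum_diff: "nbsum G (\<lambda>w. f w - g w) v = nbsum G f v - nbsum G g v"
  unfolding nbsum_def by (rule sum_subtractf)

lemma nbsum_cmult: "nbsum G (\<lambda>w. c * f w) v = c * nbsum G f v"
  unfolding nbsum_def by (rule sum_distrib_left[symmetric])

lemma nbsum_divide: "nbsum G (\<lambda>w. f w / c) v = nbsum G f v / c"
  unfolding nbsum_def by (rule sum_divide_distrib[symmetric])

lemma nbsum_sum: "nbsum G (\<lambda>w. \<Sum>i\<in>I. f i w) v = (\<Sum>i\<in>I. nbsum G (f i) v)"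
  unfolding nbsum_def by (rule sum.swap)

lemma nbsum_cong_verts:
  assumes "edges G \<subseteq> verts G \<times> verts G" "\<And>w. w \<in> verts G \<Longrightarrow> f w = g w"
  shows "nbsum G f v = nbsum G g v"
  using assms by (intro nbsum_cong) auto

lemma funpow_nbsum_minus:
  "(nbsum G ^^ i) (\<lambda>v. nbsum G f v - a * f v) = (\<lambda>v. (nbsum G ^^ Suc i) f v - a * (nbsum G ^^ i) f v)"
  by (induction i) (auto simp: nbsum_diff nbsum_cmult)

lemma nbsum_symmetric:
  assumes "fin_graph H"
  shows "(\<Sum>v\<in>verts H. cnj (f v) * nbsum H g v) = (\<Sum>v\<in>verts H. cnj (nbsum H f v) * g v)"
proof -
  let ?V = "verts H"
  have H: "finite ?V" "edges H \<subseteq> ?V \<times> ?V" "sym (edges H)" using assms by (auto simp: fin_graph_def)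
  have nb: "edges H `` {v} = {w \<in> ?V. (v, w) \<in> edges H}" "edges H `` {v} = {w \<in> ?V. (w, v) \<in> edges H}" for v
    using H(2,3) by (auto dest: symD)
  have "(\<Sum>v\<in>?V. cnj (f v) * nbsum H g v)
      = (\<Sum>v\<in>?V. \<Sum>w\<in>?V. if (v, w) \<in> edges H then cnj (f v) * g w else 0)"
    unfolding nbsum_def nb(1) using H(1)
    by (simp add: sum_distrib_left sum.inter_filter if_distrib[of "\<lambda>c. _ * c"] cong: if_cong)
  also have "\<dots> = (\<Sum>w\<in>?V. \<Sum>v\<in>?V. if (v, w) \<in> edges H then cnj (f v) * g w else 0)"
    by (rule sum.swap)
  also have "\<dots> = (\<Sum>v\<in>?V. cnj (nbsum H f v) * g v)"
    unfolding nbsum_def nb(2) using H(1)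
    by (simp add: sum_distrib_right sum.inter_filter if_distrib[of "\<lambda>c. c * _"] if_distrib[of cnj] cong: if_cong)
  finally show ?thesis .
qed

lemma sum_cnj_self: "(\<Sum>v\<in>V. cnj (f v) * f v) = of_real (\<Sum>v\<in>V. (cmod (f v))\<^sup>2)"
  by (simp add: complex_norm_square mult.commute del: of_real_power)

lemma sum_cmod_sq_eq_0:
  assumes "finite V" "(\<Sum>v\<in>V. cnj (f v) * f v) = 0"
  shows "\<forall>v\<in>V. f v = 0"
proof -
  have "(\<Sum>v\<in>V. (cmod (f v))\<^sup>2) = 0" using assms(2) unfolding sum_cnj_self of_real_eq_0_iff .
  then show ?thesis using assms(1) by (auto simp: sum_nonneg_eq_0_iff)
qed

text \<open>Symmetry gives \<open>z <f,f> = <f,Af> = <Af,f> = cnj z <f,f>\<close>.\<close>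

lemma nonreal_eigenfunction_eq_0:
  assumes H: "fin_graph H" and z: "z \<notin> \<real>" and f: "\<And>v. v \<in> verts H \<Longrightarrow> nbsum H f v = z * f v"
  shows "\<forall>v\<in>verts H. f v = 0"
proof (rule sum_cmod_sq_eq_0)
  let ?s = "\<Sum>v\<in>verts H. cnj (f v) * f v"
  have "z * ?s = (\<Sum>v\<in>verts H. cnj (f v) * nbsum H f v)"
    by (simp add: f sum_distrib_left mult_ac)
  also have "\<dots> = cnj z * ?s"
    unfolding nbsum_symmetric[OF H] by (simp add: f sum_distrib_left mult_ac)
  finally show "?s = 0" using z by (metis Reals_cnj_iff mult_cancel_right)
qed (use H in \<open>simp add: fin_graph_def\<close>)

text \<open>The summands are indexed by their eigenvalues, so different summands are orthogonal. A
  summand \<open>w l\<close> may be zero.\<close>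

definition sum_of_eigenfunctions :: "graph \<Rightarrow> real set \<Rightarrow> (real \<Rightarrow> nat \<Rightarrow> complex) \<Rightarrow> (nat \<Rightarrow> complex) \<Rightarrow> bool" where
  "sum_of_eigenfunctions H \<Lambda> w f \<longleftrightarrow> finite \<Lambda> \<and>
     (\<forall>l\<in>\<Lambda>. \<forall>v\<in>verts H. nbsum H (w l) v = of_real l * w l v) \<and>
     (\<forall>v\<in>verts H. f v = (\<Sum>l\<in>\<Lambda>. w l v))"

text \<open>Symmetry of the adjacency operator rules out Jordan blocks and nonreal eigenvalues.\<close>

lemma sum_of_eigenfunctions_step:
  assumes H: "fin_graph H" and g: "sum_of_eigenfunctions H \<Lambda> w (\<lambda>v. nbsum H f v - a * f v)"
  shows "\<exists>\<Lambda> w. sum_of_eigenfunctions H \<Lambda> w f"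
proof -
  let ?V = "verts H"
  have fin: "finite \<Lambda>" "finite ?V" and sub: "edges H \<subseteq> ?V \<times> ?V"
    and w: "\<And>l v. l \<in> \<Lambda> \<Longrightarrow> v \<in> ?V \<Longrightarrow> nbsum H (w l) v = of_real l * w l v"
    and Af: "\<And>v. v \<in> ?V \<Longrightarrow> nbsum H f v - a * f v = (\<Sum>l\<in>\<Lambda>. w l v)"
    using g H by (auto simp: sum_of_eigenfunctions_def fin_graph_def)
  define L where "L = {l\<in>\<Lambda>. complex_of_real l \<noteq> a}"
  \<comment> \<open>For \<open>l \<noteq> a\<close> the summand \<open>w l\<close> is
    \<open>A - a\<close> applied to \<open>w l / (l - a)\<close>. Removing these preimages from
    \<open>f\<close> leaves \<open>f'\<close> with \<open>(A - a) f' = u\<close>, the part of the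
    sum that belongs to the eigenvalue \<open>a\<close>.\<close>
  define w' where "w' = (\<lambda>l v. w l v / (of_real l - a))"
  define f' where "f' = (\<lambda>v. f v - (\<Sum>l\<in>L. w' l v))"
  define u where "u = (\<lambda>v. \<Sum>l\<in>\<Lambda> - L. w l v)"
  have finL: "finite L" using fin by (simp add: L_def)
  have w': "nbsum H (w' l) v = of_real l * w' l v" "of_real l * w' l v - a * w' l v = w l v"
    if "l \<in> L" "v \<in> ?V" for l v
  proof -
    show "nbsum H (w' l) v = of_real l * w' l v"
      using that w[of l v] unfolding w'_def nbsum_divide by (simp add: L_def)
    have "of_real l - a \<noteq> 0" using that by (simp add: L_def)
    then show "of_real l * w' l v - a * w' l v = w l v"
      unfolding w'_def left_diff_distrib[symmetric] by simp
  qed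
  have f': "nbsum H f' v - a * f' v = u v" if v: "v \<in> ?V" for v
  proof -
    have "nbsum H f' v - a * f' v
        = (nbsum H f v - a * f v) - (\<Sum>l\<in>L. of_real l * w' l v - a * w' l v)"
      using v by (simp add: f'_def nbsum_diff nbsum_sum w'(1) right_diff_distrib sum_distrib_left sum_subtractf)
    also have "\<dots> = (\<Sum>l\<in>\<Lambda>. w l v) - (\<Sum>l\<in>L. w l v)"
      using v by (simp add: Af w')
    also have "\<dots> = u v"
      unfolding u_def using fin(1) by (subst sum_diff) (auto simp: L_def)
    finally show ?thesis .
  qed
  have Au: "nbsum H u v = a * u v" if "v \<in> ?V" for v
    using w that by (auto simp: u_def nbsum_sum sum_distrib_left L_def intro!: sum.cong)
  \<comment> \<open>For real \<open>a\<close> the function \<open>u\<close> lies both in the kernel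
    and in the range of the symmetric operator \<open>A - a\<close>, so it is orthogonal to itself.
    For nonreal \<open>a\<close> it is an empty sum.\<close>
  have u0: "u v = 0" if "v \<in> ?V" for v
  proof (cases "a \<in> \<real>")
    case True
    then have a: "cnj a = a" by (simp add: Reals_cnj_iff)
    have "(\<Sum>v\<in>?V. cnj (u v) * u v) = (\<Sum>v\<in>?V. cnj (u v) * (nbsum H f' v - a * f' v))"
      by (simp add: f')
    also have "\<dots> = (\<Sum>v\<in>?V. cnj (nbsum H u v) * f' v) - (\<Sum>v\<in>?V. cnj (u v) * (a * f' v))"
      by (simp add: right_diff_distrib sum_subtractf nbsum_symmetric[OF H])
    also have "\<dots> = 0" by (simp add: Au a mult_ac)
    finally show ?thesis using sum_cmod_sq_eq_0[OF fin(2)] that by blast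
  next
    case False
    then have "\<Lambda> - L = {}" by (auto simp: L_def)
    then show ?thesis by (simp only: u_def sum.empty)
  qed
  have f'_eig: "nbsum H f' v = a * f' v" if "v \<in> ?V" for v
    using f'[OF that] u0[OF that] by simp
  have split: "f v = f' v + (\<Sum>l\<in>L. w' l v)" for v by (simp add: f'_def)
  show ?thesis
  proof (cases "a \<in> \<real>")
    case True
    then obtain r where r: "a = of_real r" by (auto elim: Reals_cases)
    then have rL: "r \<notin> L" by (simp add: L_def)
    have "(\<Sum>l\<in>L. if l = r then f' v else w' l v) = (\<Sum>l\<in>L. w' l v)" for v
      using rL by (intro sum.cong) auto
    then have "sum_of_eigenfunctions H (insert r L) (\<lambda>l. if l = r then f' else w' l) f"
      using finL rL w' f'_eig r
      by (auto simp: sum_of_eigenfunctions_def split if_distrib[of "\<lambda>h. h _"] cong: if_cong)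
    then show ?thesis by blast
  next
    case False
    then have "\<forall>v\<in>?V. f' v = 0" using nonreal_eigenfunction_eq_0[OF H] f'_eig by blast
    then have "sum_of_eigenfunctions H L w' f"
      using finL w' by (auto simp: sum_of_eigenfunctions_def split)
    then show ?thesis by blast
  qed
qed

text \<open>Induction on the degree: if \<open>p = (X - a) q\<close> annihilates \<open>f\<close>,
  then \<open>q\<close> annihilates \<open>(A - a) f\<close>, and the preceding lemma goes back from
  \<open>(A - a) f\<close> to \<open>f\<close>.\<close>

lemma sum_of_eigenfunctions_of_annihilator:
  assumes H: "fin_graph H" and "p \<noteq> 0"
    and "\<And>v. v \<in> verts H \<Longrightarrow> (\<Sum>i\<le>degree p. coeff p i * (nbsum H ^^ i) f v) = 0"
  shows "\<exists>\<Lambda> w. sum_of_eigenfunctions H \<Lambda> w f"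
  using assms(2,3)
proof (induction "degree p" arbitrary: p f)
  case 0
  then have "coeff p 0 \<noteq> 0" by (metis leading_coeff_0_iff)
  then have "\<forall>v\<in>verts H. f v = 0" using 0 by auto
  then have "sum_of_eigenfunctions H {} (\<lambda>_ _. 0) f" by (simp add: sum_of_eigenfunctions_def)
  then show ?case by blast
next
  case (Suc n)
  have "\<not> constant (poly p)" using Suc.hyps(2) by (simp add: constant_degree)
  then obtain a where "poly p a = 0" using fundamental_theorem_of_algebra by blast
  then obtain q where q: "p = [:- a, 1:] * q" by (metis dvdE poly_eq_0_iff_dvd)
  have "q \<noteq> 0" using Suc.prems(1) q by auto
  then have deg: "degree p = Suc (degree q)" unfolding q by (subst degree_mult_eq) auto
  let ?g = "\<lambda>v. nbsum H f v - a * f v"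
  have "(\<Sum>i\<le>degree q. coeff q i * (nbsum H ^^ i) ?g v) = 0" if v: "v \<in> verts H" for v
  proof -
    let ?P = "\<lambda>i. (nbsum H ^^ i) f v"
    have co: "coeff p i = (case i of 0 \<Rightarrow> 0 | Suc j \<Rightarrow> coeff q j) - a * coeff q i" for i
      unfolding q by (simp add: coeff_pCons split: nat.split)
    have "(\<Sum>i\<le>degree p. coeff p i * ?P i)
        = (\<Sum>i\<le>Suc (degree q). (case i of 0 \<Rightarrow> 0 | Suc j \<Rightarrow> coeff q j) * ?P i) -
          (\<Sum>i\<le>Suc (degree q). a * coeff q i * ?P i)"
      unfolding deg co by (simp add: left_diff_distrib sum_subtractf del: sum.atMost_Suc)
    also have "(\<Sum>i\<le>Suc (degree q). (case i of 0 \<Rightarrow> 0 | Suc j \<Rightarrow> coeff q j) * ?P i)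
        = (\<Sum>i\<le>degree q. coeff q i * ?P (Suc i))"
      by (subst sum.atMost_Suc_shift) simp
    also have "(\<Sum>i\<le>Suc (degree q). a * coeff q i * ?P i) = (\<Sum>i\<le>degree q. a * coeff q i * ?P i)"
      by (simp add: coeff_eq_0)
    also have "(\<Sum>i\<le>degree q. coeff q i * ?P (Suc i)) - (\<Sum>i\<le>degree q. a * coeff q i * ?P i)
        = (\<Sum>i\<le>degree q. coeff q i * (nbsum H ^^ i) ?g v)"
      unfolding funpow_nbsum_minus by (simp add: sum_subtractf algebra_simps)
    finally show ?thesis using Suc.prems(2)[OF v] by simp
  qed
  moreover have "n = degree q" using Suc.hyps(2) deg by simp
  ultimately obtain \<Lambda> w where "sum_of_eigenfunctions H \<Lambda> w ?g"
    using Suc.hyps(1)[of q ?g] \<open>q \<noteq> 0\<close> by blast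
  then show ?case using sum_of_eigenfunctions_step[OF H] by blast
qed

text \<open>On \<open>n\<close> points the \<open>n + 1\<close> functions
  \<open>f, A f, ..., A^n f\<close> are linearly dependent, which is an annihilating
  polynomial.\<close>

lemma sum_of_eigenfunctions_exists:
  assumes H: "fin_graph H"
  shows "\<exists>\<Lambda> w. sum_of_eigenfunctions H \<Lambda> w f"
proof -
  have "finite (verts H)" using H by (simp add: fin_graph_def)
  from linearly_dependent_functions[OF this finite_atMost[of "card (verts H)"], of "\<lambda>i. (nbsum H ^^ i) f"]
  obtain c where c: "\<exists>i\<le>card (verts H). c i \<noteq> 0"
    "\<forall>v\<in>verts H. (\<Sum>i\<le>card (verts H). c i * (nbsum H ^^ i) f v) = 0" by auto
  define p where "p = Poly (map c [0..<Suc (card (verts H))])"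
  have co: "coeff p i = (if i \<le> card (verts H) then c i else 0)" for i
    by (simp add: p_def nth_default_def del: upt_Suc)
  then have p0: "p \<noteq> 0" using c(1) by (metis coeff_0)
  have "degree p \<le> card (verts H)" by (rule degree_le) (simp add: co)
  then have "(\<Sum>i\<le>degree p. coeff p i * (nbsum H ^^ i) f v)
      = (\<Sum>i\<le>card (verts H). c i * (nbsum H ^^ i) f v)" for v
    by (intro sum.mono_neutral_cong_left) (auto simp: coeff_eq_0 co, metis coeff_eq_0 co not_le)
  then show ?thesis
    using c(2) by (intro sum_of_eigenfunctions_of_annihilator[OF H p0]) simp
qed

section \<open>Resolvents of finite graphs\<close>

text \<open>The column at \<open>y\<close> of the resolvent of a finite graph, extended by zero.\<close>

definition is_green :: "graph \<Rightarrow> complex \<Rightarrow> nat \<Rightarrow> (nat \<Rightarrow> complex) \<Rightarrow> bool" where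
  "is_green H z y g \<longleftrightarrow> (\<forall>v. v \<notin> verts H \<longrightarrow> g v = 0) \<and>
     (\<forall>v\<in>verts H. nbsum H g v - z * g v = basis_vec y v)"

definition green :: "graph \<Rightarrow> complex \<Rightarrow> nat \<Rightarrow> nat \<Rightarrow> complex" where
  "green H z y = (THE g. is_green H z y g)"

lemma is_green_unique:
  assumes H: "fin_graph H" and z: "z \<notin> \<real>" and g: "is_green H z y g" "is_green H z y g'"
  shows "g = g'"
proof
  fix v
  have "nbsum H g v - z * g v = nbsum H g' v - z * g' v" if "v \<in> verts H" for v
    using g that by (simp add: is_green_def)
  then have "nbsum H (\<lambda>v. g v - g' v) v = z * (g v - g' v)" if "v \<in> verts H" for v
    unfolding nbsum_diff using that by (simp add: algebra_simps)
  then have "\<forall>v\<in>verts H. g v - g' v = 0" by (rule nonreal_eigenfunction_eq_0[OF H z])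
  then show "g v = g' v" using g by (cases "v \<in> verts H") (auto simp: is_green_def)
qed

text \<open>The imaginary part of \<open><g, (A - z) g> = cnj (g y)\<close>, since
  \<open><g, A g>\<close> is real (the Ward identity). It bounds resolvent columns uniformly in the
  graph and later normalises the transport.\<close>

lemma is_green_norm:
  assumes H: "fin_graph H" and y: "y \<in> verts H" and g: "is_green H z y g"
  shows "Im z * (\<Sum>v\<in>verts H. (cmod (g v))\<^sup>2) = Im (g y)"
proof -
  let ?V = "verts H" and ?n = "\<Sum>v\<in>verts H. (cmod (g v))\<^sup>2"
  let ?q = "\<Sum>v\<in>?V. cnj (g v) * nbsum H g v"
  have fin: "finite ?V" using H by (simp add: fin_graph_def)
  have "cnj ?q = (\<Sum>v\<in>?V. cnj (nbsum H g v) * g v)" by (simp add: mult.commute)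
  then have "cnj ?q = ?q" by (simp add: nbsum_symmetric[OF H])
  then have "Im ?q = 0" by (metis Reals_cnj_iff complex_is_Real_iff)
  moreover have "?q - z * of_real ?n = (\<Sum>v\<in>?V. cnj (g v) * (nbsum H g v - z * g v))"
    unfolding sum_cnj_self[symmetric] by (simp add: right_diff_distrib sum_subtractf sum_distrib_left mult_ac)
  moreover have "\<dots> = (\<Sum>v\<in>?V. if v = y then cnj (g v) else 0)"
    using g by (intro sum.cong) (auto simp: is_green_def basis_vec_def)
  moreover have "\<dots> = cnj (g y)" using fin y by simp
  ultimately show ?thesis by (simp add: complex_eq_iff)
qed

text \<open>Expand \<open>basis_vec y\<close> into eigenfunctions \<open>w l\<close> and take
  \<open>p l = ||w l||^2\<close>: the atoms of the spectral measure at \<open>y\<close>. The second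
  moment is recorded for the sake of tightness over growing balls.\<close>

lemma resolvent_spectral_decomposition:
  assumes H: "fin_graph H" and y: "y \<in> verts H"
  obtains \<Lambda> p where "finite \<Lambda>" "\<And>l. l \<in> \<Lambda> \<Longrightarrow> 0 \<le> p l" "(\<Sum>l\<in>\<Lambda>. p l) = 1"
    "(\<Sum>l\<in>\<Lambda>. l\<^sup>2 * p l) = real (card (edges H `` {y}))"
    "\<And>z. z \<notin> \<real> \<Longrightarrow> \<exists>g. is_green H z y g \<and> g y = (\<Sum>l\<in>\<Lambda>. of_real (p l) / (of_real l - z))"
proof -
  let ?V = "verts H"
  have V: "finite ?V" "edges H \<subseteq> ?V \<times> ?V" using H by (auto simp: fin_graph_def)
  obtain \<Lambda> w where "sum_of_eigenfunctions H \<Lambda> w (basis_vec y)"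
    using sum_of_eigenfunctions_exists[OF H] by blast
  then have fin: "finite \<Lambda>" and w: "\<And>l v. l \<in> \<Lambda> \<Longrightarrow> v \<in> ?V \<Longrightarrow> nbsum H (w l) v = of_real l * w l v"
    and e: "\<And>v. v \<in> ?V \<Longrightarrow> basis_vec y v = (\<Sum>l\<in>\<Lambda>. w l v)"
    by (auto simp: sum_of_eigenfunctions_def)
  define p where "p = (\<lambda>l. \<Sum>v\<in>?V. (cmod (w l v))\<^sup>2)"
  have orth: "(\<Sum>v\<in>?V. cnj (w l v) * w m v) = 0" if "l \<in> \<Lambda>" "m \<in> \<Lambda>" "l \<noteq> m" for l m
  proof -
    let ?s = "\<Sum>v\<in>?V. cnj (w l v) * w m v"
    have "of_real m * ?s = (\<Sum>v\<in>?V. cnj (w l v) * nbsum H (w m) v)"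
      using that by (simp add: w sum_distrib_left mult_ac)
    also have "\<dots> = of_real l * ?s"
      unfolding nbsum_symmetric[OF H] using that by (simp add: w sum_distrib_left mult_ac)
    finally show ?thesis using that by (simp add: of_real_eq_iff)
  qed
  \<comment> \<open>Pair \<open>w l\<close> with \<open>basis_vec y\<close>, the sum of all
    \<open>w m\<close>: by orthogonality only \<open>m = l\<close> survives.\<close>
  have wy: "w l y = of_real (p l)" if l: "l \<in> \<Lambda>" for l
  proof -
    have "(\<Sum>v\<in>?V. cnj (w l v) * basis_vec y v) = (\<Sum>v\<in>?V. if v = y then cnj (w l v) else 0)"
      by (intro sum.cong) (auto simp: basis_vec_def)
    also have "\<dots> = cnj (w l y)" using V y by simp
    finally have "cnj (w l y) = (\<Sum>v\<in>?V. \<Sum>m\<in>\<Lambda>. cnj (w l v) * w m v)"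
      by (simp add: e sum_distrib_left)
    also have "\<dots> = (\<Sum>m\<in>\<Lambda>. \<Sum>v\<in>?V. cnj (w l v) * w m v)" by (rule sum.swap)
    also have "\<dots> = (\<Sum>m\<in>\<Lambda>. if m = l then of_real (p l) else 0)"
      using orth[OF l] by (intro sum.cong) (auto simp: p_def sum_cnj_self simp del: of_real_sum of_real_power)
    also have "\<dots> = of_real (p l)" using fin l by simp
    finally show ?thesis by (metis complex_cnj_cnj complex_cnj_complex_of_real)
  qed
  have one: "nbsum H (basis_vec y) v = (\<Sum>l\<in>\<Lambda>. of_real l * w l v)" if "v \<in> ?V" for v
  proof -
    have "nbsum H (basis_vec y) v = nbsum H (\<lambda>v. \<Sum>l\<in>\<Lambda>. w l v) v"
      using V e by (intro nbsum_cong_verts) auto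
    then show ?thesis using that by (simp add: nbsum_sum w)
  qed
  have two: "nbsum H (nbsum H (basis_vec y)) y = (\<Sum>l\<in>\<Lambda>. of_real (l\<^sup>2) * w l y)"
  proof -
    have "nbsum H (nbsum H (basis_vec y)) y = nbsum H (\<lambda>v. \<Sum>l\<in>\<Lambda>. of_real l * w l v) y"
      using V one by (intro nbsum_cong_verts) auto
    then show ?thesis using y by (simp add: nbsum_sum nbsum_cmult w power2_eq_square mult_ac)
  qed
  \<comment> \<open>The diagonal entry of \<open>A^2\<close> counts the walks of length 2 from
    \<open>y\<close> back to \<open>y\<close>, one for each neighbour.\<close>
  have "nbsum H (nbsum H (basis_vec y)) y = (\<Sum>v\<in>edges H `` {y}. 1)"
    unfolding nbsum_def[of _ "nbsum H (basis_vec y)"]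
  proof (rule sum.cong)
    fix v assume "v \<in> edges H `` {y}"
    then have "y \<in> edges H `` {v}" "finite (edges H `` {v})"
      using H V finite_subset[of "edges H `` {v}" ?V] by (auto simp: fin_graph_def dest: symD)
    then show "nbsum H (basis_vec y) v = 1" by (simp add: nbsum_def basis_vec_def)
  qed auto
  then have "complex_of_real (\<Sum>l\<in>\<Lambda>. l\<^sup>2 * p l) = of_real (real (card (edges H `` {y})))"
    using two wy by simp
  then have 2: "(\<Sum>l\<in>\<Lambda>. l\<^sup>2 * p l) = real (card (edges H `` {y}))" by (rule of_real_eq_iff[THEN iffD1])
  have "complex_of_real (\<Sum>l\<in>\<Lambda>. p l) = of_real 1"
    using e[OF y] wy by (simp add: basis_vec_def)
  then have 1: "(\<Sum>l\<in>\<Lambda>. p l) = 1" by (rule of_real_eq_iff[THEN iffD1])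
  have 3: "\<exists>g. is_green H z y g \<and> g y = (\<Sum>l\<in>\<Lambda>. of_real (p l) / (of_real l - z))" if z: "z \<notin> \<real>" for z
  proof -
    let ?g = "\<lambda>v. if v \<in> ?V then \<Sum>l\<in>\<Lambda>. w l v / (of_real l - z) else 0"
    have nz: "of_real l - z \<noteq> 0" for l using z by auto
    have "nbsum H ?g v - z * ?g v = basis_vec y v" if v: "v \<in> ?V" for v
    proof -
      have "nbsum H ?g v = nbsum H (\<lambda>v. \<Sum>l\<in>\<Lambda>. w l v / (of_real l - z)) v"
        using V by (intro nbsum_cong_verts) auto
      also have "\<dots> = (\<Sum>l\<in>\<Lambda>. of_real l * w l v / (of_real l - z))"
        using v by (simp add: nbsum_sum nbsum_divide w)
      also have "\<dots> - z * ?g v = (\<Sum>l\<in>\<Lambda>. (of_real l - z) * w l v / (of_real l - z))"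
        using v by (simp add: left_diff_distrib diff_divide_distrib sum_subtractf sum_distrib_left)
      also have "\<dots> = basis_vec y v" using nz by (simp add: e[OF v])
      finally show ?thesis .
    qed
    then have "is_green H z y ?g" by (simp add: is_green_def)
    then show ?thesis using y wy by (intro exI[of _ ?g]) simp
  qed
  have "0 \<le> p l" for l by (simp add: p_def sum_nonneg)
  from that[OF fin this 1 2 3] show ?thesis .
qed

lemma is_green_green:
  assumes H: "fin_graph H" and y: "y \<in> verts H" and z: "z \<notin> \<real>"
  shows "is_green H z y (green H z y)"
proof -
  have "\<exists>g. is_green H z y g"
  proof (rule resolvent_spectral_decomposition[OF H y])
    fix \<Lambda> and p :: "real \<Rightarrow> real"
    assume "\<And>z. z \<notin> \<real> \<Longrightarrow> \<exists>g. is_green H z y g \<and> g y = (\<Sum>l\<in>\<Lambda>. of_real (p l) / (of_real l - z))"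
    from this[OF z] show ?thesis by blast
  qed
  then have "\<exists>!g. is_green H z y g" using is_green_unique[OF H z] by blast
  then show ?thesis unfolding green_def by (rule theI')
qed

lemma green_eqI:
  assumes "fin_graph H" "z \<notin> \<real>" "is_green H z y g"
  shows "green H z y = g"
  unfolding green_def
proof (rule the_equality)
  show "g' = g" if "is_green H z y g'" for g'
    using is_green_unique[OF assms(1,2) that assms(3)] .
qed (rule assms(3))

subsection \<open>Compactness\<close>

lemma pointwise_bounded_convergent_subseq:
  fixes g :: "nat \<Rightarrow> nat \<Rightarrow> complex"
  assumes "\<And>n v. cmod (g n v) \<le> M"
  shows "\<exists>r f. strict_mono r \<and> (\<forall>v. (\<lambda>n. g (r n) v) \<longlonglongrightarrow> f v)"
proof -
  define P where "P = (\<lambda>v (s :: nat \<Rightarrow> nat). convergent (\<lambda>n. g (s n) v))"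
  interpret subseqs P
  proof
    fix v and s :: "nat \<Rightarrow> nat"
    have "bounded (range (\<lambda>n. g (s n) v))" using assms by (auto simp: bounded_iff)
    then obtain l r where "strict_mono r" "((\<lambda>n. g (s n) v) \<circ> r) \<longlonglongrightarrow> l"
      using bounded_imp_convergent_subsequence by blast
    then show "\<exists>r. strict_mono r \<and> P v (s \<circ> r)" by (auto simp: P_def o_def convergent_def)
  qed
  have "P v (diagseq \<circ> ((+) (Suc v)))" for v
  proof (rule diagseq_holds)
    fix r s :: "nat \<Rightarrow> nat" and n assume "strict_mono r" "P n s"
    then show "P n (s \<circ> r)"
      unfolding P_def using convergent_subseq_convergent[of "\<lambda>k. g (s k) n" r] by (simp add: o_def)
  qed
  then have "convergent (\<lambda>n. g (diagseq (n + Suc v)) v)" for v by (simp only: P_def o_def add.commute)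
  then have "convergent (\<lambda>n. g (diagseq n) v)" for v
    using convergent_ignore_initial_segment[of "\<lambda>n. g (diagseq n) v" "Suc v"] by blast
  then have "\<forall>v. \<exists>l. (\<lambda>n. g (diagseq n) v) \<longlonglongrightarrow> l" by (auto simp: convergent_def)
  then obtain f where "\<And>v. (\<lambda>n. g (diagseq n) v) \<longlonglongrightarrow> f v" by metis
  then show ?thesis using subseq_diagseq by blast
qed

text \<open>By compactness, a bounded sequence with only one possible limit point converges. The
  hypothesis \<open>uniq\<close> is later discharged by uniqueness of the resolvent or of the
  projection column.\<close>

lemma pointwise_bounded_tendsto:
  fixes g :: "nat \<Rightarrow> nat \<Rightarrow> complex"
  assumes bd: "\<And>n v. cmod (g n v) \<le> M"
    and uniq: "\<And>r f'. strict_mono r \<Longrightarrow> (\<And>v. (\<lambda>n. g (r n) v) \<longlonglongrightarrow> f' v) \<Longrightarrow> f' = f"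
  shows "(\<lambda>n. g n v) \<longlonglongrightarrow> f v"
proof (rule ccontr)
  assume "\<not> ?thesis"
  then obtain e where e: "e > 0" "\<And>N. \<exists>n\<ge>N. \<not> dist (g n v) (f v) < e"
    unfolding lim_sequentially by blast
  then have "infinite {n. \<not> dist (g n v) (f v) < e}"
    unfolding infinite_nat_iff_unbounded_le by auto
  from infinite_enumerate[OF this] obtain s :: "nat \<Rightarrow> nat"
    where s: "strict_mono s" "\<And>n. \<not> dist (g (s n) v) (f v) < e" by auto
  obtain r f' where r: "strict_mono r" "\<And>v. (\<lambda>n. g (s (r n)) v) \<longlonglongrightarrow> f' v"
    using pointwise_bounded_convergent_subseq[of "\<lambda>n. g (s n)"] bd by blast
  have "strict_mono (\<lambda>n. s (r n))" using strict_mono_o[OF s(1) r(1)] by (simp add: o_def)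
  then have "f' = f" using r(2) by (rule uniq)
  then have "(\<lambda>n. g (s (r n)) v) \<longlonglongrightarrow> f v" using r(2) by blast
  then obtain N where "\<forall>n\<ge>N. dist (g (s (r n)) v) (f v) < e"
    using e(1) unfolding lim_sequentially by blast
  then show False using s(2) by blast
qed

subsection \<open>Square-summable functions\<close>

lemma ell2_cauchy_schwarz:
  assumes "(\<lambda>x. (cmod (f x))\<^sup>2) summable_on A" "(\<lambda>x. (cmod (g x))\<^sup>2) summable_on A"
  shows "(\<lambda>x. norm (cnj (f x) * g x)) summable_on A"
    and "cmod (ell2_inner A f g) \<le> ell2_norm A f * ell2_norm A g"
proof -
  have fin: "(\<Sum>x\<in>F. norm (cnj (f x) * g x)) \<le> ell2_norm A f * ell2_norm A g"
    if F: "finite F" "F \<subseteq> A" for F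
  proof -
    have "(\<Sum>x\<in>F. norm (cnj (f x) * g x)) = (\<Sum>x\<in>F. \<bar>cmod (f x)\<bar> * \<bar>cmod (g x)\<bar>)"
      by (simp add: norm_mult)
    also have "\<dots> \<le> L2_set (\<lambda>x. cmod (f x)) F * L2_set (\<lambda>x. cmod (g x)) F" by (rule L2_set_mult_ineq)
    also have "\<dots> \<le> ell2_norm A f * ell2_norm A g"
      unfolding L2_set_def ell2_norm_def
      by (intro mult_mono real_sqrt_le_mono finite_sum_le_infsum assms F real_sqrt_ge_zero sum_nonneg infsum_nonneg) auto
    finally show ?thesis .
  qed
  show abs: "(\<lambda>x. norm (cnj (f x) * g x)) summable_on A"
    using fin by (intro nonneg_bdd_above_summable_on) (auto intro!: bdd_aboveI2)
  have "cmod (ell2_inner A f g) \<le> (\<Sum>\<^sub>\<infinity>x\<in>A. norm (cnj (f x) * g x))"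
    unfolding ell2_inner_def by (rule norm_infsum_bound[OF abs])
  also have "\<dots> \<le> ell2_norm A f * ell2_norm A g"
    by (rule infsum_le_finite_sums[OF abs]) (rule fin)
  finally show "cmod (ell2_inner A f g) \<le> ell2_norm A f * ell2_norm A g" .
qed

lemma ell2_sumD: "f \<in> ell2 V \<Longrightarrow> (\<lambda>x. (cmod (f x))\<^sup>2) summable_on V"
  by (simp add: ell2_def)

lemma ell2_inner_summable:
  "f \<in> ell2 V \<Longrightarrow> g \<in> ell2 V \<Longrightarrow> (\<lambda>x. cnj (f x) * g x) summable_on V"
  by (rule abs_summable_summable) (auto intro: ell2_cauchy_schwarz(1) ell2_sumD)

lemma ell2_add_scaled:
  assumes f: "f \<in> ell2 V" and g: "g \<in> ell2 V"
  shows "(\<lambda>x. f x + c * g x) \<in> ell2 V"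
proof -
  have "(\<lambda>x. 2 * (cmod (f x))\<^sup>2 + 2 * (cmod c)\<^sup>2 * (cmod (g x))\<^sup>2) summable_on V"
    by (intro summable_on_add summable_on_cmult_right ell2_sumD f g)
  moreover have "(cmod (f x + c * g x))\<^sup>2 \<le> 2 * (cmod (f x))\<^sup>2 + 2 * (cmod c)\<^sup>2 * (cmod (g x))\<^sup>2" for x
  proof -
    have "(cmod (f x + c * g x))\<^sup>2 \<le> (cmod (f x) + cmod c * cmod (g x))\<^sup>2"
      by (intro power_mono order_trans[OF norm_triangle_ineq]) (simp_all add: norm_mult)
    also have "\<dots> \<le> 2 * (cmod (f x))\<^sup>2 + 2 * (cmod c)\<^sup>2 * (cmod (g x))\<^sup>2"
      using sum_squares_bound[of "cmod (f x)" "cmod c * cmod (g x)"]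
      by (simp add: power2_eq_square algebra_simps)
    finally show ?thesis .
  qed
  ultimately have "(\<lambda>x. (cmod (f x + c * g x))\<^sup>2) summable_on V"
    by (rule summable_on_comparison_test) auto
  then show ?thesis using f g by (simp add: ell2_def)
qed

lemma ell2_diff: "f \<in> ell2 V \<Longrightarrow> g \<in> ell2 V \<Longrightarrow> (\<lambda>x. f x - g x) \<in> ell2 V"
  using ell2_add_scaled[of f V g "-1"] by simp

lemma ell2_finite_support:
  assumes "finite {x. f x \<noteq> 0}" "{x. f x \<noteq> 0} \<subseteq> V"
  shows "f \<in> ell2 V"
proof -
  have "(\<lambda>x. (cmod (f x))\<^sup>2) summable_on {x. f x \<noteq> 0}" using assms(1) by simp
  then have "(\<lambda>x. (cmod (f x))\<^sup>2) summable_on V"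
    by (rule summable_on_cong_neutral[THEN iffD1, rotated -1]) (use assms in auto)
  then show ?thesis using assms(2) by (auto simp: ell2_def)
qed

lemma ell2_inner_add_scaled:
  assumes "f \<in> ell2 V" "g \<in> ell2 V" "h \<in> ell2 V"
  shows "ell2_inner V f (\<lambda>x. g x + c * h x) = ell2_inner V f g + c * ell2_inner V f h"
proof -
  have "ell2_inner V f (\<lambda>x. g x + c * h x) = (\<Sum>\<^sub>\<infinity>x\<in>V. cnj (f x) * g x + c * (cnj (f x) * h x))"
    by (simp add: ell2_inner_def algebra_simps)
  also have "\<dots> = ell2_inner V f g + c * ell2_inner V f h"
    unfolding ell2_inner_def using ell2_inner_summable assms
    by (simp add: infsum_add summable_on_cmult_right infsum_cmult_right)
  finally show ?thesis .
qed

lemma ell2_inner_commute: "ell2_inner V g f = cnj (ell2_inner V f g)"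
  unfolding ell2_inner_def by (subst infsum_cnj[symmetric]) (simp add: mult.commute)

lemma ell2_zero: "(\<lambda>_. 0) \<in> ell2 V"
  by (simp add: ell2_def)

lemma ell2_scaled: "f \<in> ell2 V \<Longrightarrow> (\<lambda>x. c * f x) \<in> ell2 V"
  using ell2_add_scaled[OF ell2_zero] by simp

lemma ell2_inner_scaled_right:
  "f \<in> ell2 V \<Longrightarrow> g \<in> ell2 V \<Longrightarrow> ell2_inner V f (\<lambda>x. c * g x) = c * ell2_inner V f g"
  using ell2_inner_add_scaled[OF _ ell2_zero, of f V g c] by (simp add: ell2_inner_def)

lemma ell2_inner_scaled_left:
  assumes "f \<in> ell2 V" "g \<in> ell2 V"
  shows "ell2_inner V (\<lambda>x. c * f x) g = cnj c * ell2_inner V f g"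
  by (subst (1 2) ell2_inner_commute) (simp add: ell2_inner_scaled_right[OF assms(2,1)])

lemma ell2_inner_basis_vec:
  assumes "y \<in> V"
  shows "ell2_inner V f (basis_vec y) = cnj (f y)"
proof -
  have "ell2_inner V f (basis_vec y) = (\<Sum>\<^sub>\<infinity>x\<in>{y}. cnj (f x) * basis_vec y x)"
    unfolding ell2_inner_def using assms by (intro infsum_cong_neutral) (auto simp: basis_vec_def)
  then show ?thesis by (simp add: basis_vec_def)
qed

lemma basis_vec_ell2: "y \<in> V \<Longrightarrow> basis_vec y \<in> ell2 V"
  by (rule ell2_finite_support) (auto simp: basis_vec_def)

lemma ell2_inner_self:
  assumes "f \<in> ell2 V"
  shows "ell2_inner V f f = of_real (\<Sum>\<^sub>\<infinity>x\<in>V. (cmod (f x))\<^sup>2)"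
proof -
  have "ell2_inner V f f = (\<Sum>\<^sub>\<infinity>x\<in>V. of_real ((cmod (f x))\<^sup>2))"
    unfolding ell2_inner_def by (intro infsum_cong) (simp add: complex_norm_square mult.commute del: of_real_power)
  also have "\<dots> = of_real (\<Sum>\<^sub>\<infinity>x\<in>V. (cmod (f x))\<^sup>2)"
    by (rule infsumI[OF has_sum_of_real_iff[THEN iffD2, OF has_sum_infsum[OF ell2_sumD[OF assms]]]])
  finally show ?thesis .
qed

lemma ell2_norm_nonneg: "0 \<le> ell2_norm V f"
  by (simp add: ell2_norm_def infsum_nonneg)

lemma cmod_le_ell2_norm:
  assumes "f \<in> ell2 V"
  shows "cmod (f v) \<le> ell2_norm V f"
proof (cases "v \<in> V")
  case True
  have "(\<Sum>x\<in>{v}. (cmod (f x))\<^sup>2) \<le> (\<Sum>\<^sub>\<infinity>x\<in>V. (cmod (f x))\<^sup>2)"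
    using assms True by (intro finite_sum_le_infsum) (auto simp: ell2_def)
  then show ?thesis unfolding ell2_norm_def by (intro real_le_rsqrt) simp
qed (use assms in \<open>simp add: ell2_def ell2_norm_def infsum_nonneg\<close>)

lemma ell2_inner_self_eq_0:
  assumes "f \<in> ell2 V" "ell2_inner V f f = 0"
  shows "f = (\<lambda>_. 0)"
proof -
  have "ell2_norm V f = 0" using assms(2) unfolding ell2_inner_self[OF assms(1)] by (simp add: ell2_norm_def)
  then show ?thesis using cmod_le_ell2_norm[OF assms(1)] by (auto simp: fun_eq_iff)
qed

lemma ell2_of_bounded_sums:
  assumes "\<And>x. x \<notin> V \<Longrightarrow> f x = 0" "\<And>F. finite F \<Longrightarrow> F \<subseteq> V \<Longrightarrow> (\<Sum>x\<in>F. (cmod (f x))\<^sup>2) \<le> B"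
  shows "f \<in> ell2 V" "(\<Sum>\<^sub>\<infinity>x\<in>V. (cmod (f x))\<^sup>2) \<le> B"
proof -
  have s: "(\<lambda>x. (cmod (f x))\<^sup>2) summable_on V"
    using assms(2) by (intro nonneg_bdd_above_summable_on) (auto intro!: bdd_aboveI2)
  then show "f \<in> ell2 V" using assms(1) by (auto simp: ell2_def)
  show "(\<Sum>\<^sub>\<infinity>x\<in>V. (cmod (f x))\<^sup>2) \<le> B" using infsum_le_finite_sums[OF s] assms(2) by blast
qed

text \<open>Fatou's lemma for counting measure: a uniform bound on finite partial sums survives
  pointwise limits.\<close>

lemma ell2_pointwise_limit:
  assumes lim: "\<And>v. (\<lambda>n. g n v) \<longlonglongrightarrow> f v"
    and supp: "\<And>n v. v \<notin> V \<Longrightarrow> g n v = 0"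
    and B: "\<And>n F. finite F \<Longrightarrow> F \<subseteq> V \<Longrightarrow> (\<Sum>x\<in>F. (cmod (g n x))\<^sup>2) \<le> B"
  shows "f \<in> ell2 V" "(\<Sum>\<^sub>\<infinity>x\<in>V. (cmod (f x))\<^sup>2) \<le> B"
proof -
  have 0: "f v = 0" if "v \<notin> V" for v
    using lim[of v] supp[OF that] by (simp add: LIMSEQ_const_iff)
  have 1: "(\<Sum>x\<in>F. (cmod (f x))\<^sup>2) \<le> B" if "finite F" "F \<subseteq> V" for F
  proof (rule LIMSEQ_le_const2)
    show "(\<lambda>n. \<Sum>x\<in>F. (cmod (g n x))\<^sup>2) \<longlonglongrightarrow> (\<Sum>x\<in>F. (cmod (f x))\<^sup>2)"
      by (intro tendsto_intros lim)
  qed (use B[OF that] in auto)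
  show "f \<in> ell2 V" "(\<Sum>\<^sub>\<infinity>x\<in>V. (cmod (f x))\<^sup>2) \<le> B" using ell2_of_bounded_sums[OF 0 1] by blast+
qed

text \<open>Bounded pointwise convergence implies weak convergence: on a finite set carrying most of
  \<phi> the limit is pointwise, and off this set Cauchy-Schwarz applies.\<close>

lemma ell2_inner_pointwise_limit:
  assumes \<phi>: "\<phi> \<in> ell2 V" and lim: "\<And>v. (\<lambda>n. g n v) \<longlonglongrightarrow> f v"
    and supp: "\<And>n v. v \<notin> V \<Longrightarrow> g n v = 0"
    and B: "\<And>n F. finite F \<Longrightarrow> F \<subseteq> V \<Longrightarrow> (\<Sum>x\<in>F. (cmod (g n x))\<^sup>2) \<le> B"
  shows "(\<lambda>n. ell2_inner V \<phi> (g n)) \<longlonglongrightarrow> ell2_inner V \<phi> f"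
proof (rule LIMSEQ_I)
  fix e :: real assume "e > 0"
  have f: "f \<in> ell2 V" "(\<Sum>\<^sub>\<infinity>x\<in>V. (cmod (f x))\<^sup>2) \<le> B" using ell2_pointwise_limit[OF lim supp B] by blast+
  have g: "g n \<in> ell2 V" "(\<Sum>\<^sub>\<infinity>x\<in>V. (cmod (g n x))\<^sup>2) \<le> B" for n
    using ell2_of_bounded_sums[OF supp B] by blast+
  have B0: "B \<ge> 0" using B[of "{}"] by simp
  \<comment> \<open>Each of the two tails is at most \<open>d * sqrt B \<le> e / 8\<close>, and the
    finite part gets \<open>e / 2\<close>. The summand 1 keeps the denominator positive when
    \<open>B = 0\<close>.\<close>
  define d where "d = e / 8 / (sqrt B + 1)"
  have d: "d > 0" using \<open>e > 0\<close> B0 by (simp add: d_def add_nonneg_pos)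
  then have "d\<^sup>2 > 0" by simp
  from infsum_finite_approximation[OF ell2_sumD[OF \<phi>] this] obtain F where F: "finite F" "F \<subseteq> V"
    "dist (\<Sum>x\<in>F. (cmod (\<phi> x))\<^sup>2) (\<Sum>\<^sub>\<infinity>x\<in>V. (cmod (\<phi> x))\<^sup>2) \<le> d\<^sup>2" by blast
  have sub: "(\<lambda>x. (cmod (h x))\<^sup>2) summable_on (V - F)" if "h \<in> ell2 V" for h
    using ell2_sumD[OF that] by (rule summable_on_subset_banach) auto
  have splitn: "(\<Sum>\<^sub>\<infinity>x\<in>V. (cmod (h x))\<^sup>2) = (\<Sum>x\<in>F. (cmod (h x))\<^sup>2) + (\<Sum>\<^sub>\<infinity>x\<in>V - F. (cmod (h x))\<^sup>2)"
    if "h \<in> ell2 V" for h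
    using infsum_Diff[OF ell2_sumD[OF that], of F] F(1,2) by simp
  have splitp: "ell2_inner V \<phi> h = (\<Sum>x\<in>F. cnj (\<phi> x) * h x) + ell2_inner (V - F) \<phi> h" if "h \<in> ell2 V" for h
    using infsum_Diff[OF ell2_inner_summable[OF \<phi> that], of F] F(1,2) by (simp add: ell2_inner_def)
  have "ell2_norm (V - F) \<phi> \<le> d"
    unfolding ell2_norm_def using F(3) splitn[OF \<phi>] d by (intro real_le_lsqrt) (auto simp: dist_real_def)
  moreover have "ell2_norm (V - F) h \<le> sqrt B" if "h \<in> ell2 V" "(\<Sum>\<^sub>\<infinity>x\<in>V. (cmod (h x))\<^sup>2) \<le> B" for h
    unfolding ell2_norm_def using splitn[OF that(1)] that(2) sum_nonneg[of F "\<lambda>x. (cmod (h x))\<^sup>2"]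
    by (intro real_sqrt_le_mono) auto
  ultimately have tail: "cmod (ell2_inner (V - F) \<phi> h) \<le> d * sqrt B"
    if "h \<in> ell2 V" "(\<Sum>\<^sub>\<infinity>x\<in>V. (cmod (h x))\<^sup>2) \<le> B" for h
    using that d ell2_cauchy_schwarz(2)[OF sub[OF \<phi>] sub[OF that(1)]]
    by (meson ell2_norm_nonneg less_imp_le mult_mono order_trans)
  have "(\<lambda>n. \<Sum>x\<in>F. cnj (\<phi> x) * g n x) \<longlonglongrightarrow> (\<Sum>x\<in>F. cnj (\<phi> x) * f x)"
    by (intro tendsto_intros lim)
  from LIMSEQ_D[OF this half_gt_zero[OF \<open>e > 0\<close>]] obtain N where N: "\<And>n. n \<ge> N \<Longrightarrow>
    cmod ((\<Sum>x\<in>F. cnj (\<phi> x) * g n x) - (\<Sum>x\<in>F. cnj (\<phi> x) * f x)) < e / 2" by blast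
  have "d * sqrt B \<le> e / 8"
  proof -
    have "sqrt B + 1 \<noteq> 0" using real_sqrt_ge_zero[OF B0] by linarith
    have "d * sqrt B \<le> d * (sqrt B + 1)" using d by simp
    also have "\<dots> = e / 8" using nonzero_eq_divide_eq[OF \<open>sqrt B + 1 \<noteq> 0\<close>] d_def by blast
    finally show ?thesis .
  qed
  have "cmod (ell2_inner V \<phi> (g n) - ell2_inner V \<phi> f) < e" if "n \<ge> N" for n
  proof -
    let ?a = "(\<Sum>x\<in>F. cnj (\<phi> x) * g n x) - (\<Sum>x\<in>F. cnj (\<phi> x) * f x)"
    let ?b = "ell2_inner (V - F) \<phi> (g n)" and ?c = "ell2_inner (V - F) \<phi> f"
    have "ell2_inner V \<phi> (g n) - ell2_inner V \<phi> f = ?a + (?b - ?c)"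
      unfolding splitp[OF f(1)] splitp[OF g(1)] by (rule add_diff_add)
    then have "cmod (ell2_inner V \<phi> (g n) - ell2_inner V \<phi> f) \<le> cmod ?a + cmod (?b - ?c)"
      by (simp only: norm_triangle_ineq)
    also have "\<dots> \<le> cmod ?a + (cmod ?b + cmod ?c)"
      by (intro add_left_mono norm_triangle_ineq4)
    also have "\<dots> < e"
      using N[OF that] tail[OF f] tail[OF g, of n] \<open>d * sqrt B \<le> e / 8\<close> \<open>e > 0\<close> by linarith
    finally show ?thesis .
  qed
  then show "\<exists>N. \<forall>n\<ge>N. cmod (ell2_inner V \<phi> (g n) - ell2_inner V \<phi> f) < e" by blast
qed

subsection \<open>The adjacency operator of a self-adjoint graph\<close>

lemma connected_lf_graphD:
  assumes "connected_lf_graph G"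
  shows "edges G \<subseteq> verts G \<times> verts G" "sym (edges G)" "finite (edges G `` {v})"
proof -
  show 1: "edges G \<subseteq> verts G \<times> verts G" "sym (edges G)" using assms by (auto simp: connected_lf_graph_def)
  show "finite (edges G `` {v})"
  proof (cases "v \<in> verts G")
    case False
    then have "edges G `` {v} = {}" using 1 by auto
    then show ?thesis by simp
  qed (use assms in \<open>auto simp: connected_lf_graph_def\<close>)
qed

lemma nbsum_outside:
  assumes "edges G \<subseteq> verts G \<times> verts G" "v \<notin> verts G"
  shows "nbsum G f v = 0"
proof -
  have "edges G `` {v} = {}" using assms by auto
  then show ?thesis by (simp add: nbsum_def)
qed

lemma adjacency_opD:
  assumes G: "connected_lf_graph G" and "(F, H) \<in> adjacency_op G"
  shows "finite {x. F x \<noteq> 0}" "F \<in> ell2 (verts G)" "H \<in> ell2 (verts G)" "H = nbsum G F"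
proof -
  have F: "finite {x. F x \<noteq> 0}" "{x. F x \<noteq> 0} \<subseteq> verts G" and H: "H = nbsum G F"
    using assms(2) by (auto simp: adjacency_op_def nbsum_def)
  have "{x. H x \<noteq> 0} \<subseteq> (\<Union>w\<in>{x. F x \<noteq> 0}. edges G `` {w})"
  proof
    fix x assume "x \<in> {x. H x \<noteq> 0}"
    then have "(\<Sum>w\<in>edges G `` {x}. F w) \<noteq> 0" by (simp add: H nbsum_def)
    then obtain w where "w \<in> edges G `` {x}" "F w \<noteq> 0" by (rule sum.not_neutral_contains_not_neutral)
    then show "x \<in> (\<Union>w\<in>{x. F x \<noteq> 0}. edges G `` {w})"
      using connected_lf_graphD(2)[OF G] by (auto dest: symD)
  qed
  moreover have "finite (\<Union>w\<in>{x. F x \<noteq> 0}. edges G `` {w})"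
    using F(1) connected_lf_graphD(3)[OF G] by blast
  ultimately have "finite {x. H x \<noteq> 0}" by (rule finite_subset)
  moreover have "{x. H x \<noteq> 0} \<subseteq> verts G"
    using nbsum_outside[OF connected_lf_graphD(1)[OF G]] by (auto simp: H)
  ultimately show "H \<in> ell2 (verts G)" by (rule ell2_finite_support)
  show "finite {x. F x \<noteq> 0}" "F \<in> ell2 (verts G)" "H = nbsum G F" using F H by (auto intro: ell2_finite_support)
qed

text \<open>Both sides are finite double sums over the support \<open>A\<close> of \<open>h\<close>
  and its neighbourhood \<open>N\<close>, so the summations can be exchanged for arbitrary
  \<open>f\<close>.\<close>

lemma inner_nbsum_finite_support:
  assumes G: "connected_lf_graph G" and h: "finite {x. h x \<noteq> 0}" "{x. h x \<noteq> 0} \<subseteq> verts G"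
  shows "ell2_inner (verts G) f (nbsum G h) = ell2_inner (verts G) (nbsum G f) h"
proof -
  let ?V = "verts G"
  define A where "A = {x. h x \<noteq> 0}"
  define N where "N = (\<Union>w\<in>A. edges G `` {w})"
  have sub: "edges G \<subseteq> ?V \<times> ?V" and sym: "\<And>v w. (v, w) \<in> edges G \<longleftrightarrow> (w, v) \<in> edges G"
    and lf: "\<And>v. finite (edges G `` {v})"
    using connected_lf_graphD[OF G] by (auto dest: symD)
  have A: "finite A" "A \<subseteq> ?V" and N: "finite N" "N \<subseteq> ?V"
    using h lf sub by (auto simp: A_def N_def)
  have nh: "nbsum G h v = (\<Sum>w\<in>A. if (v, w) \<in> edges G then h w else 0)" for v
  proof -
    have "nbsum G h v = (\<Sum>w\<in>{w \<in> A. (v, w) \<in> edges G}. h w)"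
      unfolding nbsum_def using lf[of v] by (intro sum.mono_neutral_right) (auto simp: A_def)
    then show ?thesis using A(1) by (simp add: sum.inter_filter)
  qed
  have nf: "nbsum G f w = (\<Sum>v\<in>N. if (v, w) \<in> edges G then f v else 0)" if "w \<in> A" for w
  proof -
    have "edges G `` {w} = {v \<in> N. (v, w) \<in> edges G}" using that sym by (auto simp: N_def)
    then show ?thesis unfolding nbsum_def using N(1) by (simp add: sum.inter_filter)
  qed
  have N0: "nbsum G h v = 0" if "v \<notin> N" for v
  proof -
    have "(v, w) \<notin> edges G" if "w \<in> A" for w using that \<open>v \<notin> N\<close> sym[of v w] by (auto simp: N_def)
    then show ?thesis unfolding nh by (intro sum.neutral) auto
  qed
  have "ell2_inner ?V f (nbsum G h) = (\<Sum>\<^sub>\<infinity>v\<in>N. cnj (f v) * nbsum G h v)"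
    unfolding ell2_inner_def using N N0 by (intro infsum_cong_neutral) auto
  also have "\<dots> = (\<Sum>v\<in>N. \<Sum>w\<in>A. if (v, w) \<in> edges G then cnj (f v) * h w else 0)"
    using N(1) unfolding nh by (simp add: sum_distrib_left if_distrib[of "\<lambda>c. _ * c"] cong: if_cong)
  also have "\<dots> = (\<Sum>w\<in>A. \<Sum>v\<in>N. if (v, w) \<in> edges G then cnj (f v) * h w else 0)"
    by (rule sum.swap)
  also have "\<dots> = (\<Sum>w\<in>A. cnj (nbsum G f w) * h w)"
    by (intro sum.cong)
      (simp_all add: nf sum_distrib_right if_distrib[of "\<lambda>c. c * _"] if_distrib[of cnj] cong: if_cong)
  also have "\<dots> = (\<Sum>\<^sub>\<infinity>w\<in>A. cnj (nbsum G f w) * h w)" using A(1) by simp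
  also have "\<dots> = ell2_inner ?V (nbsum G f) h"
    unfolding ell2_inner_def using A by (intro infsum_cong_neutral) (auto simp: A_def)
  finally show ?thesis .
qed

lemma ell2_norm_tendsto_pointwise:
  assumes "\<And>n. F n \<in> ell2 V" "f \<in> ell2 V" "(\<lambda>n. ell2_norm V (\<lambda>x. F n x - f x)) \<longlonglongrightarrow> 0"
  shows "(\<lambda>n. F n v) \<longlonglongrightarrow> f v"
proof -
  have "cmod (F n v - f v) \<le> ell2_norm V (\<lambda>x. F n x - f x)" for n
    using cmod_le_ell2_norm[OF ell2_diff[OF assms(1,2)]] .
  from Lim_null_comparison[OF always_eventually[OF allI[OF this]] assms(3)]
  show ?thesis by (rule LIM_zero_cancel)
qed

lemma ell2_norm_tendsto_inner:
  assumes g: "g \<in> ell2 V" and F: "\<And>n. F n \<in> ell2 V" and f: "f \<in> ell2 V"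
    and lim: "(\<lambda>n. ell2_norm V (\<lambda>x. F n x - f x)) \<longlonglongrightarrow> 0"
  shows "(\<lambda>n. ell2_inner V g (F n)) \<longlonglongrightarrow> ell2_inner V g f"
proof -
  have eq: "ell2_inner V g (F n) - ell2_inner V g f = ell2_inner V g (\<lambda>x. F n x - f x)" for n
    using ell2_inner_add_scaled[OF g F f, of n "-1"] by simp
  have le: "norm (ell2_inner V g (F n) - ell2_inner V g f) \<le> ell2_norm V g * ell2_norm V (\<lambda>x. F n x - f x)" for n
    unfolding eq by (rule ell2_cauchy_schwarz(2)) (intro ell2_sumD ell2_diff g F f)+
  have "(\<lambda>n. ell2_norm V g * ell2_norm V (\<lambda>x. F n x - f x)) \<longlonglongrightarrow> 0"
    using tendsto_mult_left[OF lim, of "ell2_norm V g"] by simp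
  from Lim_null_comparison[OF always_eventually[OF allI[OF le]] this]
  show ?thesis by (rule LIM_zero_cancel)
qed

text \<open>Convergence in l2 is pointwise, and neighbour sums are finite, so the closure still acts
  by \<open>nbsum\<close>.\<close>

lemma op_closure_adjacencyD:
  assumes G: "connected_lf_graph G" and "(f, g) \<in> op_closure (verts G) (adjacency_op G)"
  shows "f \<in> ell2 (verts G)" "g \<in> ell2 (verts G)" "g = nbsum G f"
proof -
  let ?V = "verts G"
  obtain F H where FH: "\<And>n::nat. (F n, H n) \<in> adjacency_op G"
    and lim: "(\<lambda>n. ell2_norm ?V (\<lambda>x. F n x - f x)) \<longlonglongrightarrow> 0" "(\<lambda>n. ell2_norm ?V (\<lambda>x. H n x - g x)) \<longlonglongrightarrow> 0"
    and fg: "f \<in> ell2 ?V" "g \<in> ell2 ?V"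
    using assms(2) unfolding op_closure_def by blast
  note ad = adjacency_opD[OF G FH]
  show "f \<in> ell2 ?V" "g \<in> ell2 ?V" using fg .
  show "g = nbsum G f"
  proof
    fix v
    have "(\<lambda>n. nbsum G (F n) v) \<longlonglongrightarrow> nbsum G f v"
      unfolding nbsum_def by (intro tendsto_intros ell2_norm_tendsto_pointwise[OF ad(2) fg(1) lim(1)])
    moreover have "(\<lambda>n. nbsum G (F n) v) \<longlonglongrightarrow> g v"
      using ell2_norm_tendsto_pointwise[OF ad(3) fg(2) lim(2)] ad(4) by simp
    ultimately show "g v = nbsum G f v" by (rule LIMSEQ_unique[rotated])
  qed
qed

text \<open>The maximal operator, \<open>nbsum\<close> on all l2 functions with l2 image, is
  contained in the adjoint of the closure.\<close>

lemma nbsum_in_adjoint: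
  assumes G: "connected_lf_graph G" and f: "f \<in> ell2 (verts G)" "nbsum G f \<in> ell2 (verts G)"
  shows "(f, nbsum G f) \<in> op_adjoint (verts G) (op_closure (verts G) (adjacency_op G))"
proof -
  let ?V = "verts G"
  have "ell2_inner ?V f k = ell2_inner ?V (nbsum G f) h"
    if hk: "(h, k) \<in> op_closure ?V (adjacency_op G)" for h k
  proof -
    obtain F H where FH: "\<And>n::nat. (F n, H n) \<in> adjacency_op G"
      and lim: "(\<lambda>n. ell2_norm ?V (\<lambda>x. F n x - h x)) \<longlonglongrightarrow> 0" "(\<lambda>n. ell2_norm ?V (\<lambda>x. H n x - k x)) \<longlonglongrightarrow> 0"
      and hk': "h \<in> ell2 ?V" "k \<in> ell2 ?V"
      using hk unfolding op_closure_def by blast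
    note ad = adjacency_opD[OF G FH]
    have "ell2_inner ?V f (H n) = ell2_inner ?V (nbsum G f) (F n)" for n
    proof -
      have "{x. F n x \<noteq> 0} \<subseteq> ?V" using ad(2)[of n] by (auto simp: ell2_def)
      then show ?thesis unfolding ad(4)[of n] by (rule inner_nbsum_finite_support[OF G ad(1)])
    qed
    then have "(\<lambda>n. ell2_inner ?V (nbsum G f) (F n)) \<longlonglongrightarrow> ell2_inner ?V f k"
      using ell2_norm_tendsto_inner[OF f(1) ad(3) hk'(2) lim(2)] by simp
    then show ?thesis
      using ell2_norm_tendsto_inner[OF f(2) ad(2) hk'(1) lim(1)] by (rule LIMSEQ_unique)
  qed
  then show ?thesis using f by (auto simp: op_adjoint_def)
qed

text \<open>The form in which self-adjointness is used: the closure has the maximal domain, so that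
  membership is checked by two summability conditions instead of approximating sequences.\<close>

lemma self_adjoint_graph_closure:
  assumes "connected_lf_graph G" "self_adjoint_graph G" "f \<in> ell2 (verts G)" "nbsum G f \<in> ell2 (verts G)"
  shows "(f, nbsum G f) \<in> op_closure (verts G) (adjacency_op G)"
  using nbsum_in_adjoint[OF assms(1,3,4)] assms(2)
  by (simp add: self_adjoint_graph_def essentially_self_adjoint_op_def self_adjoint_op_def)

lemma self_adjoint_graph_symmetric:
  assumes G: "connected_lf_graph G" and sa: "self_adjoint_graph G"
    and f: "f \<in> ell2 (verts G)" "nbsum G f \<in> ell2 (verts G)"
    and h: "h \<in> ell2 (verts G)" "nbsum G h \<in> ell2 (verts G)"
  shows "ell2_inner (verts G) f (nbsum G h) = ell2_inner (verts G) (nbsum G f) h"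
  using nbsum_in_adjoint[OF G f] self_adjoint_graph_closure[OF G sa h] by (auto simp: op_adjoint_def)

definition is_resolvent :: "graph \<Rightarrow> complex \<Rightarrow> nat \<Rightarrow> (nat \<Rightarrow> complex) \<Rightarrow> bool" where
  "is_resolvent G z y f \<longleftrightarrow> f \<in> ell2 (verts G) \<and>
     (\<forall>v\<in>verts G. nbsum G f v - z * f v = basis_vec y v)"

lemma is_resolventD:
  assumes "connected_lf_graph G" "y \<in> verts G" "is_resolvent G z y f"
  shows "f \<in> ell2 (verts G)" "nbsum G f = (\<lambda>v. basis_vec y v + z * f v)" "nbsum G f \<in> ell2 (verts G)"
proof -
  show f: "f \<in> ell2 (verts G)" using assms by (simp add: is_resolvent_def)
  show eq: "nbsum G f = (\<lambda>v. basis_vec y v + z * f v)"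
  proof
    fix v
    show "nbsum G f v = basis_vec y v + z * f v"
    proof (cases "v \<in> verts G")
      case True
      then have "nbsum G f v - z * f v = basis_vec y v" using assms(3) by (simp add: is_resolvent_def)
      then show ?thesis by (simp add: diff_eq_eq)
    next
      case False
      then show ?thesis using f assms(2) nbsum_outside[OF connected_lf_graphD(1)[OF assms(1)]]
        by (auto simp: ell2_def basis_vec_def)
    qed
  qed
  show "nbsum G f \<in> ell2 (verts G)" unfolding eq by (intro ell2_add_scaled f basis_vec_ell2 assms)
qed

text \<open>The computation of the finite case, with symmetry on the maximal domain; the deficiency
  spaces are trivial.\<close>

lemma self_adjoint_graph_nonreal_eigenfunction:
  assumes G: "connected_lf_graph G" "self_adjoint_graph G" and z: "z \<notin> \<real>"
    and f: "f \<in> ell2 (verts G)" "nbsum G f = (\<lambda>v. z * f v)"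
  shows "f = (\<lambda>_. 0)"
proof -
  have e: "nbsum G f = (\<lambda>v. 0 + z * f v)" using f(2) by simp
  have 0: "(\<lambda>_. 0) \<in> ell2 (verts G)" by (simp add: ell2_def)
  have n: "nbsum G f \<in> ell2 (verts G)" unfolding e by (intro ell2_add_scaled f 0)
  have i: "ell2_inner (verts G) f (nbsum G f) = z * ell2_inner (verts G) f f"
    using ell2_inner_add_scaled[OF f(1) 0 f(1), of z] unfolding e by (simp add: ell2_inner_def)
  have "ell2_inner (verts G) f (nbsum G f) = cnj (ell2_inner (verts G) f (nbsum G f))"
    by (rule trans[OF self_adjoint_graph_symmetric[OF G f(1) n f(1) n] ell2_inner_commute])
  then have "z * ell2_inner (verts G) f f = cnj z * cnj (ell2_inner (verts G) f f)"
    unfolding i by simp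
  moreover have "cnj (ell2_inner (verts G) f f) = ell2_inner (verts G) f f"
    by (rule ell2_inner_commute[symmetric])
  ultimately have "ell2_inner (verts G) f f = 0"
    using z by (metis Reals_cnj_iff mult_cancel_right)
  then show ?thesis using ell2_inner_self_eq_0[OF f(1)] by blast
qed

lemma is_resolvent_unique:
  assumes G: "connected_lf_graph G" "self_adjoint_graph G" and y: "y \<in> verts G" and z: "z \<notin> \<real>"
    and f: "is_resolvent G z y f" "is_resolvent G z y g"
  shows "f = g"
proof -
  note f' = is_resolventD[OF G(1) y f(1)] and g' = is_resolventD[OF G(1) y f(2)]
  have "nbsum G (\<lambda>v. f v - g v) = (\<lambda>v. z * (f v - g v))"
    by (rule ext) (simp add: nbsum_diff f'(2) g'(2) right_diff_distrib)
  from self_adjoint_graph_nonreal_eigenfunction[OF G z ell2_diff[OF f'(1) g'(1)] this]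
  show ?thesis by (simp add: fun_eq_iff)
qed

text \<open>Replaces the description by operator closures with a pointwise equation for an l2
  function. The maximal domain gives existence, and absence of nonreal eigenfunctions gives
  uniqueness.\<close>

lemma resolvent_entry_eq:
  assumes G: "connected_lf_graph G" "self_adjoint_graph G" and y: "y \<in> verts G" and z: "z \<notin> \<real>"
    and f: "is_resolvent G z y f"
  shows "resolvent_entry G z y = f y"
proof -
  let ?T = "op_closure (verts G) (adjacency_op G)"
  have inner: "ell2_inner (verts G) (basis_vec y) h = h y" for h
    using ell2_inner_commute[of "verts G" "basis_vec y" h] ell2_inner_basis_vec[OF y, of h] by simp
  note f' = is_resolventD[OF G(1) y f]
  have "(f, nbsum G f) \<in> ?T" using self_adjoint_graph_closure[OF G f'(1,3)] .
  moreover have "basis_vec y = (\<lambda>v. nbsum G f v - z * f v)" unfolding f'(2) by simp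
  ultimately have ex: "(basis_vec y, f) \<in> resolvent_op ?T z" unfolding resolvent_op_def by blast
  have un: "h = f" if h: "(basis_vec y, h) \<in> resolvent_op ?T z" for h
  proof -
    obtain k where k: "basis_vec y = (\<lambda>v. k v - z * h v)" "(h, k) \<in> ?T"
      using h by (auto simp: resolvent_op_def)
    note k' = op_closure_adjacencyD[OF G(1) k(2)]
    have "nbsum G h v - z * h v = basis_vec y v" for v unfolding k(1) k'(3) ..
    then have "is_resolvent G z y h" using k' by (simp add: is_resolvent_def)
    then show ?thesis using is_resolvent_unique[OF G y z _ f] by blast
  qed
  show ?thesis
    unfolding resolvent_entry_def inner by (rule the_equality) (use ex un in blast)+
qed

subsection \<open>Resolvents as limits over balls\<close>

lemma fin_graph_ball:
  assumes "connected_lf_graph G" "set xs \<subseteq> verts G"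
  shows "fin_graph (graph_ball G xs r)"
proof -
  have "sym (edges G)" using connected_lf_graphD(2)[OF assms(1)] .
  then show ?thesis
    using finite_ball_verts[OF assms] by (auto simp: fin_graph_def graph_ball_def sym_def)
qed

lemma ball_verts_neighbor:
  assumes "v \<in> ball_verts G xs r" "(v, w) \<in> edges G"
  shows "w \<in> ball_verts G xs (r + 1)"
proof -
  obtain s n where "s \<in> set xs" "real n \<le> r" "(s, v) \<in> edges G ^^ n"
    using assms(1) by (auto simp: ball_verts_def)
  then have "s \<in> set xs" "real (Suc n) \<le> r + 1" "(s, w) \<in> edges G ^^ Suc n" using assms(2) by auto
  then show ?thesis unfolding ball_verts_def by blast
qed

text \<open>A vertex at distance at least 1 inside the ball has all its neighbours in the
  ball.\<close>

lemma nbsum_graph_ball: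
  assumes "v \<in> ball_verts G xs r" "r + 1 \<le> r'"
  shows "nbsum (graph_ball G xs r') f v = nbsum G f v"
proof -
  have "ball_verts G xs r \<subseteq> ball_verts G xs r'" "ball_verts G xs (r + 1) \<subseteq> ball_verts G xs r'"
    using assms(2) by (auto intro!: ball_verts_mono)
  then have "edges (graph_ball G xs r') `` {v} = edges G `` {v}"
    using assms(1) ball_verts_neighbor[OF assms(1)] by (auto simp: graph_ball_def)
  then show ?thesis by (simp add: nbsum_def)
qed

text \<open>With \<open>N = ||g||^2\<close>, the identity of \<open>is_green_norm\<close> gives
  \<open>|Im z| N = |Im (g y)| \<le> sqrt N\<close>.\<close>

lemma is_green_bound:
  assumes H: "fin_graph H" and y: "y \<in> verts H" and z: "Im z \<noteq> 0" and g: "is_green H z y g"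
  shows "(\<Sum>v\<in>verts H. (cmod (g v))\<^sup>2) \<le> (1 / Im z)\<^sup>2"
proof -
  let ?N = "\<Sum>v\<in>verts H. (cmod (g v))\<^sup>2"
  have fin: "finite (verts H)" using H by (simp add: fin_graph_def)
  have N0: "0 \<le> ?N" by (simp add: sum_nonneg)
  have "(cmod (g y))\<^sup>2 \<le> ?N" by (rule member_le_sum[OF y _ fin]) simp
  moreover have "(Im z * ?N)\<^sup>2 \<le> (cmod (g y))\<^sup>2"
    unfolding is_green_norm[OF H y g] by (intro abs_le_square_iff[THEN iffD1]) (simp add: abs_Im_le_cmod)
  ultimately have *: "(Im z)\<^sup>2 * ?N * ?N \<le> 1 * ?N" by (simp add: power2_eq_square mult_ac)
  show ?thesis
  proof (cases "?N = 0")
    case False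
    then have "(Im z)\<^sup>2 * ?N \<le> 1" using * N0 by (simp only: mult_le_cancel_right)
    then show ?thesis using z by (simp add: power_divide field_simps)
  qed simp
qed

lemma is_green_sum_le:
  assumes H: "fin_graph H" and g: "is_green H z y g" and F: "finite F"
  shows "(\<Sum>v\<in>F. (cmod (g v))\<^sup>2) \<le> (\<Sum>v\<in>verts H. (cmod (g v))\<^sup>2)"
proof -
  have "(\<Sum>v\<in>F. (cmod (g v))\<^sup>2) = (\<Sum>v\<in>F \<inter> verts H. (cmod (g v))\<^sup>2)"
    using g F by (intro sum.mono_neutral_right) (auto simp: is_green_def)
  also have "\<dots> \<le> (\<Sum>v\<in>verts H. (cmod (g v))\<^sup>2)"
    using H by (intro sum_mono2) (auto simp: fin_graph_def)
  finally show ?thesis .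
qed

text \<open>The columns on balls are bounded in l2 uniformly in the radius. Every pointwise limit
  point solves the resolvent equation on \<open>G\<close>, whose solution is unique by
  self-adjointness.\<close>

lemma green_ball_tendsto:
  assumes G: "connected_lf_graph G" "self_adjoint_graph G" and y: "y \<in> verts G" and z: "z \<notin> \<real>"
  obtains f where "is_resolvent G z y f" "(\<Sum>\<^sub>\<infinity>v\<in>verts G. (cmod (f v))\<^sup>2) \<le> (1 / Im z)\<^sup>2"
    "\<And>v. (\<lambda>n. green (graph_ball G [y] (real n)) z y v) \<longlonglongrightarrow> f v"
proof -
  define g where "g = (\<lambda>n. green (graph_ball G [y] (real n)) z y)"
  let ?H = "\<lambda>n. graph_ball G [y] (real n)"
  have Im: "Im z \<noteq> 0" using z complex_is_Real_iff by blast
  have H: "fin_graph (?H n)" for n using fin_graph_ball G(1) y by simp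
  have yH: "y \<in> verts (?H n)" for n using roots_in_ball[of "real n" "[y]" G] by (simp add: graph_ball_def)
  have g: "is_green (?H n) z y (g n)" for n unfolding g_def by (rule is_green_green[OF H yH z])
  have VH: "verts (?H n) \<subseteq> verts G" for n
    using ball_verts_subset[of G "[y]"] G(1) y by (simp add: graph_ball_def wf_markedI)
  have supp: "g n v = 0" if "v \<notin> verts G" for n v using g[of n] VH that by (auto simp: is_green_def)
  have B: "(\<Sum>v\<in>F. (cmod (g n v))\<^sup>2) \<le> (1 / Im z)\<^sup>2" if "finite F" for n F
    using is_green_sum_le[OF H g that] is_green_bound[OF H yH Im g] by (rule order_trans)
  have M: "cmod (g n v) \<le> \<bar>1 / Im z\<bar>" for n v
    using B[of "{v}" n] by (simp add: abs_le_square_iff[symmetric])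
  have lim: "is_resolvent G z y f \<and> (\<Sum>\<^sub>\<infinity>v\<in>verts G. (cmod (f v))\<^sup>2) \<le> (1 / Im z)\<^sup>2"
    if r: "strict_mono r" and f: "\<And>v. (\<lambda>n. g (r n) v) \<longlonglongrightarrow> f v" for r f
  proof -
    have "nbsum G f v - z * f v = basis_vec y v" if v: "v \<in> verts G" for v
    proof (rule LIMSEQ_unique)
      show "(\<lambda>n. nbsum G (g (r n)) v - z * g (r n) v) \<longlonglongrightarrow> nbsum G f v - z * f v"
        unfolding nbsum_def by (intro tendsto_intros f)
      \<comment> \<open>From radius \<open>k + 1\<close> on, the equation of the ball at
        \<open>v\<close> is the equation of \<open>G\<close> at \<open>v\<close>.\<close>
      obtain k where k: "v \<in> ball_verts G [y] (real k)" using ball_verts_exhaust[of G "[y]" v] G(1) y v by auto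
      have "nbsum G (g (r n)) v - z * g (r n) v = basis_vec y v" if "n \<ge> Suc k" for n
      proof -
        have rn: "Suc k \<le> r n" using strict_mono_imp_increasing[OF r, of n] that by linarith
        then have "nbsum (?H (r n)) (g (r n)) v = nbsum G (g (r n)) v"
          by (intro nbsum_graph_ball[OF k]) simp
        moreover have "v \<in> verts (?H (r n))"
          using k ball_verts_mono[of "real k" "real (r n)" G "[y]"] rn by (auto simp: graph_ball_def)
        ultimately show ?thesis using g[of "r n"] by (auto simp: is_green_def)
      qed
      then show "(\<lambda>n. nbsum G (g (r n)) v - z * g (r n) v) \<longlonglongrightarrow> basis_vec y v"
        by (intro tendsto_eventually) (auto simp: eventually_sequentially)
    qed
    moreover have "f \<in> ell2 (verts G)" "(\<Sum>\<^sub>\<infinity>v\<in>verts G. (cmod (f v))\<^sup>2) \<le> (1 / Im z)\<^sup>2"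
      using ell2_pointwise_limit[OF f supp B] by blast+
    ultimately show ?thesis by (simp add: is_resolvent_def)
  qed
  obtain r f where rf: "strict_mono r" "\<And>v. (\<lambda>n. g (r n) v) \<longlonglongrightarrow> f v"
    using pointwise_bounded_convergent_subseq[of g, OF M] by blast
  have f: "is_resolvent G z y f" "(\<Sum>\<^sub>\<infinity>v\<in>verts G. (cmod (f v))\<^sup>2) \<le> (1 / Im z)\<^sup>2" using lim[OF rf] by blast+
  have "(\<lambda>n. g n v) \<longlonglongrightarrow> f v" for v
  proof (rule pointwise_bounded_tendsto[of g, OF M])
    fix r f' assume "strict_mono r" "\<And>v. (\<lambda>n. g (r n) v) \<longlonglongrightarrow> f' v"
    then have "is_resolvent G z y f'" using lim by blast
    then show "f' = f" using f(1) by (rule is_resolvent_unique[OF G y z])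
  qed
  then show ?thesis using that[OF f] by (simp add: g_def)
qed

subsection \<open>Stieltjes transforms\<close>

lemma nonreal_diff_bound:
  assumes "Im z \<noteq> 0"
  shows "cmod (1 / (complex_of_real \<xi> - z)) \<le> 1 / \<bar>Im z\<bar>"
proof -
  have "\<bar>Im z\<bar> \<le> cmod (complex_of_real \<xi> - z)" using abs_Im_le_cmod[of "complex_of_real \<xi> - z"] by simp
  then show ?thesis using assms by (simp add: norm_divide frac_le)
qed

lemma stieltjes_integrable:
  assumes "prob_space \<mu>" "sets \<mu> = sets borel" "Im z \<noteq> 0"
  shows "integrable \<mu> (\<lambda>\<xi>. 1 / (complex_of_real \<xi> - z))"
proof -
  interpret prob_space \<mu> by fact
  note [measurable_cong] = assms(2)
  show ?thesis
    using nonreal_diff_bound[OF assms(3)] by (intro integrable_const_bound[of _ "1 / \<bar>Im z\<bar>"]) auto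
qed

section \<open>Stieltjes inversion with the Poisson kernel\<close>

lemma Im_stieltjes_kernel:
  assumes "\<eta> > 0"
  shows "Im (1 / (complex_of_real \<xi> - Complex t \<eta>)) = \<eta> / ((\<xi> - t)\<^sup>2 + \<eta>\<^sup>2)"
  by (simp add: Im_divide power2_eq_square)

lemma arctan_kernel_integral:
  assumes eta: "\<eta> > 0" and "a \<le> b"
  shows "(\<integral>\<^sup>+t. ennreal (\<eta> / ((\<xi> - t)\<^sup>2 + \<eta>\<^sup>2)) * indicator {a..b} t \<partial>lborel)
    = ennreal (arctan ((b - \<xi>) / \<eta>) - arctan ((a - \<xi>) / \<eta>))"
proof (rule nn_integral_FTC_Icc[OF _ _ _ \<open>a \<le> b\<close>])
  show "DERIV (\<lambda>t. arctan ((t - \<xi>) / \<eta>)) t :> \<eta> / ((\<xi> - t)\<^sup>2 + \<eta>\<^sup>2)" for t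
  proof -
    have "(\<xi> - t)\<^sup>2 + \<eta>\<^sup>2 \<noteq> 0" using eta by (simp add: add_nonneg_eq_0_iff)
    moreover have "1 + ((t - \<xi>) / \<eta>)\<^sup>2 = ((\<xi> - t)\<^sup>2 + \<eta>\<^sup>2) / \<eta>\<^sup>2"
      using eta by (simp add: power_divide add_divide_distrib power2_commute)
    ultimately have "inverse (1 + ((t - \<xi>) / \<eta>)\<^sup>2) * (1 / \<eta>) = \<eta> / ((\<xi> - t)\<^sup>2 + \<eta>\<^sup>2)"
      using eta by (simp add: power2_eq_square)
    moreover have "DERIV (\<lambda>t. arctan ((t - \<xi>) / \<eta>)) t :> inverse (1 + ((t - \<xi>) / \<eta>)\<^sup>2) * (1 / \<eta>)"
      using eta by (auto intro!: derivative_eq_intros)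
    ultimately show ?thesis by simp
  qed
qed (use eta in auto)

text \<open>Tonelli for the Poisson kernel: its integral over a window in \<open>t\<close> is an
  \<open>arctan\<close> difference, its integral over \<xi> is the imaginary part of the Stieltjes
  transform. The transform thus determines the smoothed mass of every interval.\<close>

lemma integral_arctan_eq_stieltjes:
  assumes "prob_space \<mu>" "sets \<mu> = sets borel" "\<eta> > 0" "a \<le> b"
  shows "(\<integral>\<^sup>+\<xi>. ennreal (arctan ((b - \<xi>) / \<eta>) - arctan ((a - \<xi>) / \<eta>)) \<partial>\<mu>)
    = (\<integral>\<^sup>+t. ennreal (Im (\<integral>\<xi>. 1 / (complex_of_real \<xi> - Complex t \<eta>) \<partial>\<mu>)) * indicator {a..b} t \<partial>lborel)"
proof -
  interpret M: prob_space \<mu> by fact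
  interpret P: pair_sigma_finite \<mu> lborel ..
  note [measurable_cong] = assms(2)
  have inner: "(\<integral>\<^sup>+\<xi>. ennreal (\<eta> / ((\<xi> - t)\<^sup>2 + \<eta>\<^sup>2)) \<partial>\<mu>)
      = ennreal (Im (\<integral>\<xi>. 1 / (complex_of_real \<xi> - Complex t \<eta>) \<partial>\<mu>))" for t
  proof -
    have int: "integrable \<mu> (\<lambda>\<xi>. 1 / (complex_of_real \<xi> - Complex t \<eta>))"
      using assms by (intro stieltjes_integrable) auto
    have "(\<integral>\<^sup>+\<xi>. ennreal (Im (1 / (complex_of_real \<xi> - Complex t \<eta>))) \<partial>\<mu>)
        = ennreal (\<integral>\<xi>. Im (1 / (complex_of_real \<xi> - Complex t \<eta>)) \<partial>\<mu>)"
    proof (rule nn_integral_eq_integral)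
      show "integrable \<mu> (\<lambda>\<xi>. Im (1 / (complex_of_real \<xi> - Complex t \<eta>)))" using int by (rule integrable_Im)
      show "AE \<xi> in \<mu>. 0 \<le> Im (1 / (complex_of_real \<xi> - Complex t \<eta>))"
        unfolding Im_stieltjes_kernel[OF assms(3)] using assms(3) by (intro AE_I2) simp
    qed
    also have "\<dots> = ennreal (Im (\<integral>\<xi>. 1 / (complex_of_real \<xi> - Complex t \<eta>) \<partial>\<mu>))"
      by (simp only: integral_Im[OF int])
    finally show ?thesis by (simp only: Im_stieltjes_kernel[OF assms(3)])
  qed
  have "(\<integral>\<^sup>+\<xi>. ennreal (arctan ((b - \<xi>) / \<eta>) - arctan ((a - \<xi>) / \<eta>)) \<partial>\<mu>)
      = (\<integral>\<^sup>+\<xi>. (\<integral>\<^sup>+t. ennreal (\<eta> / ((\<xi> - t)\<^sup>2 + \<eta>\<^sup>2)) * indicator {a..b} t \<partial>lborel) \<partial>\<mu>)"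
    unfolding arctan_kernel_integral[OF assms(3,4)] ..
  also have "\<dots> = (\<integral>\<^sup>+t. (\<integral>\<^sup>+\<xi>. ennreal (\<eta> / ((\<xi> - t)\<^sup>2 + \<eta>\<^sup>2)) * indicator {a..b} t \<partial>\<mu>) \<partial>lborel)"
    by (rule P.Fubini'[symmetric]) measurable
  also have "\<dots> = (\<integral>\<^sup>+t. (\<integral>\<^sup>+\<xi>. ennreal (\<eta> / ((\<xi> - t)\<^sup>2 + \<eta>\<^sup>2)) \<partial>\<mu>) * indicator {a..b} t \<partial>lborel)"
    by (intro nn_integral_cong nn_integral_multc) measurable
  finally show ?thesis unfolding inner .
qed

text \<open>The width \<open>1 / (n + 1)^2\<close> is much smaller than the shift
  \<open>1 / (n + 1)\<close> of the right end, so the point \<open>\<xi> = b\<close> also receives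
  the full limit \<open>pi\<close> instead of \<open>pi / 2\<close>. The left end \<open>- n\<close>
  exhausts the half-line.\<close>

lemma arctan_window_tendsto:
  "(\<lambda>n. arctan ((b + 1 / real (Suc n) - \<xi>) / (1 / (real (Suc n))\<^sup>2))
      - arctan ((- real n - \<xi>) / (1 / (real (Suc n))\<^sup>2))) \<longlonglongrightarrow> pi * indicator {..b} \<xi>"
proof -
  have lo: "(\<lambda>n. arctan ((- real n - \<xi>) / (1 / (real (Suc n))\<^sup>2))) \<longlonglongrightarrow> - (pi / 2)"
    by (rule filterlim_compose[OF tendsto_arctan_at_bot]) real_asymp
  show ?thesis
  proof (cases "\<xi> \<le> b")
    case True
    have "filterlim (\<lambda>n. (b + 1 / real (Suc n) - \<xi>) / (1 / (real (Suc n))\<^sup>2)) at_top sequentially"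
    proof (rule filterlim_at_top_mono)
      show "filterlim (\<lambda>n. real n) at_top sequentially" by (rule filterlim_real_sequentially)
      have "real n \<le> (b + 1 / real (Suc n) - \<xi>) / (1 / (real (Suc n))\<^sup>2)" for n
      proof -
        have "real n \<le> 1 / real (Suc n) * (real (Suc n))\<^sup>2" by (simp add: power2_eq_square)
        also have "\<dots> \<le> (b + 1 / real (Suc n) - \<xi>) * (real (Suc n))\<^sup>2"
          using True by (intro mult_right_mono) auto
        finally show ?thesis by simp
      qed
      then show "\<forall>\<^sub>F n in sequentially. real n \<le> (b + 1 / real (Suc n) - \<xi>) / (1 / (real (Suc n))\<^sup>2)" by simp
    qed
    from tendsto_diff[OF filterlim_compose[OF tendsto_arctan_at_top this] lo] True show ?thesis by simp
  next
    case False
    then have "b - \<xi> < 0" by simp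
    then have "filterlim (\<lambda>n. (b + 1 / real (Suc n) - \<xi>) / (1 / (real (Suc n))\<^sup>2)) at_bot sequentially"
      by real_asymp
    from tendsto_diff[OF filterlim_compose[OF tendsto_arctan_at_bot this] lo] False show ?thesis by simp
  qed
qed

lemma arctan_window_bounds:
  assumes "a \<le> b" "\<eta> > 0"
  shows "0 \<le> arctan ((b - \<xi>) / \<eta>) - arctan ((a - \<xi>) / \<eta>)"
    and "arctan ((b - \<xi>) / \<eta>) - arctan ((a - \<xi>) / \<eta>) \<le> pi"
proof -
  have "(a - \<xi>) / \<eta> \<le> (b - \<xi>) / \<eta>" using assms by (intro divide_right_mono) auto
  then show "0 \<le> arctan ((b - \<xi>) / \<eta>) - arctan ((a - \<xi>) / \<eta>)" by (simp add: arctan_le_iff)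
  show "arctan ((b - \<xi>) / \<eta>) - arctan ((a - \<xi>) / \<eta>) \<le> pi"
    using arctan_bounded[of "(b - \<xi>) / \<eta>"] arctan_bounded[of "(a - \<xi>) / \<eta>"] by linarith
qed

text \<open>The smoothed masses of the windows agree for both measures and converge, by dominated
  convergence, to \<open>pi\<close> times the distribution functions.\<close>

lemma stieltjes_unique:
  assumes \<mu>: "prob_space \<mu>" "sets \<mu> = sets borel" and \<nu>: "prob_space \<nu>" "sets \<nu> = sets borel"
    and eq: "\<And>z. z \<notin> \<real> \<Longrightarrow> (\<integral>\<xi>. 1 / (complex_of_real \<xi> - z) \<partial>\<mu>) = (\<integral>\<xi>. 1 / (complex_of_real \<xi> - z) \<partial>\<nu>)"
  shows "\<mu> = \<nu>"
proof -
  have cdf: "measure \<mu> {..b} = measure \<nu> {..b}" for b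
  proof -
    define h where "h = (\<lambda>n \<xi>. arctan ((b + 1 / real (Suc n) - \<xi>) / (1 / (real (Suc n))\<^sup>2))
      - arctan ((- real n - \<xi>) / (1 / (real (Suc n))\<^sup>2)))"
    have lim: "(\<lambda>n. \<integral>\<xi>. h n \<xi> \<partial>M) \<longlonglongrightarrow> pi * measure M {..b}"
      if M: "prob_space M" "sets M = sets borel" for M
    proof -
      interpret prob_space M by fact
      note [measurable_cong] = M(2)
      have "(\<lambda>n. \<integral>\<xi>. h n \<xi> \<partial>M) \<longlonglongrightarrow> (\<integral>\<xi>. pi * indicator {..b} \<xi> \<partial>M)"
      proof (rule integral_dominated_convergence[where w = "\<lambda>_. pi"])
        show "AE \<xi> in M. (\<lambda>n. h n \<xi>) \<longlonglongrightarrow> pi * indicator {..b} \<xi>"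
          unfolding h_def by (intro AE_I2 arctan_window_tendsto)
        show "AE \<xi> in M. norm (h n \<xi>) \<le> pi" for n
        proof (rule AE_I2)
          fix \<xi>
          have "\<bar>arctan x - arctan y\<bar> \<le> pi" for x y
            using arctan_bounded[of x] arctan_bounded[of y] by linarith
          then show "norm (h n \<xi>) \<le> pi" unfolding h_def real_norm_def .
        qed
      qed (auto simp: h_def)
      then show ?thesis by (simp add: sets_eq_imp_space_eq[OF M(2)])
    qed
    have nn: "(\<integral>\<xi>. h n \<xi> \<partial>M) = enn2real (\<integral>\<^sup>+\<xi>. ennreal (h n \<xi>) \<partial>M)"
      if M: "prob_space M" "sets M = sets borel" "- real n \<le> b" for M n
    proof -
      note [measurable_cong] = M(2)
      show ?thesis
        using M(3) unfolding h_def
        by (intro integral_eq_nn_integral AE_I2 arctan_window_bounds) (auto intro: order_trans[of _ b])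
    qed
    \<comment> \<open>The window must be nonempty for the \<open>arctan\<close> identity;
      \<open>- n \<le> b\<close> ensures this and holds for all large \<open>n\<close>, enough for
      the limit.\<close>
    have "(\<integral>\<xi>. h n \<xi> \<partial>\<mu>) = (\<integral>\<xi>. h n \<xi> \<partial>\<nu>)" if n: "- real n \<le> b" for n
    proof -
      have ab: "- real n \<le> b + 1 / real (Suc n)" using n by (rule order_trans) simp
      have e0: "1 / (real (Suc n))\<^sup>2 > 0" by simp
      have "Complex t (1 / (real (Suc n))\<^sup>2) \<notin> \<real>" for t by (simp add: complex_is_Real_iff)
      note eq' = eq[OF this]
      have "(\<integral>\<^sup>+\<xi>. ennreal (h n \<xi>) \<partial>\<mu>) = (\<integral>\<^sup>+\<xi>. ennreal (h n \<xi>) \<partial>\<nu>)"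
        unfolding h_def integral_arctan_eq_stieltjes[OF \<mu> e0 ab]
          integral_arctan_eq_stieltjes[OF \<nu> e0 ab] eq' ..
      then show ?thesis unfolding nn[OF \<mu> n] nn[OF \<nu> n] by (rule arg_cong)
    qed
    moreover obtain k :: nat where "- b \<le> real k" using real_arch_simple by blast
    ultimately have "\<forall>n\<ge>k. (\<integral>\<xi>. h n \<xi> \<partial>\<mu>) = (\<integral>\<xi>. h n \<xi> \<partial>\<nu>)" by fastforce
    then have "\<forall>\<^sub>F n in sequentially. (\<integral>\<xi>. h n \<xi> \<partial>\<mu>) = (\<integral>\<xi>. h n \<xi> \<partial>\<nu>)"
      by (auto simp: eventually_sequentially)
    from Lim_transform_eventually[OF lim[OF \<mu>] this] lim[OF \<nu>]
    have "pi * measure \<mu> {..b} = pi * measure \<nu> {..b}" by (rule LIMSEQ_unique)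
    then show ?thesis by simp
  qed
  have rd: "real_distribution \<mu>" "real_distribution \<nu>"
    using \<mu> \<nu> by (auto simp: real_distribution_def real_distribution_axioms_def)
  then show ?thesis by (rule cdf_unique) (auto simp: cdf_def cdf)
qed

text \<open>The kernel \<open>-i \<eta> / (\<xi> - l - i \<eta>)\<close> is bounded by 1, equals 1
  at \<open>\<xi> = l\<close> and tends to 0 elsewhere, so dominated convergence isolates the
  atom.\<close>

lemma stieltjes_atom:
  assumes \<mu>: "prob_space \<mu>" "sets \<mu> = sets borel"
  shows "(\<lambda>k. - \<i> * of_real (1 / real (Suc k)) *
      (\<integral>\<xi>. 1 / (complex_of_real \<xi> - Complex l (1 / real (Suc k))) \<partial>\<mu>)) \<longlonglongrightarrow> of_real (measure \<mu> {l})"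
proof -
  interpret prob_space \<mu> by fact
  note [measurable_cong] = \<mu>(2)
  define h where "h = (\<lambda>k \<xi>. - \<i> * of_real (1 / real (Suc k)) * (1 / (complex_of_real \<xi> - Complex l (1 / real (Suc k)))))"
  have "(\<lambda>k. \<integral>\<xi>. h k \<xi> \<partial>\<mu>) \<longlonglongrightarrow> (\<integral>\<xi>. complex_of_real (indicator {l} \<xi>) \<partial>\<mu>)"
  proof (rule integral_dominated_convergence[where w = "\<lambda>_. 1"])
    show "AE \<xi> in \<mu>. (\<lambda>k. h k \<xi>) \<longlonglongrightarrow> complex_of_real (indicator {l} \<xi>)"
    proof (rule AE_I2)
      fix \<xi>
      show "(\<lambda>k. h k \<xi>) \<longlonglongrightarrow> complex_of_real (indicator {l} \<xi>)"
      proof (cases "\<xi> = l")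
        case True
        have "complex_of_real l - Complex l (1 / real (Suc k)) = - \<i> * of_real (1 / real (Suc k))" for k
          by (simp add: complex_eq_iff)
        moreover have "- \<i> * of_real c * (1 / (- \<i> * of_real c)) = 1" if "c \<noteq> 0" for c :: real
          using that by simp
        ultimately have "h k \<xi> = 1" for k
          unfolding h_def True by (metis divide_eq_0_iff of_nat_eq_0_iff one_neq_zero nat.distinct(1))
        then show ?thesis using True by simp
      next
        case False
        have e: "(\<lambda>k. 1 / real (Suc k)) \<longlonglongrightarrow> 0" using lim_1_over_n LIMSEQ_Suc by blast
        have "(\<lambda>k. h k \<xi>) \<longlonglongrightarrow> - \<i> * of_real 0 * (1 / (complex_of_real \<xi> - Complex l 0))"
          unfolding h_def using False by (intro tendsto_intros e) (simp add: complex_eq_iff)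
        then show ?thesis using False by simp
      qed
    qed
    show "AE \<xi> in \<mu>. norm (h k \<xi>) \<le> 1" for k
    proof (rule AE_I2)
      fix \<xi>
      have "cmod (1 / (complex_of_real \<xi> - Complex l (1 / real (Suc k)))) \<le> 1 / \<bar>1 / real (Suc k)\<bar>"
        using nonreal_diff_bound[of "Complex l (1 / real (Suc k))" \<xi>] by simp
      then have "1 / real (Suc k) * cmod (1 / (complex_of_real \<xi> - Complex l (1 / real (Suc k)))) \<le>
          1 / real (Suc k) * (1 / \<bar>1 / real (Suc k)\<bar>)"
        by (rule mult_left_mono) simp
      also have "\<dots> = 1" by simp
      finally show "norm (h k \<xi>) \<le> 1"
        unfolding h_def norm_mult norm_minus_cancel norm_ii norm_of_real by simp
    qed
  qed (auto simp: h_def)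
  moreover have "(\<integral>\<xi>. complex_of_real (indicator {l} \<xi>) \<partial>\<mu>) = of_real (measure \<mu> {l})"
    by (subst integral_complex_of_real) (simp add: sets_eq_imp_space_eq[OF \<mu>(2)])
  moreover have "(\<integral>\<xi>. h k \<xi> \<partial>\<mu>) = - \<i> * of_real (1 / real (Suc k)) *
      (\<integral>\<xi>. 1 / (complex_of_real \<xi> - Complex l (1 / real (Suc k))) \<partial>\<mu>)" for k
    unfolding h_def by (rule integral_mult_right_zero)
  ultimately show ?thesis by simp
qed

text \<open>The atoms \<open>p l\<close> as a measure on the line. The last clause is Chebyshev's
  inequality with the second moment, the degree of \<open>y\<close>; its bound does not see the size
  of the graph.\<close>

lemma finite_graph_spectral_measure:
  assumes H: "fin_graph H" and y: "y \<in> verts H"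
  shows "\<exists>\<mu>. real_distribution \<mu> \<and>
    (\<forall>z. z \<notin> \<real> \<longrightarrow> green H z y y = (\<integral>\<xi>. 1 / (complex_of_real \<xi> - z) \<partial>\<mu>)) \<and>
    (\<forall>c>0. 1 - real (card (edges H `` {y})) / c\<^sup>2 \<le> measure \<mu> {- c<..c})"
proof (rule resolvent_spectral_decomposition[OF H y])
  fix \<Lambda> and p :: "real \<Rightarrow> real"
  assume fin: "finite \<Lambda>" and p0: "\<And>l. l \<in> \<Lambda> \<Longrightarrow> 0 \<le> p l" and p1: "(\<Sum>l\<in>\<Lambda>. p l) = 1"
    and p2: "(\<Sum>l\<in>\<Lambda>. l\<^sup>2 * p l) = real (card (edges H `` {y}))"
    and g: "\<And>z. z \<notin> \<real> \<Longrightarrow> \<exists>g. is_green H z y g \<and> g y = (\<Sum>l\<in>\<Lambda>. of_real (p l) / (of_real l - z))"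
  define P where "P = point_measure \<Lambda> (\<lambda>l. ennreal (p l))"
  define \<mu> where "\<mu> = distr P borel (\<lambda>l. l)"
  have "(\<Sum>l\<in>\<Lambda>. ennreal (p l)) = 1" using p0 p1 by (simp add: sum_ennreal)
  then interpret P: prob_space P unfolding P_def using fin by (intro prob_space_point_measure) auto
  have meas: "(\<lambda>l. l) \<in> borel_measurable P" by (simp add: P_def)
  have rd: "real_distribution \<mu>" unfolding \<mu>_def using meas by (rule P.real_distribution_distr)
  have int: "(\<integral>\<xi>. f \<xi> \<partial>\<mu>) = (\<Sum>l\<in>\<Lambda>. p l *\<^sub>R f l)"
    if "f \<in> borel_measurable borel" for f :: "real \<Rightarrow> 'b :: {banach, second_countable_topology}"
  proof -
    have "(\<integral>\<xi>. f \<xi> \<partial>\<mu>) = (\<integral>\<xi>. f \<xi> \<partial>P)" unfolding \<mu>_def using meas that by (rule integral_distr)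
    also have "\<dots> = (\<Sum>l\<in>\<Lambda>. p l *\<^sub>R f l)"
      unfolding P_def using fin p0 by (rule lebesgue_integral_point_measure_finite)
    finally show ?thesis .
  qed
  have st: "green H z y y = (\<integral>\<xi>. 1 / (complex_of_real \<xi> - z) \<partial>\<mu>)" if z: "z \<notin> \<real>" for z
  proof -
    obtain h where h: "is_green H z y h" "h y = (\<Sum>l\<in>\<Lambda>. of_real (p l) / (of_real l - z))"
      using g[OF z] by blast
    have "(\<integral>\<xi>. 1 / (complex_of_real \<xi> - z) \<partial>\<mu>) = (\<Sum>l\<in>\<Lambda>. p l *\<^sub>R (1 / (complex_of_real l - z)))"
      by (rule int) measurable
    then show ?thesis using green_eqI[OF H z h(1)] h(2) by (simp add: scaleR_conv_of_real)
  qed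
  have ti: "1 - real (card (edges H `` {y})) / c\<^sup>2 \<le> measure \<mu> {- c<..c}" if c: "c > 0" for c
  proof -
    interpret real_distribution \<mu> by (rule rd)
    have "measure \<mu> {- c<..c} = (\<integral>\<xi>. indicator {- c<..c} \<xi> \<partial>\<mu>)" by simp
    also have "\<dots> = (\<Sum>l\<in>\<Lambda>. p l *\<^sub>R indicator {- c<..c} l)" by (rule int) measurable
    also have "\<dots> \<ge> (\<Sum>l\<in>\<Lambda>. p l * (1 - l\<^sup>2 / c\<^sup>2))"
    proof (rule sum_mono)
      fix l assume l: "l \<in> \<Lambda>"
      have "1 - l\<^sup>2 / c\<^sup>2 \<le> indicator {- c<..c} l"
      proof (cases "l \<in> {- c<..c}")
        case False
        then have "\<not> - c < l \<or> \<not> l \<le> c" by simp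
        then have "\<bar>c\<bar> \<le> \<bar>l\<bar>" using c by linarith
        then have "c\<^sup>2 \<le> l\<^sup>2" by (simp only: abs_le_square_iff)
        then show ?thesis using c False by simp
      qed simp
      then show "p l * (1 - l\<^sup>2 / c\<^sup>2) \<le> p l *\<^sub>R indicator {- c<..c} l"
        using p0[OF l] by (simp add: mult_left_mono)
    qed
    also have "(\<Sum>l\<in>\<Lambda>. p l * (1 - l\<^sup>2 / c\<^sup>2)) = (\<Sum>l\<in>\<Lambda>. p l) - (\<Sum>l\<in>\<Lambda>. l\<^sup>2 * p l) / c\<^sup>2"
      by (simp add: right_diff_distrib sum_subtractf sum_divide_distrib mult.commute)
    finally show ?thesis unfolding p1 p2 .
  qed
  from rd st ti show ?thesis by blast
qed

text \<open>A weak limit of the spectral measures of balls takes the place of the spectral theorem.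
  The degree of \<open>y\<close> in a ball is at most its degree in \<open>G\<close>, so the family
  is tight, and the transforms converge on both sides of the claimed identity.\<close>

lemma spectral_measure_exists:
  assumes G: "connected_lf_graph G" "self_adjoint_graph G" and y: "y \<in> verts G"
  shows "\<exists>\<mu>. prob_space \<mu> \<and> sets \<mu> = sets borel \<and>
    (\<forall>z. z \<notin> \<real> \<longrightarrow> resolvent_entry G z y = (\<integral>\<xi>. 1 / (complex_of_real \<xi> - z) \<partial>\<mu>))"
proof -
  let ?H = "\<lambda>n. graph_ball G [y] (real n)"
  define D where "D = real (card (edges G `` {y}))"
  have H: "fin_graph (?H n)" for n using fin_graph_ball G(1) y by simp
  have yH: "y \<in> verts (?H n)" for n using roots_in_ball[of "real n" "[y]" G] by (simp add: graph_ball_def)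
  have "\<forall>n. \<exists>\<mu>. real_distribution \<mu> \<and>
    (\<forall>z. z \<notin> \<real> \<longrightarrow> green (?H n) z y y = (\<integral>\<xi>. 1 / (complex_of_real \<xi> - z) \<partial>\<mu>)) \<and>
    (\<forall>c>0. 1 - real (card (edges (?H n) `` {y})) / c\<^sup>2 \<le> measure \<mu> {- c<..c})"
    using finite_graph_spectral_measure[OF H yH] by blast
  then obtain \<mu> where \<mu>: "\<And>n. real_distribution (\<mu> n)"
    "\<And>n z. z \<notin> \<real> \<Longrightarrow> green (?H n) z y y = (\<integral>\<xi>. 1 / (complex_of_real \<xi> - z) \<partial>\<mu> n)"
    "\<And>n c. c > 0 \<Longrightarrow> 1 - real (card (edges (?H n) `` {y})) / c\<^sup>2 \<le> measure (\<mu> n) {- c<..c}"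
    by metis
  have D: "real (card (edges (?H n) `` {y})) \<le> D" for n
    unfolding D_def of_nat_le_iff
    by (rule card_mono[OF connected_lf_graphD(3)[OF G(1)]]) (auto simp: graph_ball_def)
  have "\<exists>a b. a < b \<and> (\<forall>n. measure (\<mu> n) {a<..b} > 1 - e)" if e: "e > 0" for e
  proof -
    \<comment> \<open>Chosen so that \<open>D / c^2 < e\<close>; the summand 1 makes this strict and
      keeps \<open>c\<close> positive when \<open>D = 0\<close>.\<close>
    define c where "c = sqrt (D / e) + 1"
    have D0: "0 \<le> D / e" using e by (simp add: D_def)
    then have c: "c > 0" unfolding c_def by (intro add_nonneg_pos) auto
    have "D / e < c\<^sup>2"
    proof -
      have "D / e = (sqrt (D / e))\<^sup>2" using D0 by simp
      also have "\<dots> < c\<^sup>2" unfolding c_def using D0 by (intro power_strict_mono) auto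
      finally show ?thesis .
    qed
    then have "D / c\<^sup>2 < e" using e c by (simp add: field_simps)
    moreover have "real (card (edges (?H n) `` {y})) / c\<^sup>2 \<le> D / c\<^sup>2" for n
      by (intro divide_right_mono D) simp
    ultimately have "measure (\<mu> n) {- c<..c} > 1 - e" for n using \<mu>(3)[OF c, of n] by (smt (verit))
    then show ?thesis using c by (intro exI[of _ "- c"] exI[of _ c]) auto
  qed
  then have "tight \<mu>" using \<mu>(1) by (auto simp: tight_def)
  from tight_imp_convergent_subsubsequence[OF this strict_mono_id] obtain r M
    where r: "strict_mono r" and M: "real_distribution M" and w: "weak_conv_m (\<mu> \<circ> id \<circ> r) M"
    by blast
  have "resolvent_entry G z y = (\<integral>\<xi>. 1 / (complex_of_real \<xi> - z) \<partial>M)" if z: "z \<notin> \<real>" for z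
  proof (rule LIMSEQ_unique)
    have Im: "Im z \<noteq> 0" using z complex_is_Real_iff by blast
    have nz: "complex_of_real \<xi> - z \<noteq> 0" for \<xi> using z by auto
    have "(\<lambda>n. \<integral>\<xi>. 1 / (complex_of_real \<xi> - z) \<partial>(\<mu> \<circ> id \<circ> r) n) \<longlonglongrightarrow> (\<integral>\<xi>. 1 / (complex_of_real \<xi> - z) \<partial>M)"
    proof (rule weak_conv_imp_integral_bdd_continuous_conv)
      show "cmod (1 / (complex_of_real \<xi> - z)) \<le> 1 / \<bar>Im z\<bar>" for \<xi> by (rule nonreal_diff_bound[OF Im])
      show "isCont (\<lambda>\<xi>. 1 / (complex_of_real \<xi> - z)) \<xi>" for \<xi> using nz by (intro continuous_intros)
    qed (use \<mu>(1) M w in \<open>auto simp: o_def\<close>)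
    then show "(\<lambda>n. green (?H (r n)) z y y) \<longlonglongrightarrow> (\<integral>\<xi>. 1 / (complex_of_real \<xi> - z) \<partial>M)"
      by (simp add: \<mu>(2)[OF z])
    obtain f where f: "is_resolvent G z y f" "\<And>v. (\<lambda>n. green (?H n) z y v) \<longlonglongrightarrow> f v"
      using green_ball_tendsto[OF G y z] by blast
    have "(\<lambda>n. green (?H (r n)) z y y) \<longlonglongrightarrow> f y"
      using LIMSEQ_subseq_LIMSEQ[OF f(2) r] by (simp add: o_def)
    then show "(\<lambda>n. green (?H (r n)) z y y) \<longlonglongrightarrow> resolvent_entry G z y"
      by (simp add: resolvent_entry_eq[OF G y z f(1)])
  qed
  moreover have "prob_space M" "sets M = sets borel"
    using M by (auto simp: real_distribution_def real_distribution_axioms_def)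
  ultimately show ?thesis by blast
qed

lemma spectral_measure_at_props:
  assumes G: "connected_lf_graph G" "self_adjoint_graph G" and y: "y \<in> verts G"
  shows "prob_space (spectral_measure_at G y)" "sets (spectral_measure_at G y) = sets borel"
    "z \<notin> \<real> \<Longrightarrow> resolvent_entry G z y = (\<integral>\<xi>. 1 / (complex_of_real \<xi> - z) \<partial>spectral_measure_at G y)"
proof -
  let ?P = "\<lambda>\<mu>. prob_space \<mu> \<and> sets \<mu> = sets borel \<and>
    (\<forall>z. z \<notin> \<real> \<longrightarrow> resolvent_entry G z y = (\<integral>\<xi>. 1 / (complex_of_real \<xi> - z) \<partial>\<mu>))"
  have ex1: "\<exists>!\<mu>. ?P \<mu>"
  proof (rule ex_ex1I[OF spectral_measure_exists[OF G y]])
    show "\<mu> = \<nu>" if "?P \<mu>" "?P \<nu>" for \<mu> \<nu>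
      by (rule stieltjes_unique) (use that in auto)
  qed
  have eq: "spectral_measure_at G y = (THE \<mu>. ?P \<mu>)"
    unfolding spectral_measure_at_def using G(2) by (rule if_P)
  from theI'[OF ex1] have "?P (spectral_measure_at G y)" unfolding eq .
  then show "prob_space (spectral_measure_at G y)" "sets (spectral_measure_at G y) = sets borel"
    "z \<notin> \<real> \<Longrightarrow> resolvent_entry G z y = (\<integral>\<xi>. 1 / (complex_of_real \<xi> - z) \<partial>spectral_measure_at G y)"
    by blast+
qed

lemma spectral_measure_at_atom:
  assumes G: "connected_lf_graph G" "self_adjoint_graph G" and y: "y \<in> verts G"
    and f: "\<And>k. is_resolvent G (Complex l (1 / real (Suc k))) y (f k)"
  shows "(\<lambda>k. - \<i> * of_real (1 / real (Suc k)) * f k y) \<longlonglongrightarrow> of_real (measure (spectral_measure_at G y) {l})"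
proof -
  note \<mu> = spectral_measure_at_props[OF G y]
  have z: "Complex l (1 / real (Suc k)) \<notin> \<real>" for k by (simp add: complex_is_Real_iff)
  have "f k y = (\<integral>\<xi>. 1 / (complex_of_real \<xi> - Complex l (1 / real (Suc k))) \<partial>spectral_measure_at G y)" for k
    using resolvent_entry_eq[OF G y z f] \<mu>(3)[OF z] by simp
  then show ?thesis using stieltjes_atom[OF \<mu>(1,2), of l] by simp
qed

subsection \<open>Square-summable eigenfunctions\<close>

definition eigenspace :: "graph \<Rightarrow> real \<Rightarrow> (nat \<Rightarrow> complex) set" where
  "eigenspace G l = {\<phi> \<in> ell2 (verts G). nbsum G \<phi> = (\<lambda>v. of_real l * \<phi> v)}"

text \<open>\<open>h\<close> is the column at \<open>y\<close> of the orthogonal projection onto the eigenspace.\<close>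

definition reproducing :: "graph \<Rightarrow> real \<Rightarrow> nat \<Rightarrow> (nat \<Rightarrow> complex) \<Rightarrow> bool" where
  "reproducing G l y h \<longleftrightarrow> h \<in> eigenspace G l \<and>
     (\<forall>\<phi>\<in>eigenspace G l. ell2_inner (verts G) \<phi> h = cnj (\<phi> y))"

lemma eigenspaceD:
  assumes "\<phi> \<in> eigenspace G l"
  shows "\<phi> \<in> ell2 (verts G)" "nbsum G \<phi> = (\<lambda>v. of_real l * \<phi> v)" "nbsum G \<phi> \<in> ell2 (verts G)"
  using assms ell2_scaled[of \<phi> "verts G" "of_real l"] by (auto simp: eigenspace_def)

lemma eigenspace_diff_scaled:
  assumes "\<phi> \<in> eigenspace G l" "\<psi> \<in> eigenspace G l"
  shows "(\<lambda>v. \<phi> v - c * \<psi> v) \<in> eigenspace G l"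
proof -
  note 1 = eigenspaceD[OF assms(1)] and 2 = eigenspaceD[OF assms(2)]
  have "nbsum G (\<lambda>v. \<phi> v - c * \<psi> v) = (\<lambda>v. of_real l * (\<phi> v - c * \<psi> v))"
    by (rule ext) (simp add: nbsum_diff nbsum_cmult 1(2) 2(2) algebra_simps)
  then show ?thesis using ell2_diff[OF 1(1) ell2_scaled[OF 2(1)]] by (simp add: eigenspace_def)
qed

text \<open>Test the reproducing property on \<open>h\<close> itself:
  \<open>P(y,y) = ||P e_y||^2\<close>.\<close>

lemma reproducing_diagonal:
  assumes "reproducing G l y h"
  shows "h y = of_real (\<Sum>\<^sub>\<infinity>v\<in>verts G. (cmod (h v))\<^sup>2)"
proof -
  have h: "h \<in> ell2 (verts G)" "ell2_inner (verts G) h h = cnj (h y)"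
    using assms eigenspaceD(1) by (auto simp: reproducing_def)
  have "cnj (h y) = of_real (\<Sum>\<^sub>\<infinity>v\<in>verts G. (cmod (h v))\<^sup>2)"
    using h(2) unfolding ell2_inner_self[OF h(1)] by (rule sym)
  then show ?thesis by (metis complex_cnj_cnj complex_cnj_complex_of_real)
qed

lemma reproducing_diagonal_nonneg:
  assumes "reproducing G l y h"
  shows "0 \<le> Re (h y)" "h y = of_real (Re (h y))"
  by (simp_all add: reproducing_diagonal[OF assms] infsum_nonneg)

lemma reproducing_nonzero:
  assumes h: "reproducing G l y h" and \<phi>: "\<phi> \<in> eigenspace G l" "\<phi> y \<noteq> 0"
  shows "h y \<noteq> 0"
proof
  assume "h y = 0"
  have h': "h \<in> eigenspace G l" "ell2_inner (verts G) h h = cnj (h y)" "ell2_inner (verts G) \<phi> h = cnj (\<phi> y)"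
    using h \<phi>(1) by (auto simp: reproducing_def)
  have "h = (\<lambda>_. 0)" using ell2_inner_self_eq_0[OF eigenspaceD(1)[OF h'(1)]] h'(2) \<open>h y = 0\<close> by simp
  then have "ell2_inner (verts G) \<phi> h = 0" by (simp add: ell2_inner_def)
  then show False using h'(3) \<phi>(2) by simp
qed

lemma reproducing_unique:
  assumes h: "reproducing G l y h" and h': "reproducing G l y h'"
  shows "h = h'"
proof -
  let ?d = "\<lambda>v. h v - 1 * h' v"
  have K: "h \<in> eigenspace G l" "h' \<in> eigenspace G l" using h h' by (auto simp: reproducing_def)
  have d: "?d \<in> eigenspace G l" using eigenspace_diff_scaled[OF K] .
  note e = eigenspaceD(1)[OF K(1)] eigenspaceD(1)[OF K(2)] eigenspaceD(1)[OF d]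
  have "ell2_inner (verts G) ?d ?d = ell2_inner (verts G) ?d h - ell2_inner (verts G) ?d h'"
    using ell2_inner_add_scaled[OF e(3,1,2), of "-1"] by simp
  also have "\<dots> = 0" using h h' d by (simp add: reproducing_def)
  finally have "?d = (\<lambda>_. 0)" by (rule ell2_inner_self_eq_0[OF e(3)])
  then show ?thesis by (simp add: fun_eq_iff)
qed

text \<open>\<open>-i \<eta> (A - l - i \<eta>)^-1\<close> converges to the projection onto the
  eigenspace. The scaled columns \<open>g k\<close> have l2 norm at most 1, and each of their limit
  points is an eigenfunction with the reproducing property, which determines it.\<close>

lemma scaled_resolvent_tendsto_reproducing:
  assumes G: "connected_lf_graph G" "self_adjoint_graph G" and y: "y \<in> verts G"
    and f: "\<And>k. is_resolvent G (Complex l (1 / real (Suc k))) y (f k)"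
    and bd: "\<And>k. (\<Sum>\<^sub>\<infinity>v\<in>verts G. (cmod (f k v))\<^sup>2) \<le> (1 / Im (Complex l (1 / real (Suc k))))\<^sup>2"
  shows "\<exists>h. reproducing G l y h \<and>
    (\<forall>v. (\<lambda>k. - \<i> * of_real (1 / real (Suc k)) * f k v) \<longlonglongrightarrow> h v)"
proof -
  let ?V = "verts G"
  define c where "c = (\<lambda>k. - \<i> * complex_of_real (1 / real (Suc k)))"
  define z where "z = (\<lambda>k. Complex l (1 / real (Suc k)))"
  define g where "g = (\<lambda>k v. c k * f k v)"
  have zc: "z k = of_real l - c k" for k by (simp add: z_def c_def complex_eq_iff)
  have c: "c \<longlonglongrightarrow> 0"
  proof -
    have "(\<lambda>k. 1 / real (Suc k)) \<longlonglongrightarrow> 0" using lim_1_over_n LIMSEQ_Suc by blast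
    from tendsto_mult[OF tendsto_const[of "- \<i>"] tendsto_of_real[OF this]] show ?thesis by (simp add: c_def)
  qed
  note f' = is_resolventD[OF G(1) y f]
  have cc: "(cmod (c k))\<^sup>2 = (1 / real (Suc k))\<^sup>2" for k
    unfolding c_def norm_mult norm_minus_cancel norm_ii norm_of_real by simp
  have supp: "g k v = 0" if "v \<notin> ?V" for k v using f'(1)[of k] that by (simp add: g_def ell2_def)
  have B: "(\<Sum>v\<in>F. (cmod (g k v))\<^sup>2) \<le> 1" if "finite F" "F \<subseteq> ?V" for k F
  proof -
    have "(\<Sum>v\<in>F. (cmod (g k v))\<^sup>2) = (1 / real (Suc k))\<^sup>2 * (\<Sum>v\<in>F. (cmod (f k v))\<^sup>2)"
      unfolding g_def norm_mult power_mult_distrib cc sum_distrib_left ..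
    also have "\<dots> \<le> (1 / real (Suc k))\<^sup>2 * (\<Sum>\<^sub>\<infinity>v\<in>?V. (cmod (f k v))\<^sup>2)"
      using that f'(1)[of k] by (intro mult_left_mono finite_sum_le_infsum ell2_sumD) auto
    also have "\<dots> \<le> (1 / real (Suc k))\<^sup>2 * (1 / (1 / real (Suc k)))\<^sup>2"
      using bd[of k] by (intro mult_left_mono) auto
    also have "\<dots> = 1" by (simp add: power_divide del: of_nat_Suc)
    finally show ?thesis .
  qed
  have M: "cmod (g k v) \<le> 1" for k v
    using B[of "{v}" k] supp[of v k] by (cases "v \<in> ?V") (auto simp: power_le_one_iff)
  have gell: "g k \<in> ell2 ?V" for k unfolding g_def by (rule ell2_scaled[OF f'(1)])
  \<comment> \<open>Symmetry gives \<open>(l - z k) <\<phi>, f k> = cnj (\<phi> y)\<close>, and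
    \<open>l - z k\<close> is the scaling factor \<open>c k\<close>. The pairing is therefore
    constant in \<open>k\<close> and passes to every weak limit.\<close>
  have gK: "ell2_inner ?V \<phi> (g k) = cnj (\<phi> y)" if \<phi>: "\<phi> \<in> eigenspace G l" for \<phi> k
  proof -
    note \<phi>' = eigenspaceD[OF \<phi>]
    have "of_real l * ell2_inner ?V \<phi> (f k) = ell2_inner ?V (nbsum G \<phi>) (f k)"
      unfolding \<phi>'(2) ell2_inner_scaled_left[OF \<phi>'(1) f'(1)] by simp
    also have "\<dots> = ell2_inner ?V \<phi> (nbsum G (f k))"
      by (rule self_adjoint_graph_symmetric[OF G \<phi>'(1,3) f'(1,3), symmetric])
    also have "\<dots> = cnj (\<phi> y) + z k * ell2_inner ?V \<phi> (f k)"
      unfolding f'(2) ell2_inner_add_scaled[OF \<phi>'(1) basis_vec_ell2[OF y] f'(1)] ell2_inner_basis_vec[OF y] z_def ..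
    finally have "c k * ell2_inner ?V \<phi> (f k) = cnj (\<phi> y)" unfolding zc by (simp add: algebra_simps)
    then show ?thesis unfolding g_def ell2_inner_scaled_right[OF \<phi>'(1) f'(1)] .
  qed
  have lim: "reproducing G l y h" if r: "strict_mono r" and h: "\<And>v. (\<lambda>n. g (r n) v) \<longlonglongrightarrow> h v" for r h
  proof -
    have hell: "h \<in> ell2 ?V" using ell2_pointwise_limit(1)[OF h supp B] .
    have "nbsum G h v = of_real l * h v" for v
    proof (cases "v \<in> ?V")
      case False
      then show ?thesis using hell nbsum_outside[OF connected_lf_graphD(1)[OF G(1)]] by (simp add: ell2_def)
    next
      case True
      have cr: "(\<lambda>n. c (r n)) \<longlonglongrightarrow> 0" using LIMSEQ_subseq_LIMSEQ[OF c r] by (simp add: o_def)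
      \<comment> \<open>The resolvent equation after scaling: an eigenvalue equation at
        \<open>l\<close> with an error that vanishes with \<open>c k\<close>.\<close>
      have "nbsum G (g k) v = c k * basis_vec y v + (of_real l - c k) * g k v" for k
        unfolding g_def nbsum_cmult f'(2) zc[symmetric] by (simp add: z_def algebra_simps)
      moreover have "(\<lambda>n. c (r n) * basis_vec y v + (of_real l - c (r n)) * g (r n) v)
          \<longlonglongrightarrow> 0 * basis_vec y v + (of_real l - 0) * h v"
        by (intro tendsto_intros cr h)
      ultimately have "(\<lambda>n. nbsum G (g (r n)) v) \<longlonglongrightarrow> of_real l * h v" by simp
      moreover have "(\<lambda>n. nbsum G (g (r n)) v) \<longlonglongrightarrow> nbsum G h v"
        unfolding nbsum_def by (intro tendsto_intros h)
      ultimately show ?thesis by (rule LIMSEQ_unique[rotated])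
    qed
    then have K: "h \<in> eigenspace G l" using hell by (auto simp: eigenspace_def)
    have "ell2_inner ?V \<phi> h = cnj (\<phi> y)" if \<phi>: "\<phi> \<in> eigenspace G l" for \<phi>
    proof (rule LIMSEQ_unique)
      show "(\<lambda>n. ell2_inner ?V \<phi> (g (r n))) \<longlonglongrightarrow> ell2_inner ?V \<phi> h"
        by (rule ell2_inner_pointwise_limit[OF eigenspaceD(1)[OF \<phi>] h supp B])
      show "(\<lambda>n. ell2_inner ?V \<phi> (g (r n))) \<longlonglongrightarrow> cnj (\<phi> y)" unfolding gK[OF \<phi>] by (rule tendsto_const)
    qed
    with K show ?thesis by (simp add: reproducing_def)
  qed
  obtain r h where rh: "strict_mono r" "\<And>v. (\<lambda>n. g (r n) v) \<longlonglongrightarrow> h v"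
    using pointwise_bounded_convergent_subseq[of g, OF M] by blast
  have h: "reproducing G l y h" using lim[OF rh] .
  have "(\<lambda>n. g n v) \<longlonglongrightarrow> h v" for v
  proof (rule pointwise_bounded_tendsto[of g, OF M])
    fix r h' assume "strict_mono r" "\<And>v. (\<lambda>n. g (r n) v) \<longlonglongrightarrow> h' v"
    from reproducing_unique[OF lim[OF this] h] show "h' = h" .
  qed
  with h show ?thesis by (auto simp: g_def c_def)
qed

subsection \<open>Trees\<close>

text \<open>A shortest walk from \<open>y\<close> to \<open>x\<close> that avoids the edge would
  close up with the edge to a cycle.\<close>

lemma tree_edge_separates:
  assumes T: "tree G" and xy: "(x, y) \<in> edges G"
  shows "(y, x) \<notin> (edges G - {(x, y), (y, x)})\<^sup>*"
proof
  let ?R = "edges G - {(x, y), (y, x)}"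
  assume "(y, x) \<in> ?R\<^sup>*"
  then have "\<exists>n. (y, x) \<in> ?R ^^ n" by (simp add: rtrancl_power)
  \<comment> \<open>Minimality makes the vertices of the walk distinct, since a repetition could be
    cut out.\<close>
  define n where "n = (LEAST n. (y, x) \<in> ?R ^^ n)"
  have n: "(y, x) \<in> ?R ^^ n" unfolding n_def by (rule LeastI_ex) fact
  have least: "n \<le> m" if "(y, x) \<in> ?R ^^ m" for m unfolding n_def using that by (rule Least_le)
  obtain f where f: "f 0 = y" "f n = x" "\<And>i. i < n \<Longrightarrow> (f i, f (Suc i)) \<in> ?R"
    using n unfolding relpow_fun_conv by blast
  have path: "(f i, f (i + k)) \<in> ?R ^^ k" if "i + k \<le> n" for i k
    using that
  proof (induction k)
    case (Suc k)
    then have "(f i, f (i + k)) \<in> ?R ^^ k" by simp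
    moreover have "(f (i + k), f (Suc (i + k))) \<in> ?R" using Suc.prems by (intro f(3)) simp
    ultimately show ?case unfolding relpow.simps add_Suc_right by (rule relcompI)
  qed simp
  have inj: "f i \<noteq> f j" if ij: "i < j" "j \<le> n" for i j
  proof
    assume eq: "f i = f j"
    have "(y, f i) \<in> ?R ^^ i" using path[of 0 i] ij f(1) by simp
    moreover have "(f i, x) \<in> ?R ^^ (n - j)" using path[of j "n - j"] ij f(2) eq by simp
    ultimately have "(y, x) \<in> ?R ^^ (i + (n - j))" by (auto simp: relpow_add)
    from least[OF this] show False using ij by simp
  qed
  have "x \<noteq> y" using T xy by (auto simp: tree_def connected_lf_graph_def irrefl_def)
  then have "n \<noteq> 0" using f(1,2) by metis
  \<comment> \<open>A walk of length 1 would be the removed edge, so the cycle has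
    \<open>n + 1 \<ge> 3\<close> vertices.\<close>
  moreover have "n \<noteq> 1" using n by auto
  ultimately have len: "3 \<le> Suc n" by simp
  define p where "p = map f [0..<Suc n]"
  have lp: "length p = Suc n" by (simp add: p_def)
  have "inj_on f {0..<Suc n}"
    by (intro linorder_inj_onI) (use inj in auto)
  then have "distinct p" by (simp add: p_def distinct_map del: upt_Suc)
  moreover have "(p ! i, p ! (Suc i mod length p)) \<in> edges G" if i: "i < length p" for i
  proof (cases "i = n")
    case True
    then show ?thesis using xy f(1,2) by (simp add: p_def nth_map del: upt_Suc map_upt_Suc)
  next
    case False
    then have "i < n" using i lp by simp
    then have "p ! i = f i" "p ! (Suc i mod length p) = f (Suc i)"
      using lp by (simp_all add: p_def nth_map del: upt_Suc)
    then show ?thesis using f(3)[OF \<open>i < n\<close>] by simp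
  qed
  ultimately have "cycle_in G p" using len lp by (simp add: cycle_in_def)
  then show False using T by (auto simp: tree_def)
qed

text \<open>Truncating \<open>\<phi>\<close> to the far side of the edge gives \<open>\<phi>'\<close> with \<open>(A - l) \<phi>' = \<phi> y \<cdot> e\<^sub>x\<close>, and the range of
  \<open>A - l\<close> is orthogonal to \<open>\<psi>\<close>.\<close>

lemma tree_eigenfunction_zero_propagates:
  assumes T: "tree G" and sa: "self_adjoint_graph G" and xy: "(x, y) \<in> edges G"
    and \<psi>: "\<psi> \<in> eigenspace G l" "\<psi> x \<noteq> 0" and \<phi>: "\<phi> \<in> eigenspace G l" "\<phi> x = 0"
  shows "\<phi> y = 0"
proof -
  let ?V = "verts G" and ?R = "edges G - {(x, y), (y, x)}"
  have G: "connected_lf_graph G" using T by (simp add: tree_def)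
  note E = connected_lf_graphD[OF G]
  have x: "x \<in> ?V" using xy E(1) by auto
  \<comment> \<open>The branch at \<open>y\<close> after removal of the edge. By \<open>xY\<close>
    and \<open>step\<close>, the only edge leaving it is \<open>(y, x)\<close>.\<close>
  define Y where "Y = {v. (y, v) \<in> ?R\<^sup>*}"
  have yY: "y \<in> Y" by (simp add: Y_def)
  have xY: "x \<notin> Y" using tree_edge_separates[OF T xy] by (simp add: Y_def)
  have step: "w \<in> Y \<or> (v = y \<and> w = x)" if "v \<in> Y" "(v, w) \<in> edges G" for v w
  proof (cases "(v, w) \<in> ?R")
    case True
    then show ?thesis using that(1) by (auto simp: Y_def intro: rtrancl_into_rtrancl)
  next
    case False
    then show ?thesis using that xY by auto
  qed
  define \<phi>' where "\<phi>' = (\<lambda>v. if v \<in> Y then \<phi> v else 0)"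
  note \<phi>K = eigenspaceD[OF \<phi>(1)] and \<psi>K = eigenspaceD[OF \<psi>(1)]
  have \<phi>'ell: "\<phi>' \<in> ell2 ?V"
  proof -
    have "(\<lambda>v. (cmod (\<phi>' v))\<^sup>2) summable_on ?V"
      using ell2_sumD[OF \<phi>K(1)] by (rule summable_on_comparison_test) (auto simp: \<phi>'_def)
    then show ?thesis using \<phi>K(1) by (auto simp: ell2_def \<phi>'_def)
  qed
  \<comment> \<open>On the branch the truncation can drop only the neighbour \<open>x\<close>, where
    \<phi> vanishes. Off the branch only \<open>x\<close> sees it, through \<open>y\<close>.\<close>
  have eq: "nbsum G \<phi>' = (\<lambda>v. of_real l * \<phi>' v + \<phi> y * basis_vec x v)"
  proof
    fix v
    show "nbsum G \<phi>' v = of_real l * \<phi>' v + \<phi> y * basis_vec x v"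
    proof (cases "v \<in> Y")
      case True
      then have "nbsum G \<phi>' v = nbsum G \<phi> v"
        using step \<phi>(2) by (intro nbsum_cong) (auto simp: \<phi>'_def)
      then show ?thesis using True xY \<phi>K(2) by (auto simp: \<phi>'_def basis_vec_def)
    next
      case False
      have nb: "w = y \<and> v = x" if "w \<in> Y" "(v, w) \<in> edges G" for w
        using step[OF that(1), of v] that(2) E(2) False by (auto dest: symD)
      have "nbsum G \<phi>' v = nbsum G (\<lambda>w. if w = y \<and> v = x then \<phi> y else 0) v"
      proof (rule nbsum_cong)
        fix w assume "w \<in> edges G `` {v}"
        then show "\<phi>' w = (if w = y \<and> v = x then \<phi> y else 0)"
          using nb[of w] yY by (cases "w \<in> Y") (auto simp: \<phi>'_def)
      qed
      also have "\<dots> = (if v = x then \<phi> y else 0)"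
        using E(3)[of v] xy by (auto simp: nbsum_def)
      finally show ?thesis using False by (simp add: \<phi>'_def basis_vec_def)
    qed
  qed
  have n: "nbsum G \<phi>' \<in> ell2 ?V"
    unfolding eq by (intro ell2_add_scaled ell2_scaled \<phi>'ell basis_vec_ell2 x)
  \<comment> \<open>The two occurrences of \<open>l <\<psi>, \<phi>'>\<close> cancel and leave
    \<open>\<phi> y * cnj (\<psi> x) = 0\<close>.\<close>
  have "of_real l * ell2_inner ?V \<psi> \<phi>' = ell2_inner ?V (nbsum G \<psi>) \<phi>'"
    unfolding \<psi>K(2) ell2_inner_scaled_left[OF \<psi>K(1) \<phi>'ell] by simp
  also have "\<dots> = ell2_inner ?V \<psi> (nbsum G \<phi>')"
    by (rule self_adjoint_graph_symmetric[OF G sa \<psi>K(1,3) \<phi>'ell n, symmetric])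
  also have "\<dots> = of_real l * ell2_inner ?V \<psi> \<phi>' + \<phi> y * cnj (\<psi> x)"
    unfolding eq ell2_inner_add_scaled[OF \<psi>K(1) ell2_scaled[OF \<phi>'ell] basis_vec_ell2[OF x]]
      ell2_inner_scaled_right[OF \<psi>K(1) \<phi>'ell] ell2_inner_basis_vec[OF x] ..
  finally show ?thesis using \<psi>(2) by simp
qed

section \<open>Components of the set of vertices charged by the eigenspace\<close>

definition eigensupport :: "graph \<Rightarrow> real \<Rightarrow> nat set" where
  "eigensupport G l = {v. \<exists>\<phi>\<in>eigenspace G l. \<phi> v \<noteq> 0}"

definition support_component :: "graph \<Rightarrow> real \<Rightarrow> nat \<Rightarrow> nat set" where
  "support_component G l x = {v. (x, v) \<in> (edges G \<inter> eigensupport G l \<times> eigensupport G l)\<^sup>*}"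

lemma support_component_subset:
  assumes "x \<in> eigensupport G l"
  shows "support_component G l x \<subseteq> eigensupport G l"
proof
  fix v assume "v \<in> support_component G l x"
  then have "(x, v) \<in> (edges G \<inter> eigensupport G l \<times> eigensupport G l)\<^sup>*" by (simp add: support_component_def)
  then show "v \<in> eigensupport G l" by (induction rule: rtrancl_induct) (use assms in auto)
qed

lemma eigensupport_subset: "eigensupport G l \<subseteq> verts G"
  by (auto simp: eigensupport_def eigenspace_def ell2_def)

text \<open>Vanishing propagates along each edge in both directions, because either endpoint is
  charged by some eigenfunction. Hence evaluations at vertices of one component have the same kernel
  on the eigenspace.\<close>

lemma support_component_zero_iff:
  assumes T: "tree G" and sa: "self_adjoint_graph G"
    and v: "v \<in> support_component G l x" and \<phi>: "\<phi> \<in> eigenspace G l"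
  shows "\<phi> x = 0 \<longleftrightarrow> \<phi> v = 0"
proof -
  have "(x, v) \<in> (edges G \<inter> eigensupport G l \<times> eigensupport G l)\<^sup>*" using v by (simp add: support_component_def)
  then show ?thesis
  proof (induction rule: rtrancl_induct)
    case (step v w)
    have sym: "sym (edges G)" using T connected_lf_graphD(2) by (auto simp: tree_def)
    have vw: "(v, w) \<in> edges G" "(w, v) \<in> edges G" using step(2) sym by (auto dest: symD)
    obtain \<psi> \<psi>' where "\<psi> \<in> eigenspace G l" "\<psi> v \<noteq> 0" "\<psi>' \<in> eigenspace G l" "\<psi>' w \<noteq> 0"
      using step(2) by (auto simp: eigensupport_def)
    then have "\<phi> v = 0 \<longleftrightarrow> \<phi> w = 0"
      using tree_eigenfunction_zero_propagates[OF T sa vw(1) _ _ \<phi>]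
        tree_eigenfunction_zero_propagates[OF T sa vw(2) _ _ \<phi>] by blast
    with step(3) show ?case by simp
  qed simp
qed

text \<open>Here \<open>h = P e_x\<close> and \<open>k = P e_y\<close>. Evaluations with equal
  kernels are proportional, so \<open>P\<close> has rank one on the component and its 2 by 2 minors
  vanish there.\<close>

lemma reproducing_support_component:
  assumes T: "tree G" and sa: "self_adjoint_graph G"
    and x: "x \<in> eigensupport G l" and y: "y \<in> support_component G l x"
    and h: "reproducing G l x h" "reproducing G l y k"
  shows "(cmod (k x))\<^sup>2 = Re (h x) * Re (k y)" "0 < Re (k y)"
proof -
  have K: "h \<in> eigenspace G l" "k \<in> eigenspace G l" using h by (auto simp: reproducing_def)
  have nz: "h x \<noteq> 0" using x reproducing_nonzero[OF h(1)] by (auto simp: eigensupport_def)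
  have "y \<in> eigensupport G l" using support_component_subset[OF x] y by blast
  then have "k y \<noteq> 0" using reproducing_nonzero[OF h(2)] by (auto simp: eigensupport_def)
  then show "0 < Re (k y)" using reproducing_diagonal_nonneg[OF h(2)] by (metis less_eq_real_def of_real_0)
  have "cnj (k x) = ell2_inner (verts G) k h" using h(1) K(2) by (simp add: reproducing_def)
  also have "\<dots> = cnj (ell2_inner (verts G) h k)" by (rule ell2_inner_commute)
  also have "\<dots> = h y" using h(2) K(1) by (simp add: reproducing_def)
  finally have hy: "h y = cnj (k x)" by simp
  \<comment> \<open>The combination vanishes at \<open>x\<close> by choice of the coefficient, hence
    at \<open>y\<close>. With \<open>h y = cnj (k x)\<close> this is the identity of
    squares.\<close>
  have "(\<lambda>v. k v - (k x / h x) * h v) \<in> eigenspace G l" by (rule eigenspace_diff_scaled[OF K(2,1)])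
  from support_component_zero_iff[OF T sa y this] nz have "k y - (k x / h x) * h y = 0" by simp
  then have "k x * cnj (k x) = h x * k y" using nz hy by (simp add: field_simps)
  then have "complex_of_real ((cmod (k x))\<^sup>2) = of_real (Re (h x) * Re (k y))"
    using reproducing_diagonal_nonneg(2)[OF h(1)] reproducing_diagonal_nonneg(2)[OF h(2)]
    by (metis complex_norm_square of_real_mult of_real_power)
  then show "(cmod (k x))\<^sup>2 = Re (h x) * Re (k y)" by (rule of_real_eq_iff[THEN iffD1])
qed

definition component_graph :: "graph \<Rightarrow> real \<Rightarrow> nat \<Rightarrow> graph" where
  "component_graph G l x = Graph (support_component G l x)
     (edges G \<inter> support_component G l x \<times> support_component G l x)"

text \<open>A neighbour of the component outside it is not charged by the eigenspace, so \<phi>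
  vanishes there and the restriction of \<phi> remains an eigenfunction.\<close>

lemma nbsum_component_graph:
  assumes x: "x \<in> eigensupport G l" and \<phi>: "\<phi> \<in> eigenspace G l" and v: "v \<in> support_component G l x"
    and lf: "finite (edges G `` {v})"
  shows "nbsum (component_graph G l x) \<phi> v = of_real l * \<phi> v"
proof -
  let ?C = "support_component G l x"
  have "\<phi> w = 0" if w: "(v, w) \<in> edges G" "w \<notin> ?C" for w
  proof (rule ccontr)
    assume "\<phi> w \<noteq> 0"
    then have "w \<in> eigensupport G l" using \<phi> by (auto simp: eigensupport_def)
    moreover have "v \<in> eigensupport G l" using v support_component_subset[OF x] by blast
    ultimately have "w \<in> ?C" using v w(1) by (auto simp: support_component_def intro: rtrancl_into_rtrancl)
    then show False using w(2) by simp
  qed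
  then have "nbsum (component_graph G l x) \<phi> v = nbsum G \<phi> v"
    unfolding nbsum_def component_graph_def using v lf by (intro sum.mono_neutral_left) auto
  then show ?thesis using eigenspaceD(2)[OF \<phi>] by simp
qed

subsection \<open>Eigenvalues of finite graphs\<close>

text \<open>The witness is the characteristic polynomial of the adjacency matrix: monic with integer
  coefficients, and all its complex roots are real by symmetry.\<close>

lemma eigenvalue_finite_graph_totally_real:
  assumes H: "fin_graph H" and f: "\<And>v. v \<in> verts H \<Longrightarrow> nbsum H f v = of_real l * f v"
    and nz: "u \<in> verts H" "f u \<noteq> 0"
  shows "l \<in> totally_real_algebraic_integers"
proof -
  let ?V = "verts H"
  define n where "n = card ?V"
  have V: "finite ?V" "edges H \<subseteq> ?V \<times> ?V" using H by (auto simp: fin_graph_def)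
  obtain e where e: "bij_betw e {0..<n} ?V" using ex_bij_betw_nat_finite[OF V(1)] n_def by blast
  define A :: "int mat" where "A = mat n n (\<lambda>(i, j). if (e i, e j) \<in> edges H then 1 else 0)"
  define p where "p = char_poly A"
  let ?A = "map_mat complex_of_int A"
  have A: "A \<in> carrier_mat n n" by (simp add: A_def)
  then have A': "?A \<in> carrier_mat n n" by simp
  have p: "poly (map_poly of_int p) z = 0 \<longleftrightarrow> eigenvalue ?A z" for z :: complex
    unfolding eigenvalue_root_char_poly[OF A'] p_def of_int_hom.char_poly_hom[OF A] ..
  have mult: "vec_index (?A *\<^sub>v vec n (\<lambda>i. g (e i))) i = nbsum H g (e i)" if i: "i < n" for g i
  proof -
    have "vec_index (?A *\<^sub>v vec n (\<lambda>i. g (e i))) i = (\<Sum>j\<in>{0..<n}. if (e i, e j) \<in> edges H then g (e j) else 0)"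
      using i by (auto simp: A_def scalar_prod_def intro!: sum.cong)
    also have "\<dots> = (\<Sum>v\<in>?V. if (e i, v) \<in> edges H then g v else 0)"
      using e by (rule sum.reindex_bij_betw)
    also have "\<dots> = (\<Sum>v\<in>{v\<in>?V. (e i, v) \<in> edges H}. g v)" using V(1) by (simp add: sum.inter_filter)
    also have "{v\<in>?V. (e i, v) \<in> edges H} = edges H `` {e i}" using V(2) by auto
    finally show ?thesis by (simp add: nbsum_def)
  qed
  have real: "z \<in> \<real>" if z: "poly (map_poly of_int p) z = 0" for z :: complex
  proof (rule ccontr)
    assume "z \<notin> \<real>"
    \<comment> \<open>An eigenvector for a nonreal root, read as the function \<open>g\<close> on
      the vertices, contradicts \<open>nonreal_eigenfunction_eq_0\<close>.\<close>
    obtain w where w: "w \<in> carrier_vec n" "w \<noteq> 0\<^sub>v n" "?A *\<^sub>v w = z \<cdot>\<^sub>v w"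
      using z A unfolding p eigenvalue_def eigenvector_def by auto
    define g where "g = (\<lambda>v. vec_index w (inv_into {0..<n} e v))"
    have we: "w = vec n (\<lambda>i. g (e i))"
      using w(1) bij_betw_inv_into_left[OF e] by (intro eq_vecI) (auto simp: g_def)
    have "nbsum H g v = z * g v" if "v \<in> ?V" for v
    proof -
      have "v \<in> e ` {0..<n}" using that bij_betw_imp_surj_on[OF e] by simp
      then obtain i where i: "i < n" "v = e i" by auto
      have "nbsum H g v = vec_index (z \<cdot>\<^sub>v w) i" using mult[OF i(1), of g] w(3) i(2) we by simp
      also have "\<dots> = z * g v" using w(1) i we by (metis carrier_vecD index_smult_vec(1) index_vec)
      finally show ?thesis .
    qed
    from nonreal_eigenfunction_eq_0[OF H \<open>z \<notin> \<real>\<close> this] have "\<forall>v\<in>?V. g v = 0" .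
    then have "vec_index w i = 0" if "i < n" for i
      using that e unfolding we by (auto simp: bij_betw_def)
    then have "w = 0\<^sub>v n" using w(1) by (intro eq_vecI) auto
    with w(2) show False by simp
  qed
  have "eigenvalue ?A (of_real l)"
    unfolding eigenvalue_def eigenvector_def
  proof (intro exI[of _ "vec n (\<lambda>i. f (e i))"] conjI)
    have "u \<in> e ` {0..<n}" using nz(1) bij_betw_imp_surj_on[OF e] by simp
    then obtain i where i: "i < n" "u = e i" by auto
    show "vec n (\<lambda>i. f (e i)) \<noteq> 0\<^sub>v (dim_row ?A)"
    proof
      assume "vec n (\<lambda>i. f (e i)) = 0\<^sub>v (dim_row ?A)"
      then have "vec_index (vec n (\<lambda>i. f (e i))) i = vec_index (0\<^sub>v n) i" using A by simp
      then show False using i nz(2) by simp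
    qed
    show "?A *\<^sub>v vec n (\<lambda>i. f (e i)) = of_real l \<cdot>\<^sub>v vec n (\<lambda>i. f (e i))"
    proof (rule eq_vecI)
      fix i assume "i < dim_vec (of_real l \<cdot>\<^sub>v vec n (\<lambda>i. f (e i)))"
      then have i: "i < n" by simp
      then have "e i \<in> ?V" using e by (auto simp: bij_betw_def)
      then show "vec_index (?A *\<^sub>v vec n (\<lambda>i. f (e i))) i = vec_index (of_real l \<cdot>\<^sub>v vec n (\<lambda>i. f (e i))) i"
        using mult[OF i, of f] f i by simp
    qed (use A in simp)
  qed (use A in simp)
  then have "poly (map_poly of_int p) (complex_of_real l) = 0" using p by blast
  moreover have "poly (map_poly of_int q) (complex_of_real l) = complex_of_real (poly (map_poly of_int q) l)" for q
    by (induction q) (simp_all add: map_poly_pCons)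
  ultimately have "poly (map_poly of_int p) l = 0" by simp
  moreover have "lead_coeff p = 1" using degree_monic_char_poly[OF A] by (simp add: p_def)
  ultimately show ?thesis unfolding totally_real_algebraic_integers_def using real by blast
qed

subsection \<open>A local approximation of the transport\<close>

lemma green_iso:
  assumes iso: "iso_map \<phi> H xs H' ys" and fin: "fin_graph H" "fin_graph H'" and z: "z \<notin> \<real>"
    and y: "y \<in> verts H" and v: "v \<in> verts H"
  shows "green H' z (\<phi> y) (\<phi> v) = green H z y v"
proof -
  have b: "bij_betw \<phi> (verts H) (verts H')"
    and e: "\<And>a b. a \<in> verts H \<Longrightarrow> b \<in> verts H \<Longrightarrow> (a, b) \<in> edges H \<longleftrightarrow> (\<phi> a, \<phi> b) \<in> edges H'"
    using iso by (auto simp: iso_map_def)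
  have inj: "inj_on \<phi> (verts H)" using b by (rule bij_betw_imp_inj_on)
  have im: "\<phi> a \<in> verts H'" if "a \<in> verts H" for a using b that by (rule bij_betw_apply)
  let ?g' = "green H' z (\<phi> y)"
  have g': "is_green H' z (\<phi> y) ?g'" by (rule is_green_green[OF fin(2) im[OF y] z])
  define g where "g = (\<lambda>v. if v \<in> verts H then ?g' (\<phi> v) else 0)"
  have "nbsum H g a - z * g a = basis_vec y a" if a: "a \<in> verts H" for a
  proof -
    have nb: "edges H `` {a} \<subseteq> verts H" using fin(1) by (auto simp: fin_graph_def)
    have "edges H' `` {\<phi> a} \<subseteq> verts H'" using fin(2) by (auto simp: fin_graph_def)
    then have "edges H' `` {\<phi> a} \<subseteq> \<phi> ` verts H" using b by (simp add: bij_betw_def)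
    then have eq: "edges H' `` {\<phi> a} = \<phi> ` (edges H `` {a})" using nb e[OF a] by blast
    have "nbsum H' ?g' (\<phi> a) = (\<Sum>w\<in>edges H `` {a}. ?g' (\<phi> w))"
      unfolding nbsum_def eq by (rule sum.reindex_cong[OF inj_on_subset[OF inj nb]]) auto
    also have "\<dots> = nbsum H g a" unfolding nbsum_def using nb by (intro sum.cong) (auto simp: g_def)
    finally have "nbsum H g a = nbsum H' ?g' (\<phi> a)" by (rule sym)
    moreover have "g a = ?g' (\<phi> a)" using a by (simp add: g_def)
    moreover have "nbsum H' ?g' (\<phi> a) - z * ?g' (\<phi> a) = basis_vec (\<phi> y) (\<phi> a)"
      using g' im[OF a] by (simp add: is_green_def)
    ultimately have "nbsum H g a - z * g a = basis_vec (\<phi> y) (\<phi> a)" by (simp only:)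
    then show ?thesis using inj a y by (simp add: basis_vec_def inj_on_eq_iff)
  qed
  then have "is_green H z y g" by (simp add: is_green_def g_def)
  from green_eqI[OF fin(1) z this] show ?thesis using v by (simp add: g_def)
qed

text \<open>Walks of length at most \<open>r\<close> from a root stay in the ball, so the ball
  around \<open>y\<close> can be recovered from the ball around \<open>y\<close> and
  \<open>x\<close>, on which the local metric is based.\<close>

lemma graph_ball_ball_subset:
  assumes "set ys \<subseteq> set xs"
  shows "graph_ball (graph_ball G xs r) ys r = graph_ball G ys r"
proof -
  have "edges (graph_ball G xs r) \<subseteq> edges G" by (auto simp: graph_ball_def)
  then have "edges (graph_ball G xs r) ^^ n \<subseteq> edges G ^^ n" for n
    by (induction n) auto
  then have "(s, v) \<in> edges (graph_ball G xs r) ^^ n \<longleftrightarrow> (s, v) \<in> edges G ^^ n"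
    if "s \<in> set ys" "real n \<le> r" for s v n
    using relpow_in_ball[of s v n G xs r] that assms by auto
  then have 1: "ball_verts (graph_ball G xs r) ys r = ball_verts G ys r" unfolding ball_verts_def by blast
  have "ball_verts G ys r \<subseteq> ball_verts G xs r" using assms unfolding ball_verts_def by blast
  then show ?thesis unfolding graph_ball_def[of _ ys r] 1 by (auto simp: graph_ball_def)
qed

text \<open>With \<open>\<eta> = 1 / (k + 1)\<close> and \<open>q = -i \<eta> g\<close> this is
  \<open>|q x|^2 / Re (q y)\<close>, the approximation of \<open>|P(y,x)|^2 / P(y,y)\<close> on the
  ball of radius \<open>n\<close>. The vertex \<open>y\<close> sends and \<open>x\<close>
  receives.\<close>

definition weight :: "real \<Rightarrow> nat \<Rightarrow> nat \<Rightarrow> graph \<Rightarrow> nat \<Rightarrow> nat \<Rightarrow> real" where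
  "weight l k n G y x = (let g = green (graph_ball G [y] (real n)) (Complex l (1 / real (Suc k))) y
     in 1 / real (Suc k) * (cmod (g x))\<^sup>2 / Im (g y))"

lemma nonreal_Complex: "Complex l (1 / real (Suc k)) \<notin> \<real>"
  by (simp add: complex_is_Real_iff)

lemma weight_iso:
  assumes iso: "iso_map \<phi> G [y, x] H [y', x']" and wf: "wf_marked G [y, x]" "wf_marked H [y', x']"
    and fin: "fin_graph (graph_ball G [y] (real n))" "fin_graph (graph_ball H [y'] (real n))"
  shows "weight l k n G y x = weight l k n H y' x'"
proof -
  let ?B = "graph_ball G [y] (real n)" and ?B' = "graph_ball H [y'] (real n)"
  let ?z = "Complex l (1 / real (Suc k))"
  have "iso_map \<phi> G [y] H [y']" using iso by (simp add: iso_map_def)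
  moreover have "wf_marked G [y]" "wf_marked H [y']" using wf by (auto simp: wf_marked_def)
  ultimately have B: "iso_map \<phi> ?B [y] ?B' [y']" by (rule iso_map_ball)
  have y': "y' = \<phi> y" "x' = \<phi> x" using iso by (auto simp: iso_map_def)
  have y: "y \<in> verts ?B" "y' \<in> verts ?B'"
    using roots_in_ball[of "real n" "[y]" G] roots_in_ball[of "real n" "[y']" H] by (simp_all add: graph_ball_def)
  have "green ?B' ?z y' x' = green ?B ?z y x"
  proof (cases "x \<in> verts ?B")
    case True
    from green_iso[OF B fin nonreal_Complex y(1) this] show ?thesis unfolding y' .
  next
    \<comment> \<open>The receiver may lie outside the ball of the sender. Injectivity on all of
      \<open>verts G\<close> keeps its image outside too, and both columns are zero there.\<close>
    case False
    have inj: "inj_on \<phi> (verts G)" using iso by (simp add: iso_map_def bij_betw_def)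
    have "verts ?B' = \<phi> ` verts ?B" using B by (simp add: iso_map_def bij_betw_def)
    moreover have "verts ?B \<subseteq> verts G" "x \<in> verts G"
      using ball_verts_subset[OF \<open>wf_marked G [y]\<close>] wf(1) by (simp_all add: graph_ball_def wf_marked_def)
    ultimately have "x' \<notin> verts ?B'" using False inj unfolding y' by (auto simp: inj_on_def)
    then show ?thesis
      using is_green_green[OF fin(1) y(1) nonreal_Complex] is_green_green[OF fin(2) y(2) nonreal_Complex] False
      by (simp add: is_green_def)
  qed
  moreover have "green ?B' ?z y' y' = green ?B ?z y y"
    unfolding y' using green_iso[OF B fin nonreal_Complex y(1) y(1)] unfolding y' .
  ultimately show ?thesis by (simp only: weight_def Let_def)
qed

lemma weight_local:
  assumes G: "connected_lf_graph G" "{y, x} \<subseteq> verts G" and H: "connected_lf_graph H" "{y', x'} \<subseteq> verts H"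
    and iso: "isomorphic (graph_ball G [y, x] (real n)) [y, x] (graph_ball H [y', x'] (real n)) [y', x']"
  shows "weight l k n G y x = weight l k n H y' x'"
proof -
  have sub: "graph_ball (graph_ball K [a, b] (real n)) [a] (real n) = graph_ball K [a] (real n)" for K a b
    by (rule graph_ball_ball_subset) simp
  have "weight l k n (graph_ball G [y, x] (real n)) y x = weight l k n (graph_ball H [y', x'] (real n)) y' x'"
  proof -
    obtain \<phi> where "iso_map \<phi> (graph_ball G [y, x] (real n)) [y, x] (graph_ball H [y', x'] (real n)) [y', x']"
      using iso by (auto simp: isomorphic_def)
    then show ?thesis
      by (rule weight_iso) (use G H in \<open>auto simp: sub intro!: wf_marked_ball fin_graph_ball\<close>)
  qed
  then show ?thesis by (simp only: weight_def sub)
qed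

text \<open>By \<open>is_green_norm\<close> the numerators sum exactly to the denominator
  \<open>Im (g y)\<close>.\<close>

lemma sum_weight_le_1:
  assumes G: "connected_lf_graph G" and y: "y \<in> verts G"
  shows "(\<integral>\<^sup>+x. ennreal (weight l k n G y x) \<partial>count_space (verts G)) \<le> 1"
proof -
  let ?H = "graph_ball G [y] (real n)"
  define g where "g = green ?H (Complex l (1 / real (Suc k))) y"
  have H: "fin_graph ?H" using fin_graph_ball[OF G] y by simp
  have yH: "y \<in> verts ?H" using roots_in_ball[of "real n" "[y]" G] by (simp add: graph_ball_def)
  have g: "is_green ?H (Complex l (1 / real (Suc k))) y g"
    unfolding g_def by (rule is_green_green[OF H yH nonreal_Complex])
  have norm: "1 / real (Suc k) * (\<Sum>v\<in>verts ?H. (cmod (g v))\<^sup>2) = Im (g y)"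
    using is_green_norm[OF H yH g] by simp
  have Im0: "0 \<le> Im (g y)" unfolding norm[symmetric] by (simp add: sum_nonneg)
  have w: "weight l k n G y x = 1 / real (Suc k) * (cmod (g x))\<^sup>2 / Im (g y)" for x
    unfolding weight_def Let_def g_def ..
  have "(\<integral>\<^sup>+x. ennreal (weight l k n G y x) \<partial>count_space (verts G)) = (\<Sum>x\<in>verts ?H. ennreal (weight l k n G y x))"
  proof (rule nn_integral_count_space')
    show "finite (verts ?H)" using H by (simp add: fin_graph_def)
    show "verts ?H \<subseteq> verts G"
      using ball_verts_subset[of G "[y]"] G y by (simp add: graph_ball_def wf_markedI)
    show "ennreal (weight l k n G y x) = 0" if "x \<notin> verts ?H" for x
      using g that by (simp add: w is_green_def)
  qed
  also have "\<dots> = ennreal (\<Sum>x\<in>verts ?H. weight l k n G y x)"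
    using Im0 by (intro sum_ennreal) (simp add: w)
  also have "(\<Sum>x\<in>verts ?H. weight l k n G y x) = Im (g y) / Im (g y)"
    unfolding w sum_divide_distrib[symmetric] sum_distrib_left[symmetric] norm ..
  \<comment> \<open>The quotient is 1, or 0 by the convention for division by zero.\<close>
  also have "ennreal (Im (g y) / Im (g y)) \<le> 1" by simp
  finally show ?thesis .
qed

text \<open>The inner limit, over balls at fixed \<open>k\<close>. The condition on
  \<open>Im (f k y)\<close> is continuity of the quotient.\<close>

lemma weight_tendsto:
  assumes G: "connected_lf_graph G" "self_adjoint_graph G" and y: "y \<in> verts G"
  shows "\<exists>f. \<forall>k. is_resolvent G (Complex l (1 / real (Suc k))) y (f k) \<and>
    (\<Sum>\<^sub>\<infinity>v\<in>verts G. (cmod (f k v))\<^sup>2) \<le> (1 / Im (Complex l (1 / real (Suc k))))\<^sup>2 \<and>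
    (\<forall>x. Im (f k y) \<noteq> 0 \<longrightarrow>
      (\<lambda>n. weight l k n G y x) \<longlonglongrightarrow> 1 / real (Suc k) * (cmod (f k x))\<^sup>2 / Im (f k y))"
proof -
  have "\<exists>f. is_resolvent G (Complex l (1 / real (Suc k))) y f \<and>
    (\<Sum>\<^sub>\<infinity>v\<in>verts G. (cmod (f v))\<^sup>2) \<le> (1 / Im (Complex l (1 / real (Suc k))))\<^sup>2 \<and>
    (\<forall>v. (\<lambda>n. green (graph_ball G [y] (real n)) (Complex l (1 / real (Suc k))) y v) \<longlonglongrightarrow> f v)" for k
    by (rule green_ball_tendsto[OF G y nonreal_Complex[of l k]]) blast
  then obtain f where f: "\<And>k. is_resolvent G (Complex l (1 / real (Suc k))) y (f k)"
    "\<And>k. (\<Sum>\<^sub>\<infinity>v\<in>verts G. (cmod (f k v))\<^sup>2) \<le> (1 / Im (Complex l (1 / real (Suc k))))\<^sup>2"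
    "\<And>k v. (\<lambda>n. green (graph_ball G [y] (real n)) (Complex l (1 / real (Suc k))) y v) \<longlonglongrightarrow> f k v"
    by metis
  have "(\<lambda>n. weight l k n G y x) \<longlonglongrightarrow> 1 / real (Suc k) * (cmod (f k x))\<^sup>2 / Im (f k y)"
    if "Im (f k y) \<noteq> 0" for k x
    unfolding weight_def Let_def by (intro tendsto_intros f(3) that)
  with f(1,2) show ?thesis by blast
qed

text \<open>The radius goes to infinity first, then \<open>k\<close>; the limit
  \<open>|P(y,x)|^2 / P(y,y)\<close> equals \<open>P(x,x)\<close> by the rank-one identity, whatever
  \<open>y\<close> in the component.\<close>

lemma liminf_weight_support_component:
  assumes T: "tree G" and sa: "self_adjoint_graph G"
    and x: "x \<in> eigensupport G l" and y: "y \<in> support_component G l x"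
    and h: "reproducing G l x h"
  shows "liminf (\<lambda>k. liminf (\<lambda>n. ennreal (weight l k n G y x))) = ennreal (Re (h x))"
proof -
  have G: "connected_lf_graph G" using T by (simp add: tree_def)
  have "y \<in> verts G" using support_component_subset[OF x] eigensupport_subset y by blast
  from weight_tendsto[OF G sa this, of l] obtain f
    where f: "\<And>k. is_resolvent G (Complex l (1 / real (Suc k))) y (f k)"
      "\<And>k. (\<Sum>\<^sub>\<infinity>v\<in>verts G. (cmod (f k v))\<^sup>2) \<le> (1 / Im (Complex l (1 / real (Suc k))))\<^sup>2"
      "\<And>k x. Im (f k y) \<noteq> 0 \<Longrightarrow>
        (\<lambda>n. weight l k n G y x) \<longlonglongrightarrow> 1 / real (Suc k) * (cmod (f k x))\<^sup>2 / Im (f k y)"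
    by blast
  define g where "g = (\<lambda>k v. - \<i> * of_real (1 / real (Suc k)) * f k v)"
  obtain h' where h': "reproducing G l y h'" "\<And>v. (\<lambda>k. g k v) \<longlonglongrightarrow> h' v"
    using scaled_resolvent_tendsto_reproducing[OF G sa \<open>y \<in> verts G\<close> f(1,2)] unfolding g_def by blast
  note rep = reproducing_support_component[OF T sa x y h h'(1)]
  have Reg: "Re (g k y) = 1 / real (Suc k) * Im (f k y)" for k by (simp add: g_def)
  have cg: "(cmod (g k x))\<^sup>2 = (1 / real (Suc k))\<^sup>2 * (cmod (f k x))\<^sup>2" for k
    unfolding g_def norm_mult norm_minus_cancel norm_ii norm_of_real by (simp add: power_mult_distrib power_divide)
  have lim1: "liminf (\<lambda>n. ennreal (weight l k n G y x)) = ennreal ((cmod (g k x))\<^sup>2 / Re (g k y))"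
    if "Re (g k y) > 0" for k
  proof -
    have "Im (f k y) \<noteq> 0" using that by (auto simp: Reg)
    then have "(\<lambda>n. ennreal (weight l k n G y x)) \<longlonglongrightarrow> ennreal (1 / real (Suc k) * (cmod (f k x))\<^sup>2 / Im (f k y))"
      by (intro tendsto_ennrealI f(3))
    from lim_imp_Liminf[OF sequentially_bot this]
    show ?thesis unfolding Reg cg by (simp add: power2_eq_square del: of_nat_Suc)
  qed
  have "(\<lambda>k. Re (g k y)) \<longlonglongrightarrow> Re (h' y)" by (intro tendsto_intros h'(2))
  \<comment> \<open>Since \<open>P(y,y) > 0\<close>, the denominator is positive for all large
    \<open>k\<close>, which is all that the outer liminf sees.\<close>
  from order_tendstoD(1)[OF this rep(2)] have ev: "\<forall>\<^sub>F k in sequentially. 0 < Re (g k y)" .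
  have "(\<lambda>k. ennreal ((cmod (g k x))\<^sup>2 / Re (g k y))) \<longlonglongrightarrow> ennreal ((cmod (h' x))\<^sup>2 / Re (h' y))"
    using rep(2) by (intro tendsto_ennrealI tendsto_intros h'(2)) auto
  also have "(cmod (h' x))\<^sup>2 / Re (h' y) = Re (h x)" using rep by simp
  finally have "(\<lambda>k. ennreal ((cmod (g k x))\<^sup>2 / Re (g k y))) \<longlonglongrightarrow> ennreal (Re (h x))" .
  then have "(\<lambda>k. liminf (\<lambda>n. ennreal (weight l k n G y x))) \<longlonglongrightarrow> ennreal (Re (h x))"
    by (rule Lim_transform_eventually) (use ev in eventually_elim, simp add: lim1)
  then show ?thesis by (rule lim_imp_Liminf[OF sequentially_bot])
qed

text \<open>Both \<open>P(y,y)\<close> and the mass of the atom at \<open>l\<close> are the limit of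
  \<open>-i \<eta>\<close> times the diagonal resolvent entry, so they are equal.\<close>

lemma atom_eigensupport:
  assumes G: "connected_lf_graph G" "self_adjoint_graph G" and y: "y \<in> verts G"
    and atom: "emeasure (spectral_measure_at G y) {l} > 0"
  shows "y \<in> eigensupport G l" "\<exists>h. reproducing G l y h \<and> 0 < Re (h y)"
proof -
  obtain f
    where f: "\<And>k. is_resolvent G (Complex l (1 / real (Suc k))) y (f k)"
      "\<And>k. (\<Sum>\<^sub>\<infinity>v\<in>verts G. (cmod (f k v))\<^sup>2) \<le> (1 / Im (Complex l (1 / real (Suc k))))\<^sup>2"
    using weight_tendsto[OF G y, of l] by blast
  from scaled_resolvent_tendsto_reproducing[OF G y f] obtain h where h: "reproducing G l y h"
    "(\<lambda>k. - \<i> * of_real (1 / real (Suc k)) * f k y) \<longlonglongrightarrow> h y" by blast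
  have hy: "h y = of_real (measure (spectral_measure_at G y) {l})"
    using LIMSEQ_unique[OF h(2) spectral_measure_at_atom[OF G y f(1)]] .
  interpret prob_space "spectral_measure_at G y" by (rule spectral_measure_at_props[OF G y])
  have pos: "measure (spectral_measure_at G y) {l} > 0"
    using atom by (simp add: emeasure_eq_measure)
  then show "\<exists>h. reproducing G l y h \<and> 0 < Re (h y)" using h(1) hy by auto
  have "h y \<noteq> 0" using pos hy by simp
  then show "y \<in> eigensupport G l" using h(1) by (auto simp: eigensupport_def reproducing_def)
qed

subsection \<open>Measurability and mass transport\<close>

lift_definition transport :: "real \<Rightarrow> nat \<Rightarrow> nat \<Rightarrow> birooted_graph \<Rightarrow> ennreal" is
  "\<lambda>l k n (G, y, x). ennreal (weight l k n G y x)"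
proof clarsimp
  fix l :: real and k n :: nat and G H x y x' y'
  assume *: "connected_lf_graph G" "connected_lf_graph H" "y \<in> verts G" "x \<in> verts G" "y' \<in> verts H" "x' \<in> verts H"
    "isomorphic G [y, x] H [y', x']"
  then have "isomorphic (graph_ball G [y, x] (real n)) [y, x] (graph_ball H [y', x'] (real n)) [y', x']"
    by (intro isomorphic_ball) (auto intro: wf_markedI)
  then show "ennreal (weight l k n G y x) = ennreal (weight l k n H y' x')"
    using * by (subst weight_local) auto
qed

text \<open>Such a distance forces an agreement radius strictly above \<open>n\<close>; strictness
  matters because the radius is a supremum.\<close>

lemma agreement_of_local_dist:
  assumes "local_dist G xs H ys < 1 / (1 + real n)"
  shows "isomorphic (graph_ball G xs (real n)) xs (graph_ball H ys (real n)) ys"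
proof (rule agreement_radius_less)
  show "ennreal (real n) < agreement_radius G xs H ys"
  proof (rule ccontr)
    assume "\<not> ?thesis"
    then have "agreement_radius G xs H ys \<le> ennreal (real n)" by simp
    from inverse_radius_mono[OF this] have "1 / (1 + real n) \<le> local_dist G xs H ys"
      unfolding local_dist_def inverse_radius by simp
    then show False using assms by simp
  qed
qed simp

lemma transport_locally_constant:
  assumes "dist a b < 1 / (1 + real n)"
  shows "transport l k n a = transport l k n b"
  using assms
proof (transfer fixing: l k n, clarsimp)
  fix G H x y x' y'
  assume "connected_lf_graph G" "connected_lf_graph H" "y \<in> verts G" "x \<in> verts G" "y' \<in> verts H" "x' \<in> verts H"
    and "local_dist G [y, x] H [y', x'] < 1 / (1 + real n)"
  then show "ennreal (weight l k n G y x) = ennreal (weight l k n H y' x')"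
    using agreement_of_local_dist by (subst weight_local) auto
qed

text \<open>A locally constant function is continuous, hence Borel.\<close>

lemma transport_measurable [measurable]: "transport l k n \<in> borel_measurable borel"
proof (rule borel_measurable_continuous_onI)
  have "isCont (transport l k n) a" for a
    unfolding isCont_def
  proof (rule tendsto_eventually)
    show "\<forall>\<^sub>F b in at a. transport l k n b = transport l k n a"
      unfolding eventually_at using transport_locally_constant
      by (intro exI[of _ "1 / (1 + real n)"]) auto
  qed
  then show "continuous_on UNIV (transport l k n)" by (simp add: continuous_at_imp_continuous_on)
qed

lemma transport_abs:
  assumes "connected_lf_graph G" "y \<in> verts G" "x \<in> verts G"
  shows "transport l k n (abs_birooted_graph (G, y, x)) = ennreal (weight l k n G y x)"
  using assms by (subst transport.abs_eq) (auto simp: isomorphic_refl)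

section \<open>The limiting transport: mass sent and mass received\<close>

lemma rooted_graph_cases:
  obtains G x where "connected_lf_graph G" "x \<in> verts G" "g = abs_rooted_graph (G, x)"
proof -
  obtain G x where r: "rep_rooted_graph g = (G, x)" by force
  have "g = abs_rooted_graph (G, x)" using Quotient_abs_rep[OF Quotient_rooted_graph, of g] r by simp
  moreover have "connected_lf_graph G" "x \<in> verts G"
    using Quotient_rep_reflp[OF Quotient_rooted_graph, of g] r by auto
  ultimately show ?thesis using that by blast
qed

text \<open>The liminf is defined and Borel on the whole space, including graphs on which the limits
  might not exist, and it is the form to which Fatou's lemma applies.\<close>

definition limit_transport :: "real \<Rightarrow> birooted_graph \<Rightarrow> ennreal" where
  "limit_transport l b = liminf (\<lambda>k. liminf (\<lambda>n. transport l k n b))"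

lemma limit_transport_measurable [measurable]: "limit_transport l \<in> borel_measurable borel"
  unfolding limit_transport_def by measurable

text \<open>Fatou's lemma, once for each liminf, from the bound on finite balls.\<close>

lemma mass_sent_limit_transport: "mass_sent (limit_transport l) g \<le> 1"
proof (rule rooted_graph_cases[of g])
  fix G y assume G: "connected_lf_graph G" "y \<in> verts G" and g: "g = abs_rooted_graph (G, y)"
  let ?w = "\<lambda>k n x. ennreal (weight l k n G y x)"
  have "mass_sent (limit_transport l) g
      = (\<integral>\<^sup>+x. limit_transport l (abs_birooted_graph (G, y, x)) \<partial>count_space (verts G))"
    unfolding g using G by (subst mass_sent.abs_eq) (auto simp: isomorphic_refl)
  also have "\<dots> = (\<integral>\<^sup>+x. liminf (\<lambda>k. liminf (\<lambda>n. ?w k n x)) \<partial>count_space (verts G))"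
    using G by (intro nn_integral_cong) (simp add: limit_transport_def transport_abs)
  also have "\<dots> \<le> liminf (\<lambda>k. \<integral>\<^sup>+x. liminf (\<lambda>n. ?w k n x) \<partial>count_space (verts G))"
    by (rule nn_integral_liminf) simp
  also have "\<dots> \<le> liminf (\<lambda>k. 1)"
  proof (intro Liminf_mono always_eventually allI)
    fix k
    have "(\<integral>\<^sup>+x. liminf (\<lambda>n. ?w k n x) \<partial>count_space (verts G))
        \<le> liminf (\<lambda>n. \<integral>\<^sup>+x. ?w k n x \<partial>count_space (verts G))"
      by (rule nn_integral_liminf) simp
    also have "\<dots> \<le> liminf (\<lambda>n. 1)"
      by (intro Liminf_mono always_eventually allI sum_weight_le_1 G)
    finally show "(\<integral>\<^sup>+x. liminf (\<lambda>n. ?w k n x) \<partial>count_space (verts G)) \<le> 1" by (simp add: Liminf_const)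
  qed
  finally show ?thesis by (simp add: Liminf_const)
qed

text \<open>The root receives the same positive amount \<open>P(x,x)\<close> from each vertex of its
  component, so infinite mass follows once the component is infinite.\<close>

lemma mass_received_limit_transport:
  assumes tree: "is_tree g" and l: "l \<notin> totally_real_algebraic_integers"
    and atom: "emeasure (spectral_measure g) {l} > 0"
  shows "mass_received (limit_transport l) g = \<infinity>"
proof (rule rooted_graph_cases[of g])
  fix G x assume G: "connected_lf_graph G" "x \<in> verts G" and g: "g = abs_rooted_graph (G, x)"
  let ?C = "support_component G l x"
  have T: "tree G" using tree unfolding g using G by (subst (asm) is_tree.abs_eq) (auto simp: isomorphic_refl)
  have sm: "emeasure (spectral_measure_at G x) {l} > 0"
    using atom unfolding g using G by (subst (asm) spectral_measure.abs_eq) (auto simp: isomorphic_refl)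
  \<comment> \<open>Otherwise the spectral measure would be the null measure, which has no
    atom.\<close>
  then have sa: "self_adjoint_graph G" by (auto simp: spectral_measure_at_def split: if_splits)
  note supp = atom_eigensupport(1)[OF G(1) sa G(2) sm]
  obtain h where h: "reproducing G l x h" "0 < Re (h x)" using atom_eigensupport(2)[OF G(1) sa G(2) sm] by blast
  have C: "?C \<subseteq> verts G" using support_component_subset[OF supp] eigensupport_subset by blast
  \<comment> \<open>On a finite component \<open>h\<close> would be a nonzero eigenfunction of a
    finite graph, making \<open>l\<close> totally real.\<close>
  have inf: "infinite ?C"
  proof
    assume "finite ?C"
    then have fin: "fin_graph (component_graph G l x)"
      using connected_lf_graphD(2)[OF G(1)] by (auto simp: fin_graph_def component_graph_def sym_def)
    have hK: "h \<in> eigenspace G l" using h(1) by (simp add: reproducing_def)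
    have "l \<in> totally_real_algebraic_integers"
    proof (rule eigenvalue_finite_graph_totally_real[OF fin])
      show "nbsum (component_graph G l x) h v = of_real l * h v" if "v \<in> verts (component_graph G l x)" for v
        using that by (intro nbsum_component_graph[OF supp hK] connected_lf_graphD(3)[OF G(1)])
          (simp add: component_graph_def)
      show "x \<in> verts (component_graph G l x)" by (simp add: component_graph_def support_component_def)
      show "h x \<noteq> 0" using h(2) by auto
    qed
    with l show False ..
  qed
  have "\<infinity> = ennreal (Re (h x)) * emeasure (count_space (verts G)) ?C"
    using inf C h(2) by (simp add: emeasure_count_space ennreal_mult_top)
  also have "\<dots> = (\<integral>\<^sup>+y. ennreal (Re (h x)) * indicator ?C y \<partial>count_space (verts G))"
    using C by (simp add: nn_integral_cmult_indicator)
  also have "\<dots> \<le> (\<integral>\<^sup>+y. limit_transport l (abs_birooted_graph (G, y, x)) \<partial>count_space (verts G))"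
  proof (rule nn_integral_mono)
    fix y assume "y \<in> space (count_space (verts G))"
    then have y: "y \<in> verts G" by simp
    show "ennreal (Re (h x)) * indicator ?C y \<le> limit_transport l (abs_birooted_graph (G, y, x))"
    proof (cases "y \<in> ?C")
      case True
      then show ?thesis
        using liminf_weight_support_component[OF T sa supp True h(1)] G y
        by (simp add: limit_transport_def transport_abs)
    qed simp
  qed
  also have "\<dots> = mass_received (limit_transport l) g"
    unfolding g using G by (subst mass_received.abs_eq) (auto simp: isomorphic_refl)
  finally show ?thesis by (simp add: top_unique)
qed

theorem corollary3:
  fixes L :: "rooted_graph measure"
  assumes "unimodular L"
    and "concentrated_on_trees L"
  shows "pure_point_support L \<subseteq> totally_real_algebraic_integers"
proof (rule subsetI, rule ccontr)
  fix l assume "l \<in> pure_point_support L" and l: "l \<notin> totally_real_algebraic_integers"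
  let ?a = "\<lambda>g. emeasure (spectral_measure g) {l}" and ?F = "limit_transport l"
  interpret prob_space L using assms(1) by (simp add: unimodular_def)
  have "0 < (\<integral>\<^sup>+g. ?a g \<partial>L)"
    using \<open>l \<in> pure_point_support L\<close> by (simp add: pure_point_support_def mean_spectral_measure_def)
  \<comment> \<open>The integral is the supremum over simple functions below the integrand. A simple
    minorant with positive integral gives a measurable set \<open>B\<close> of positive measure on
    which the atom is present, without appeal to measurability of the integrand.\<close>
  then obtain s where s: "simple_function L s" "s \<le> ?a" "0 < integral\<^sup>S L s"
    unfolding nn_integral_def less_SUP_iff by blast
  define B where "B = {g \<in> space L. s g \<noteq> 0}"
  have sm: "s \<in> borel_measurable L" using s(1) by (rule borel_measurable_simple_function)
  have B: "B \<in> sets L" unfolding B_def using sm by measurable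
  have "integral\<^sup>N L s \<noteq> 0" using s(1,3) by (simp add: nn_integral_eq_simple_integral)
  then have "emeasure L B \<noteq> 0" unfolding B_def using sm by (simp add: nn_integral_0_iff)
  then have "\<infinity> = \<infinity> * emeasure L B" by (simp add: ennreal_top_mult)
  also have "\<dots> = (\<integral>\<^sup>+g. \<infinity> * indicator B g \<partial>L)"
    using B by (rule nn_integral_cmult_indicator[symmetric])
  also have "\<dots> \<le> (\<integral>\<^sup>+g. mass_received ?F g \<partial>L)"
  proof (rule nn_integral_mono_AE)
    have "AE g in L. is_tree g" using assms(2) by (simp add: concentrated_on_trees_def)
    then show "AE g in L. \<infinity> * indicator B g \<le> mass_received ?F g"
    proof eventually_elim
      case (elim g)
      have "?a g > 0" if "g \<in> B"
      proof -
        have "s g > 0" using that by (simp add: B_def zero_less_iff_neq_zero)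
        then show ?thesis using le_funD[OF s(2), of g] by (rule less_le_trans)
      qed
      then show ?case using mass_received_limit_transport[OF elim l] by (cases "g \<in> B") auto
    qed
  qed
  also have "\<dots> = (\<integral>\<^sup>+g. mass_sent ?F g \<partial>L)" using assms(1) by (simp add: unimodular_def)
  also have "\<dots> \<le> (\<integral>\<^sup>+g. 1 \<partial>L)" by (intro nn_integral_mono mass_sent_limit_transport)
  also have "\<dots> = 1" by (simp add: emeasure_space_1)
  finally show False by (simp add: top_unique)
qed

end
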